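(* Let $p$ be an odd prime, $a_0,a_1\in\mathbb F_p$, and let $$G_{\vec a}=\langle \sigma_1,\sigma_2,\sigma_3:\ \sigma_1^p=\sigma_3^{a_1},\ \sigma_2^p=\sigma_3^p=1,\ \sigma_3\in Z(G_{\vec a}),\ \sigma_2\sigma_1=\sigma_1\sigma_2\sigma_3^{a_0}\rangle .$$ Let $K_0$ be a field of characteristic $p$ and $K_3/K_0$ a Galois extension of degree $p^3$ with $\mathrm{Gal}(K_3/K_0)\cong G_{\vec a}$; identify the two groups. Let $K_2$ be the fixed field of $\langle\sigma_3\rangle$ and $K_1$ the fixed field of $\langle\sigma_2,\sigma_3\rangle$. Let $x_1\in K_1$ and $x_2\in K_2$ be such that $K_1=K_0(x_1)$, $K_2=K_0(x_1,x_2)$, $(\sigma_1-1)x_1=1$, $(\sigma_2-1)x_2=1$, $(\sigma_1-1)x_2=0$, and $\wp(x_1)=\beta_1$, $\wp(x_2)=\beta_2$ for some $\beta_1,\beta_2\in K_0$. Then one can select $x_3\in K_3$ with $(\sigma_3-1)x_3=1$ such that $K_3=K_0(x_1,x_2,x_3)$ and $$x_3^p-x_3=a_0\beta_2x_1+a_1D_1(x_1)+\beta_3$$ for some $\beta_3\in K_0$. Conversely, if $K_0$ is a field of characteristic $p$ and $K_3/K_0$ is an algebraic extension of degree $p^3$ with $K_3=K_0(x_1,x_2,x_3)$, where $\wp(x_1)=\beta_1$, $\wp(x_2)=\beta_2$ and $\wp(x_3)=a_0\beta_2x_1+a_1D_1(x_1)+\beta_3$ for some $\beta_1,\beta_2,\beta_3\in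 K_0$, then $K_3/K_0$ is a Galois extension with Galois group isomorphic to $G_{\vec a}$.
   Context: $\wp(x)=x^p-x$. For an automorphism $\sigma$ and an element $x$, $(\sigma-1)x=\sigma(x)-x$. $D_1\in\mathbb F_p[x]$ is the reduction modulo $p$ of the integer polynomial $$\frac{x^p+(x^p-x)^p-(x+(x^p-x))^p}{p},$$ so that if $\wp(x)=\beta$ then $D_1(x)=-\sum_{i=1}^{p-1}\frac1p\binom{p}{i}x^i\beta^{p-i}$. For $\vec a=(0,0),(0,1),(1,0),(1,1)$ the group $G_{\vec a}$ is, respectively, $C_p^3$, $C_{p^2}\times C_p$, the Heisenberg group of order $p^3$, and the metacyclic non-Abelian group of order $p^3$ and exponent $p^2$. *)

theory Defs
  imports "HOL-Algebra.Algebra" "HOL-Computational_Algebra.Computational_Algebra"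
begin

section \<open>Groups given by generators and relations\<close>

text \<open>
  A word is a list of letters; the letter \<open>(g, True)\<close> stands for the generator \<open>g\<close> and
  \<open>(g, False)\<close> for its formal inverse.  A relation \<open>u = v\<close> is the pair \<open>(u, v)\<close>.
\<close>

type_synonym 'g word = "('g \<times> bool) list"

inductive word_cong :: "('g word \<times> 'g word) set \<Rightarrow> 'g word \<Rightarrow> 'g word \<Rightarrow> bool" for R where
  rel: "(u, v) \<in> R \<Longrightarrow> word_cong R u v"
| cancel: "word_cong R [(g, b), (g, \<not> b)] []"
| refl: "word_cong R u u"
| sym: "word_cong R u v \<Longrightarrow> word_cong R v u"
| trans: "word_cong R u v \<Longrightarrow> word_cong R v w \<Longrightarrow> word_cong R u w"
| app: "word_cong R u u' \<Longrightarrow> word_cong R v v' \<Longrightarrow> word_cong R (u @ v) (u' @ v')"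

definition word_class :: "('g word \<times> 'g word) set \<Rightarrow> 'g word \<Rightarrow> 'g word set" where
  "word_class R u = {v. word_cong R u v}"

definition presented_group :: "('g word \<times> 'g word) set \<Rightarrow> 'g word set monoid" where
  "presented_group R =
     \<lparr>carrier = range (word_class R),
      monoid.mult = (\<lambda>A B. \<Union>u\<in>A. \<Union>v\<in>B. word_class R (u @ v)),
      monoid.one = word_class R []\<rparr>"

lemma word_class_eq_iff: "word_class R u = word_class R v \<longleftrightarrow> word_cong R u v"
proof
  assume "word_class R u = word_class R v"
  moreover have "v \<in> word_class R v" by (simp add: word_class_def word_cong.refl)
  ultimately have "v \<in> word_class R u" by simp
  then show "word_cong R u v" by (simp add: word_class_def)
next
  assume uv: "word_cong R u v"
  have "word_cong R u w \<longleftrightarrow> word_cong R v w" for w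
    using word_cong.trans[OF uv] word_cong.trans[OF word_cong.sym[OF uv]] by blast
  then show "word_class R u = word_class R v" by (simp add: word_class_def)
qed

lemma mult_word_class:
  "word_class R u \<otimes>\<^bsub>presented_group R\<^esub> word_class R v = word_class R (u @ v)"
proof -
  have eq: "word_class R (u' @ v') = word_class R (u @ v)"
    if "u' \<in> word_class R u" "v' \<in> word_class R v" for u' v'
  proof -
    have "word_cong R u u'" "word_cong R v v'"
      using that by (simp_all add: word_class_def)
    then have "word_cong R (u @ v) (u' @ v')" by (rule word_cong.app)
    then show ?thesis by (simp only: word_class_eq_iff word_cong.sym)
  qed
  have "u \<in> word_class R u" "v \<in> word_class R v"
    by (simp_all add: word_class_def word_cong.refl)
  then have "(\<Union>u'\<in>word_class R u. \<Union>v'\<in>word_class R v. word_class R (u' @ v'))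
      = word_class R (u @ v)"
    using eq by blast
  then show ?thesis by (simp add: presented_group_def)
qed

lemma group_presented_group: "group (presented_group R)"
proof (rule groupI)
  let ?G = "presented_group R"
  have car: "carrier ?G = range (word_class R)" and one: "\<one>\<^bsub>?G\<^esub> = word_class R []"
    by (simp_all add: presented_group_def)
  have inv: "word_cong R (rev (map (\<lambda>(g, b). (g, \<not> b)) u) @ u) []" for u :: "'a word"
  proof (induction u)
    case (Cons l u)
    obtain g b where l: "l = (g, b)" by fastforce
    let ?i = "rev (map (\<lambda>(g, b). (g, \<not> b)) u)"
    have "word_cong R [(g, \<not> b), (g, b)] []"
      using word_cong.cancel[of R g "\<not> b"] by simp
    then have "word_cong R (?i @ ([(g, \<not> b), (g, b)] @ u)) (?i @ ([] @ u))"
      by (intro word_cong.app word_cong.refl)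
    from word_cong.trans[OF this, of "[]"] Cons show ?case by (simp add: l)
  qed (simp add: word_cong.refl)
  show "\<one>\<^bsub>?G\<^esub> \<in> carrier ?G"
    by (simp add: car one)
  fix x assume "x \<in> carrier ?G"
  then obtain u where x: "x = word_class R u" using car by auto
  show "\<one>\<^bsub>?G\<^esub> \<otimes>\<^bsub>?G\<^esub> x = x"
    by (simp add: x one mult_word_class)
  show "\<exists>y\<in>carrier ?G. y \<otimes>\<^bsub>?G\<^esub> x = \<one>\<^bsub>?G\<^esub>"
  proof
    let ?y = "word_class R (rev (map (\<lambda>(g, b). (g, \<not> b)) u))"
    show "?y \<otimes>\<^bsub>?G\<^esub> x = \<one>\<^bsub>?G\<^esub>"
      using inv[of u] by (simp add: x one mult_word_class word_class_eq_iff)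
    show "?y \<in> carrier ?G" by (simp add: car)
  qed
  fix y assume "y \<in> carrier ?G"
  then obtain v where y: "y = word_class R v" using car by auto
  show "x \<otimes>\<^bsub>?G\<^esub> y \<in> carrier ?G"
    by (simp add: x y car mult_word_class)
  fix z assume "z \<in> carrier ?G"
  then obtain w where z: "z = word_class R w" using car by auto
  show "x \<otimes>\<^bsub>?G\<^esub> y \<otimes>\<^bsub>?G\<^esub> z = x \<otimes>\<^bsub>?G\<^esub> (y \<otimes>\<^bsub>?G\<^esub> z)"
    by (simp add: x y z mult_word_class)
qed

datatype gen = S1 | S2 | S3

text \<open>
  The parameters \<open>a\<^sub>0, a\<^sub>1 \<in> \<int>/p\<close> are represented by natural numbers below \<open>p\<close>.  The last
  family of relations says that the third generator commutes with every word.
\<close>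

definition G_rels :: "nat \<Rightarrow> nat \<Rightarrow> nat \<Rightarrow> (gen word \<times> gen word) set" where
  "G_rels p a0 a1 =
     (let s1 = (S1, True); s2 = (S2, True); s3 = (S3, True) in
      {(replicate p s1, replicate a1 s3),
       (replicate p s2, []),
       (replicate p s3, []),
       ([s2, s1], [s1, s2] @ replicate a0 s3)}
      \<union> {([s3] @ w, w @ [s3]) | w. True})"

definition G_group :: "nat \<Rightarrow> nat \<Rightarrow> nat \<Rightarrow> gen word set monoid" where
  "G_group p a0 a1 = presented_group (G_rels p a0 a1)"

definition G_gen :: "nat \<Rightarrow> nat \<Rightarrow> nat \<Rightarrow> gen \<Rightarrow> gen word set" where
  "G_gen p a0 a1 s = word_class (G_rels p a0 a1) [(s, True)]"

section \<open>Galois extensions\<close>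

definition ring_char :: "('a, 'b) ring_scheme \<Rightarrow> nat" where
  "ring_char R = Gcd {n :: nat. add_pow R n \<one>\<^bsub>R\<^esub> = \<zero>\<^bsub>R\<^esub>}"

text \<open>
  As in \<^const>\<open>AutoGroup\<close>, automorphisms are extensional (undefined off the carrier), and
  the product of \<open>\<sigma>\<close> and \<open>\<tau>\<close> is \<open>x \<mapsto> \<sigma> (\<tau> x)\<close>.
\<close>

definition Gal :: "('a, 'b) ring_scheme \<Rightarrow> 'a set \<Rightarrow> ('a \<Rightarrow> 'a) monoid" where
  "Gal L K = BijGroup (carrier L)
     \<lparr>carrier := {\<sigma> \<in> ring_hom L L \<inter> Bij (carrier L). \<forall>k\<in>K. \<sigma> k = k}\<rparr>"

definition fixed_field :: "('a, 'b) ring_scheme \<Rightarrow> ('a \<Rightarrow> 'a) set \<Rightarrow> 'a set" where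
  "fixed_field L H = {x \<in> carrier L. \<forall>\<sigma>\<in>H. \<sigma> x = x}"

definition algebraic_extension :: "('a, 'b) ring_scheme \<Rightarrow> 'a set \<Rightarrow> bool" where
  "algebraic_extension L K \<longleftrightarrow> (\<forall>x\<in>carrier L. (ring.algebraic L over K) x)"

text \<open>Galois in the sense of Artin and Bourbaki.\<close>

definition galois_extension :: "('a, 'b) ring_scheme \<Rightarrow> 'a set \<Rightarrow> bool" where
  "galois_extension L K \<longleftrightarrow>
     algebraic_extension L K \<and> fixed_field L (carrier (Gal L K)) = K"

section \<open>The Artin--Schreier operator and the polynomial \<open>D\<^sub>1\<close>\<close>

definition wp :: "('a, 'b) ring_scheme \<Rightarrow> nat \<Rightarrow> 'a \<Rightarrow> 'a" where
  "wp R p x = x [^]\<^bsub>R\<^esub> p \<ominus>\<^bsub>R\<^esub> x"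

text \<open>
  The division below is exact.  The reduction modulo \<open>p\<close> is represented by the polynomial whose
  coefficients are the residues in \<open>{0..<p}\<close>.
\<close>

definition D1 :: "nat \<Rightarrow> int poly" where
  "D1 p = map_poly (\<lambda>c. c mod int p)
     (let x = [:0, 1:] in (x ^ p + (x ^ p - x) ^ p - (x + (x ^ p - x)) ^ p) div [:int p:])"

text \<open>
  The value at \<open>x \<in> R\<close> of the polynomial \<open>f\<close>, whose coefficients are mapped to \<open>R\<close>
  along \<open>c \<mapsto> c \<cdot> 1\<close>; \<^const>\<open>ring.eval\<close> expects the leading coefficient first.
\<close>

definition eval_int_poly :: "('a, 'b) ring_scheme \<Rightarrow> int poly \<Rightarrow> 'a \<Rightarrow> 'a" where
  "eval_int_poly R f x = ring.eval R (map (\<lambda>c. add_pow R c \<one>\<^bsub>R\<^esub>) (rev (coeffs f))) x"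

end

theory Submission
  imports Defs "HOL-Number_Theory.Residues"
begin

text \<open>
  Write \<open>\<wp>(x) = x ^ p - x\<close> and let \<open>c = ((X + 1) ^ p - X ^ p - 1) / p\<close>.  Two facts about integer
  polynomials explain the equation for \<open>x\<^sub>3\<close>.  First, \<open>D\<^sub>1(x + 1) - D\<^sub>1(x) = - \<wp>(c(x))\<close> in characteristic
  \<open>p\<close> (\<open>D1_value_shift\<close>).  Hence, with \<open>u = a\<^sub>0 x\<^sub>2 - a\<^sub>1 c(x\<^sub>1)\<close>, the right-hand side of the equation
  changes by \<open>\<wp>(u)\<close> when \<open>x\<^sub>1\<close> is replaced by \<open>x\<^sub>1 + 1\<close>, and \<open>\<sigma>\<^sub>1 x\<^sub>3 = x\<^sub>3 + u\<close>, \<open>\<sigma>\<^sub>2 x\<^sub>3 = x\<^sub>3\<close>,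
  \<open>\<sigma>\<^sub>3 x\<^sub>3 = x\<^sub>3 + 1\<close> is compatible with it.  Second, \<open>c\<close> is monic of degree \<open>p - 1\<close>, so the operator
  \<open>(\<sigma>\<^sub>1 - 1) ^ (p - 1)\<close> maps \<open>c(x\<^sub>1)\<close> to \<open>(p - 1)! = - 1\<close> (\<open>delta_iter_carry\<close>).  Since
  \<open>(\<sigma>\<^sub>1 - 1) ^ p = \<sigma>\<^sub>1 ^ p - 1\<close>, the \<open>p\<close>-th power of \<open>\<sigma>\<^sub>1\<close> adds \<open>a\<^sub>1\<close> to \<open>x\<^sub>3\<close>, just as the power of
  \<open>\<sigma>\<^sub>3\<close> with exponent \<open>a\<^sub>1\<close> does.  The summand \<open>a\<^sub>0 x\<^sub>2\<close> of \<open>u\<close> accounts for the commutator of \<open>\<sigma>\<^sub>1\<close>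
  and \<open>\<sigma>\<^sub>2\<close>.

  For the first half, any nontrivial automorphism whose \<open>p\<close>-th power is the identity moves some element
  by 1 (\<open>artin_schreier_generator\<close>); \<open>\<sigma>\<^sub>3\<close> is nontrivial because an extension generated by \<open>x\<^sub>1\<close> and
  \<open>x\<^sub>2\<close> has degree at most \<open>p\<^sup>2\<close>.  An element \<open>y\<close> with \<open>\<sigma>\<^sub>3 y = y + 1\<close> is corrected in two steps by
  elements fixed by \<open>\<sigma>\<^sub>3\<close>, so that \<open>\<sigma>\<^sub>2\<close> and \<open>\<sigma>\<^sub>1\<close> act on it as above (\<open>corrected_generator\<close>).  Each step
  solves \<open>(\<tau> - 1) d = v\<close> by \<open>additive_hilbert_90\<close>, and the relations of \<open>G\<close> are the solvability
  conditions.  Then \<open>\<wp>(x\<^sub>3) - a\<^sub>0 \<beta>\<^sub>2 x\<^sub>1 - a\<^sub>1 D\<^sub>1(x\<^sub>1)\<close> is fixed by the whole Galois group.  Both the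
  additive Hilbert 90 and the fact that \<open>x\<^sub>3\<close> generates \<open>K\<^sub>3\<close> over \<open>K\<^sub>2\<close> come from one descent: if
  \<open>\<tau> \<xi> = \<xi> + 1\<close>, the binomial coefficients \<open>\<xi> choose k\<close> with \<open>k < p\<close> satisfy Pascal's rule, and they span
  everything that is killed by \<open>(\<tau> - 1) ^ p\<close> over the field fixed by \<open>\<tau>\<close>.

  For the converse, a degree count shows that each of the three steps \<open>K\<^sub>0(x\<^sub>1)\<close>, \<open>K\<^sub>0(x\<^sub>1, x\<^sub>2)\<close>, \<open>K\<^sub>3\<close> has
  degree \<open>p\<close>, so homomorphisms extend along the tower (\<open>extend_hom\<close>) and the automorphisms above exist.
  They fix only \<open>K\<^sub>0\<close> (\<open>fixed_in_simple_extension\<close>), every automorphism is a product of them, and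
  comparing with the normal form \<open>s\<^sub>1\<^sup>i s\<^sub>2\<^sup>j s\<^sub>3\<^sup>k\<close> of the elements of \<open>G\<close> yields the isomorphism
  (\<open>iso_G_group\<close>).
\<close>

section \<open>Congruences between integer polynomials\<close>

text \<open>
  For prime \<open>p\<close> this is \<open>((a + b) ^ p - a ^ p - b ^ p) / p\<close>, with the division carried out on the
  binomial coefficients, so that it makes sense over every commutative ring.
\<close>

definition mid_binomial :: "nat \<Rightarrow> 'a::comm_ring_1 \<Rightarrow> 'a \<Rightarrow> 'a" where
  "mid_binomial p a b = (\<Sum>k\<in>{1..<p}. of_nat ((p choose k) div p) * a ^ k * b ^ (p - k))"

lemma power_add_prime:
  fixes a b :: "'a::comm_ring_1"
  assumes "Factorial_Ring.prime p"
  shows "(a + b) ^ p = a ^ p + b ^ p + of_nat p * mid_binomial p a b"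
proof -
  let ?t = "\<lambda>k. of_nat (p choose k) * a ^ k * b ^ (p - k)"
  have p: "p > 1" using assms prime_gt_1_nat by blast
  have "{..p} = insert 0 (insert p {1..<p})" using p by auto
  then have "(a + b) ^ p = ?t 0 + (?t p + (\<Sum>k\<in>{1..<p}. ?t k))"
    using p by (simp add: binomial_ring)
  also have "(\<Sum>k\<in>{1..<p}. ?t k) = of_nat p * mid_binomial p a b"
    unfolding mid_binomial_def sum_distrib_left
  proof (rule sum.cong[OF HOL.refl])
    fix k assume "k \<in> {1..<p}"
    then have "p dvd p choose k" using assms by (intro dvd_choose_prime) auto
    then have "of_nat (p choose k) = (of_nat p * of_nat ((p choose k) div p) :: 'a)"
      by (metis dvd_mult_div_cancel of_nat_mult)
    then show "?t k = of_nat p * (of_nat ((p choose k) div p) * a ^ k * b ^ (p - k))"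
      by (simp add: mult.assoc)
  qed
  finally show ?thesis by simp
qed

text \<open>
  The polynomial \<open>((X + 1) ^ p - X ^ p - 1) / p\<close>: up to sign, the first carry in the
  addition of Witt vectors.
\<close>

abbreviation carry_poly :: "nat \<Rightarrow> int poly" where
  "carry_poly p \<equiv> mid_binomial p [:0, 1:] 1"

text \<open>
  Because \<open>X + (X ^ p - X) = X ^ p\<close>, the dividend in the definition of \<open>D\<^sub>1\<close> is \<open>- p\<close> times a
  divided binomial sum, and taking residues changes the quotient by a multiple of \<open>p\<close> only.
\<close>

lemma D1_cong:
  assumes "Factorial_Ring.prime p"
  shows "\<exists>h. D1 p = - mid_binomial p [:0, 1:] ([:0, 1:] ^ p - [:0, 1:]) + of_nat p * h"
proof -
  let ?X = "[:0, 1:] :: int poly" and ?q = "[:int p:]"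
  define M where "M = mid_binomial p ?X (?X ^ p - ?X)"
  have p: "p \<noteq> 0" using assms by (auto intro: ccontr)
  have c: "of_nat p = ?q" by (rule of_nat_poly)
  have N: "?X ^ p + (?X ^ p - ?X) ^ p - (?X + (?X ^ p - ?X)) ^ p = ?q * (- M)"
    by (subst power_add_prime[OF assms]) (simp add: M_def c)
  have "?q * (- M) div ?q = - M"
    using p by (intro nonzero_mult_div_cancel_left) simp
  then have D: "D1 p = map_poly (\<lambda>c. c mod int p) (- M)"
    unfolding D1_def Let_def N by (rule arg_cong)
  have "D1 p = - M + of_nat p * (- map_poly (\<lambda>c. c div int p) (- M))"
    unfolding D c
    by (rule poly_eqI) (simp add: coeff_map_poly minus_div_mult_eq_mod[symmetric] algebra_simps)
  then show ?thesis unfolding M_def by blast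
qed

lemma pcompose_power: "pcompose (f ^ n) h = pcompose f h ^ n"
  for f h :: "'a::comm_ring_1 poly"
  by (induction n) (simp_all add: pcompose_mult pcompose_1)

lemma pcompose_of_nat: "pcompose (of_nat n) h = of_nat n"
  by (simp add: of_nat_poly)

lemma pcompose_mid_binomial:
  "pcompose (mid_binomial p f g) h = mid_binomial p (pcompose f h) (pcompose g h)"
  unfolding mid_binomial_def
  by (simp add: pcompose_sum pcompose_mult pcompose_power pcompose_of_nat)

lemma mid_binomial_dvd_right:
  assumes "c dvd b"
  shows "c dvd mid_binomial p a b"
  unfolding mid_binomial_def
proof (rule dvd_sum)
  fix k assume "k \<in> {1..<p}"
  then have "b dvd b ^ (p - k)" by (intro dvd_power) auto
  then show "c dvd of_nat ((p choose k) div p) * a ^ k * b ^ (p - k)"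
    using assms by (meson dvd_mult dvd_trans)
qed

text \<open>
  A congruence modulo \<open>p\<close> becomes one modulo \<open>p\<^sup>2\<close> after raising to the \<open>p\<close>-th power.
\<close>

lemma power_add_multiple_prime:
  fixes y c :: "'a::comm_ring_1"
  assumes "Factorial_Ring.prime p"
  obtains w where "(y + of_nat p * c) ^ p = y ^ p + of_nat p * (of_nat p * w)"
proof -
  have "p \<ge> 2" using assms prime_ge_2_nat by blast
  then have "(of_nat p :: 'a) ^ 2 dvd of_nat p ^ p" by (rule le_imp_power_dvd)
  then have 1: "(of_nat p :: 'a) ^ 2 dvd (of_nat p * c) ^ p"
    by (simp add: power_mult_distrib)
  have "of_nat p dvd mid_binomial p y (of_nat p * c)"
    by (rule mid_binomial_dvd_right) simp
  then have 2: "(of_nat p :: 'a) ^ 2 dvd of_nat p * mid_binomial p y (of_nat p * c)"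
    unfolding power2_eq_square by (rule mult_dvd_mono[OF dvd_refl])
  have "(y + of_nat p * c) ^ p - y ^ p = (of_nat p * c) ^ p + of_nat p * mid_binomial p y (of_nat p * c)"
    by (simp add: power_add_prime[OF assms])
  then have "(of_nat p :: 'a) ^ 2 dvd (y + of_nat p * c) ^ p - y ^ p"
    using 1 2 by simp
  then obtain w where "(y + of_nat p * c) ^ p - y ^ p = of_nat p ^ 2 * w" by (rule dvdE)
  then have "(y + of_nat p * c) ^ p = y ^ p + of_nat p * (of_nat p * w)"
    by (simp add: power2_eq_square algebra_simps)
  then show thesis by (rule that)
qed

text \<open>
  With \<open>c\<close> the carry polynomial, \<open>(X + 1) ^ p = X ^ p + 1 + p c\<close>.  In
  \<open>p M = X ^ p + (X ^ p - X) ^ p - (X ^ p) ^ p\<close> the shift \<open>X \<mapsto> X + 1\<close> adds \<open>1 + p c\<close> to the first summand and,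
  modulo \<open>p\<^sup>2\<close>, nothing to the second and \<open>1 + p c(X ^ p)\<close> to \<open>(X ^ p) ^ p\<close>; division by \<open>p\<close> leaves
  \<open>c - c(X ^ p)\<close> modulo \<open>p\<close>.
\<close>

lemma D1_shift_cong:
  assumes "Factorial_Ring.prime p"
  defines "M \<equiv> - mid_binomial p [:0, 1:] ([:0, 1:] ^ p - [:0, 1:] :: int poly)"
  shows "\<exists>w. pcompose M [:1, 1:] =
           M + carry_poly p - pcompose (carry_poly p) ([:0, 1:] ^ p) + of_nat p * w"
proof -
  let ?X = "[:0, 1:] :: int poly" and ?q = "of_nat p :: int poly"
  note B = power_add_prime[OF assms(1)]
  define c where "c = carry_poly p"
  have q: "?q \<noteq> 0" using assms(1) by (auto intro: ccontr)
  have x1: "[:1, 1:] = ?X + 1" by (simp add: one_pCons)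
  have s: "(?X + 1) ^ p = ?X ^ p + 1 + ?q * c"
    by (simp add: B c_def)
  obtain w1 where w1: "((?X ^ p - ?X) + ?q * c) ^ p = (?X ^ p - ?X) ^ p + ?q * (?q * w1)"
    by (rule power_add_multiple_prime[OF assms(1)])
  obtain w2 where w2: "((?X ^ p + 1) + ?q * c) ^ p = (?X ^ p + 1) ^ p + ?q * (?q * w2)"
    by (rule power_add_multiple_prime[OF assms(1)])
  have cX: "pcompose c (?X ^ p) = mid_binomial p (?X ^ p) 1"
    by (simp add: c_def pcompose_mid_binomial pcompose_pCons pcompose_1)
  have M: "?q * M = ?X ^ p + (?X ^ p - ?X) ^ p - (?X ^ p) ^ p"
    using B[of ?X "?X ^ p - ?X"] by (simp add: M_def)
  have "?q * pcompose M [:1, 1:] = pcompose (?q * M) [:1, 1:]"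
    by (simp add: pcompose_mult pcompose_of_nat)
  also have "\<dots> = (?X + 1) ^ p + ((?X + 1) ^ p - (?X + 1)) ^ p - ((?X + 1) ^ p) ^ p"
    unfolding M by (simp add: pcompose_add pcompose_diff pcompose_power pcompose_pCons x1)
  also have "(?X + 1) ^ p - (?X + 1) = (?X ^ p - ?X) + ?q * c"
    unfolding s by simp
  also have "(?X + 1) ^ p + ((?X ^ p - ?X) + ?q * c) ^ p - ((?X + 1) ^ p) ^ p
     = ?q * (M + c - pcompose c (?X ^ p) + ?q * (w1 - w2))"
    unfolding s w1 w2 B[of "?X ^ p" 1] cX distrib_left right_diff_distrib M by simp
  finally show ?thesis
    using q unfolding c_def by (auto simp: mult_left_cancel)
qed

definition diff_poly :: "int poly \<Rightarrow> int poly" where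
  "diff_poly f = pcompose f [:1, 1:] - f"

lemma diff_poly_pCons: "diff_poly (pCons a f) = pCons 0 (diff_poly f) + diff_poly f + f"
  by (simp add: diff_poly_def pcompose_pCons)

text \<open>
  Each difference lowers the degree by one and multiplies the leading coefficient by the degree.
  The bound on the degree need not be attained, which makes the induction go through.
\<close>

lemma diff_poly_leading:
  assumes "degree f \<le> Suc k"
  shows "degree (diff_poly f) \<le> k \<and> Polynomial.coeff (diff_poly f) k = of_nat (Suc k) * Polynomial.coeff f (Suc k)"
  using assms
proof (induction f arbitrary: k)
  case 0
  then show ?case by (simp add: diff_poly_def)
next
  case (pCons a f)
  show ?case
  proof (cases k)
    case 0
    then have "degree f = 0" using pCons by (auto split: if_splits)
    then obtain b where "f = [:b:]" by (rule degree_eq_zeroE)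
    then show ?thesis using 0 by (simp add: diff_poly_pCons) (simp add: diff_poly_def)
  next
    case (Suc j)
    then have f: "degree f \<le> Suc j" using pCons.prems by (auto split: if_splits)
    note IH = pCons.IH[OF f]
    have "degree (pCons 0 (diff_poly f)) \<le> k"
      using IH Suc by (metis Suc_le_mono degree_pCons_le order_trans)
    then have "degree (diff_poly (pCons a f)) \<le> k"
      unfolding diff_poly_pCons using IH f Suc by (intro degree_add_le) auto
    moreover have "Polynomial.coeff (diff_poly f) k = 0"
      using IH Suc by (intro coeff_eq_0) auto
    ultimately show ?thesis
      using IH Suc by (simp add: diff_poly_pCons algebra_simps)
  qed
qed

lemma diff_poly_iterate:
  "degree f \<le> k \<Longrightarrow> (diff_poly ^^ k) f = [:fact k * Polynomial.coeff f k:]"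
proof (induction k arbitrary: f)
  case 0
  then have "degree f = 0" by simp
  then obtain b where "f = [:b:]" by (rule degree_eq_zeroE)
  then show ?case by simp
next
  case (Suc k)
  then show ?case
    using diff_poly_leading[OF Suc.prems] by (simp add: funpow_swap1 del: funpow.simps)
      (simp add: funpow_swap1 algebra_simps)
qed

lemma diff_poly_carry:
  assumes "Factorial_Ring.prime p"
  shows "(diff_poly ^^ (p - 1)) (carry_poly p) = [:fact (p - 1):]"
proof -
  have p: "p > 1" using assms prime_gt_1_nat by blast
  have c: "Polynomial.coeff (carry_poly p) n = (if n \<in> {1..<p} then int ((p choose n) div p) else 0)" for n
  proof -
    have "carry_poly p = (\<Sum>k\<in>{1..<p}. Polynomial.monom (int ((p choose k) div p)) k)"
      unfolding mid_binomial_def monom_altdef by (simp add: of_nat_poly)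
    then show ?thesis by (simp add: coeff_sum)
  qed
  have "degree (carry_poly p) \<le> p - 1"
    by (rule degree_le) (auto simp: c)
  moreover have "Polynomial.coeff (carry_poly p) (p - 1) = 1"
    using p binomial_symmetric[of "p - 1" p] by (simp add: c)
  ultimately show ?thesis by (simp add: diff_poly_iterate)
qed

section \<open>Fields of characteristic \<open>p\<close>\<close>

locale char_p_field = field R for R (structure) +
  fixes p :: nat
  assumes prime_p: "Factorial_Ring.prime p" and odd_p: "odd p"
    and char_p: "add_pow R p \<one> = \<zero>"
begin

lemma p_gt_1: "p > 1"
  using prime_p prime_gt_1_nat by blast

definition emb :: "int \<Rightarrow> 'a" where
  "emb n = add_pow R n \<one>"

lemma emb_closed [simp]: "emb n \<in> carrier R"
  by (simp add: emb_def)

lemma emb_0 [simp]: "emb 0 = \<zero>"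
  by (simp add: emb_def add_pow_int_ge)

lemma emb_1 [simp]: "emb 1 = \<one>"
  by (simp add: emb_def)

lemma emb_add: "emb (m + n) = emb m \<oplus> emb n"
  by (simp add: emb_def add.int_pow_mult)

lemma emb_minus: "emb (- n) = \<ominus> emb n"
  by (simp add: emb_def add.int_pow_neg)

lemma emb_mult: "emb (m * n) = emb m \<otimes> emb n"
  by (simp add: emb_def add_pow_ldistr_int add.int_pow_pow mult.commute)

lemma emb_of_nat: "emb (int k) = add_pow R k \<one>"
  by (simp add: emb_def add_pow_int_ge)

lemma add_pow_eq_emb: "x \<in> carrier R \<Longrightarrow> add_pow R (k::nat) x = emb (int k) \<otimes> x"
  by (simp add: emb_of_nat add_pow_ldistr)

lemma emb_p [simp]: "emb (int p) = \<zero>"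
  by (simp add: emb_of_nat char_p)

lemma emb_cong:
  assumes "[m = n] (mod int p)"
  shows "emb m = emb n"
proof -
  obtain k where "n = m + int p * k"
    using assms by (auto simp: cong_iff_lin)
  then show ?thesis by (simp add: emb_add emb_mult)
qed

lemma emb_eq_0_iff: "emb n = \<zero> \<longleftrightarrow> int p dvd n"
proof
  assume n: "emb n = \<zero>"
  show "int p dvd n"
  proof (rule ccontr)
    assume "\<not> int p dvd n"
    moreover have "Factorial_Ring.prime (int p)" using prime_p by simp
    ultimately have "coprime (int p) n" by (simp add: prime_imp_coprime)
    then obtain k where "[n * k = 1] (mod int p)"
      using cong_solve_coprime_int[of n "int p"] by (auto simp: coprime_commute)
    then have "emb n \<otimes> emb k = \<one>" by (simp add: emb_cong emb_mult[symmetric])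
    then show False using n by simp
  qed
next
  assume "int p dvd n"
  then obtain k where "n = int p * k" by (rule dvdE)
  then show "emb n = \<zero>" by (simp add: emb_mult)
qed

section \<open>Evaluating integer polynomials at additive endomorphisms\<close>

text \<open>
  The value at \<open>z\<close> of the operator \<open>f(A)\<close>.  For \<open>A\<close> the multiplication by \<open>x\<close> and \<open>z = 1\<close> it is the
  ordinary value \<open>f(x)\<close>; for \<open>A\<close> an automorphism it turns congruences between integer
  polynomials into identities between operators.
\<close>

definition endo_eval :: "('a \<Rightarrow> 'a) \<Rightarrow> int poly \<Rightarrow> 'a \<Rightarrow> 'a" where
  "endo_eval A f z = fold_coeffs (\<lambda>c w. emb c \<otimes> z \<oplus> A w) f \<zero>"

definition additive_endo :: "('a \<Rightarrow> 'a) \<Rightarrow> bool" where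
  "additive_endo A \<longleftrightarrow> A \<in> carrier R \<rightarrow> carrier R
     \<and> (\<forall>x\<in>carrier R. \<forall>y\<in>carrier R. A (x \<oplus> y) = A x \<oplus> A y)
     \<and> (\<forall>c. \<forall>x\<in>carrier R. A (emb c \<otimes> x) = emb c \<otimes> A x)"

context
  fixes A assumes A: "additive_endo A"
begin

lemma endo_closed: "x \<in> carrier R \<Longrightarrow> A x \<in> carrier R"
  using A by (auto simp: additive_endo_def)

lemma endo_add: "\<lbrakk>x \<in> carrier R; y \<in> carrier R\<rbrakk> \<Longrightarrow> A (x \<oplus> y) = A x \<oplus> A y"
  using A by (auto simp: additive_endo_def)

lemma endo_emb: "x \<in> carrier R \<Longrightarrow> A (emb c \<otimes> x) = emb c \<otimes> A x"
  using A by (auto simp: additive_endo_def)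

lemma endo_0: "A \<zero> = \<zero>"
  using endo_emb[of "\<zero>" 0] by (simp add: endo_closed)

lemma endo_eval_0 [simp]: "endo_eval A 0 z = \<zero>"
  by (simp add: endo_eval_def)

lemma endo_eval_pCons [simp]:
  assumes "z \<in> carrier R" shows "endo_eval A (pCons c f) z = emb c \<otimes> z \<oplus> A (endo_eval A f z)"
  by (cases "c = 0 \<and> f = 0")
     (use assms in \<open>auto simp: endo_eval_def fold_coeffs_pCons_coeff_not_0_eq fold_coeffs_pCons_not_0_0_eq endo_0\<close>)

lemma endo_eval_closed [simp]: "z \<in> carrier R \<Longrightarrow> endo_eval A f z \<in> carrier R"
  by (induction f) (simp_all add: endo_closed)

lemma endo_eval_add:
  assumes z: "z \<in> carrier R" shows "endo_eval A (f + g) z = endo_eval A f z \<oplus> endo_eval A g z"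
  by (induction f g rule: poly_induct2)
     (use z in \<open>simp_all add: endo_closed endo_0 endo_add emb_add l_distr a_ac\<close>)

lemma endo_eval_smult:
  assumes z: "z \<in> carrier R" shows "endo_eval A (Polynomial.smult c f) z = emb c \<otimes> endo_eval A f z"
  by (induction f) (use z in \<open>simp_all add: endo_closed endo_0 endo_emb emb_mult r_distr m_assoc\<close>)

lemma endo_eval_minus:
  assumes z: "z \<in> carrier R" shows "endo_eval A (- f) z = \<ominus> endo_eval A f z"
  using endo_eval_smult[OF z, of "- 1" f] z by (simp add: emb_minus l_minus)

lemma endo_eval_diff:
  assumes z: "z \<in> carrier R" shows "endo_eval A (f - g) z = endo_eval A f z \<ominus> endo_eval A g z"
  using endo_eval_add[OF z, of f "- g"] by (simp add: endo_eval_minus z a_minus_def)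

lemma endo_eval_mult:
  assumes z: "z \<in> carrier R" shows "endo_eval A (f * g) z = endo_eval A f (endo_eval A g z)"
  by (induction f) (use z in \<open>simp_all add: endo_closed endo_0 endo_eval_add endo_eval_smult\<close>)

lemma endo_eval_power:
  assumes z: "z \<in> carrier R" shows "endo_eval A (f ^ n) z = (endo_eval A f ^^ n) z"
proof (induction n)
  case 0
  show ?case using z by (simp add: one_pCons endo_0)
qed (use z in \<open>simp_all add: endo_eval_mult\<close>)

lemma endo_eval_of_nat_p: "z \<in> carrier R \<Longrightarrow> endo_eval A (of_nat p * f) z = \<zero>"
  by (simp add: of_nat_poly endo_eval_smult)

end

lemma endo_mult: "x \<in> carrier R \<Longrightarrow> additive_endo (\<lambda>w. x \<otimes> w)"
  by (simp add: additive_endo_def r_distr m_lcomm)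

abbreviation ipoly :: "int poly \<Rightarrow> 'a \<Rightarrow> 'a" where
  "ipoly f x \<equiv> endo_eval (\<lambda>w. x \<otimes> w) f \<one>"

context
  fixes x assumes x: "x \<in> carrier R"
begin

lemmas ipoly_simps = endo_eval_0[OF endo_mult[OF x]] endo_eval_pCons[OF endo_mult[OF x] one_closed]
lemmas ipoly_closed [simp] = endo_eval_closed[OF endo_mult[OF x] one_closed]
lemmas ipoly_add = endo_eval_add[OF endo_mult[OF x] one_closed]
lemmas ipoly_diff = endo_eval_diff[OF endo_mult[OF x] one_closed]
lemmas ipoly_of_nat_p = endo_eval_of_nat_p[OF endo_mult[OF x] one_closed]

lemma ipoly_mult: "ipoly (f * g) x = ipoly f x \<otimes> ipoly g x"
proof -
  note E = endo_mult[OF x]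
  have "endo_eval (\<lambda>w. x \<otimes> w) f z = ipoly f x \<otimes> z" if z: "z \<in> carrier R" for z
  proof (induction f)
    case 0
    show ?case using z by (simp add: endo_eval_0[OF E])
  next
    case (pCons c f)
    have "endo_eval (\<lambda>w. x \<otimes> w) (pCons c f) z = emb c \<otimes> z \<oplus> x \<otimes> (ipoly f x \<otimes> z)"
      by (simp only: endo_eval_pCons[OF E z] pCons.IH)
    also have "\<dots> = (emb c \<otimes> \<one> \<oplus> x \<otimes> ipoly f x) \<otimes> z"
      using x z by (simp add: l_distr m_assoc)
    finally show ?case by (simp only: ipoly_simps)
  qed
  then show ?thesis by (simp only: endo_eval_mult[OF E one_closed] ipoly_closed)
qed

lemma ipoly_X: "ipoly [:0, 1:] x = x"
  using x by (simp add: ipoly_simps)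

lemma ipoly_1: "ipoly 1 x = \<one>"
  using x by (simp add: one_pCons ipoly_simps)

lemma ipoly_power: "ipoly (f ^ n) x = ipoly f x [^] n"
  by (induction n) (simp_all add: ipoly_1 ipoly_mult m_comm)

end

lemma ipoly_pcompose:
  assumes x: "x \<in> carrier R"
  shows "ipoly (pcompose f g) x = ipoly f (ipoly g x)"
proof -
  have g: "ipoly g x \<in> carrier R" using x by simp
  show ?thesis
    by (induction f)
       (use x in \<open>simp_all add: ipoly_simps[OF g] ipoly_simps[OF x] pcompose_pCons ipoly_add ipoly_mult\<close>)
qed

lemma eval_int_poly_eq_ipoly:
  assumes x: "x \<in> carrier R"
  shows "eval_int_poly R f x = ipoly f x"
proof (induction f)
  case 0
  show ?case by (simp add: eval_int_poly_def ipoly_simps[OF x])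
next
  case (pCons c f)
  let ?l = "map (\<lambda>c. add_pow R c \<one>) (rev (coeffs f))"
  have "eval_int_poly R (pCons c f) x = eval (?l @ [emb c]) x"
    using pCons.hyps x unfolding eval_int_poly_def emb_def by (auto simp: cCons_def)
  also have "\<dots> = eval ?l x \<otimes> x \<oplus> emb c"
    by (rule eval_append_aux) (use x in auto)
  also have "eval ?l x = ipoly f x"
    using pCons.IH by (simp add: eval_int_poly_def)
  finally show ?case
    using x by (simp add: ipoly_simps[OF x] m_comm a_comm)
qed

section \<open>The Frobenius map and the value of \<open>D\<^sub>1\<close>\<close>

text \<open>
  Division by \<open>y\<close> reduces the claim to \<open>(t + 1) ^ p = t ^ p + 1\<close>, which is a congruence modulo
  \<open>p\<close> between integer polynomials.
\<close>

lemma frobenius_add: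
  assumes x: "x \<in> carrier R" and y: "y \<in> carrier R"
  shows "(x \<oplus> y) [^] p = x [^] p \<oplus> y [^] p"
proof (cases "y = \<zero>")
  case True
  then show ?thesis using x p_gt_1 by (simp add: nat_pow_zero)
next
  case False
  then have u: "y \<in> Units R" using y by (simp add: field_Units)
  define t where "t = x \<otimes> inv y"
  have t: "t \<in> carrier R" using x u by (simp add: t_def)
  have xt: "x = t \<otimes> y" using x y u by (simp add: t_def m_assoc)
  have "([:0, 1:] + 1) ^ p = [:0, 1:] ^ p + 1 ^ p + of_nat p * carry_poly p"
    by (rule power_add_prime[OF prime_p])
  then have "ipoly (([:0, 1:] + 1) ^ p) t = ipoly ([:0, 1:] ^ p + 1 ^ p + of_nat p * carry_poly p) t"
    by (rule arg_cong)
  then have t1: "(t \<oplus> \<one>) [^] p = t [^] p \<oplus> \<one>"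
    using t unfolding ipoly_add[OF t] ipoly_power[OF t] ipoly_of_nat_p[OF t] ipoly_X[OF t] ipoly_1[OF t]
    by simp
  have "x \<oplus> y = (t \<oplus> \<one>) \<otimes> y" using t y by (simp add: xt l_distr)
  then have "(x \<oplus> y) [^] p = (t [^] p \<oplus> \<one>) \<otimes> y [^] p"
    using t y t1 by (simp add: nat_pow_distrib)
  also have "\<dots> = x [^] p \<oplus> y [^] p"
    using t y by (simp add: xt l_distr nat_pow_distrib)
  finally show ?thesis .
qed

lemma frobenius_minus:
  assumes x: "x \<in> carrier R"
  shows "(\<ominus> x) [^] p = \<ominus> (x [^] p)"
proof -
  have "(\<ominus> x) [^] p \<oplus> x [^] p = \<zero>"
    using frobenius_add[of "\<ominus> x" x] x p_gt_1 by (simp add: l_neg nat_pow_zero)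
  then show ?thesis using x by (simp add: minus_equality)
qed

lemma frobenius_diff:
  "\<lbrakk>x \<in> carrier R; y \<in> carrier R\<rbrakk> \<Longrightarrow> (x \<ominus> y) [^] p = x [^] p \<ominus> y [^] p"
  by (simp add: a_minus_def frobenius_add frobenius_minus)

lemma emb_frobenius: "emb n [^] p = emb n"
proof -
  have nat: "emb (int k) [^] p = emb (int k)" for k
  proof (induction k)
    case 0 show ?case using p_gt_1 by (simp add: nat_pow_zero)
  next
    case (Suc k)
    have "emb (int (Suc k)) = emb (int k) \<oplus> \<one>" by (simp add: emb_add a_comm)
    then show ?case using Suc by (simp add: frobenius_add)
  qed
  show ?thesis
    by (cases n) (use nat in \<open>simp_all add: emb_minus frobenius_minus del: of_nat_Suc\<close>)
qed

lemma ipoly_frobenius: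
  assumes x: "x \<in> carrier R"
  shows "ipoly f (x [^] p) = ipoly f x [^] p"
proof (induction f)
  case 0
  show ?case using x p_gt_1 by (simp add: ipoly_simps nat_pow_zero)
next
  case (pCons c f)
  then show ?case
    using x by (simp add: ipoly_simps frobenius_add nat_pow_distrib emb_frobenius)
qed

text \<open>
  The value at \<open>x\<close> of the carry polynomial; this element measures how \<open>D\<^sub>1\<close> changes under
  \<open>x \<mapsto> x + 1\<close>.
\<close>

definition carry :: "'a \<Rightarrow> 'a" where
  "carry x = ipoly (carry_poly p) x"

definition D1_value :: "'a \<Rightarrow> 'a" where
  "D1_value x = eval_int_poly R (D1 p) x"

lemma carry_closed [simp]: "x \<in> carrier R \<Longrightarrow> carry x \<in> carrier R"
  by (simp add: carry_def)

lemma D1_value_closed [simp]: "x \<in> carrier R \<Longrightarrow> D1_value x \<in> carrier R"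
  by (simp add: D1_value_def eval_int_poly_eq_ipoly)

text \<open>
  The shift changes \<open>D\<^sub>1(x)\<close> by \<open>- \<wp>(c(x))\<close>: integer polynomials commute with the Frobenius map, so
  the term \<open>c(X ^ p)\<close> of the congruence between polynomials becomes \<open>c(x) ^ p\<close>.
\<close>

lemma D1_value_shift:
  assumes x: "x \<in> carrier R"
  shows "D1_value (x \<oplus> \<one>) = D1_value x \<oplus> carry x \<ominus> carry x [^] p"
proof -
  define M where "M = - mid_binomial p [:0, 1:] ([:0, 1:] ^ p - [:0, 1:] :: int poly)"
  obtain h where h: "D1 p = M + of_nat p * h"
    using D1_cong[OF prime_p] by (auto simp: M_def)
  obtain w where w: "pcompose M [:1, 1:] =
      M + carry_poly p - pcompose (carry_poly p) ([:0, 1:] ^ p) + of_nat p * w"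
    using D1_shift_cong[OF prime_p] by (auto simp: M_def)
  have D: "D1_value y = ipoly M y" if "y \<in> carrier R" for y
    using that by (simp add: D1_value_def eval_int_poly_eq_ipoly h ipoly_add ipoly_of_nat_p)
  have "ipoly [:1, 1:] x = x \<oplus> \<one>" using x by (simp add: ipoly_simps a_comm)
  then have "D1_value (x \<oplus> \<one>) = ipoly (pcompose M [:1, 1:]) x"
    using x by (simp add: D ipoly_pcompose)
  also have "\<dots> = D1_value x \<oplus> carry x \<ominus> carry x [^] p"
    unfolding w ipoly_add[OF x] ipoly_diff[OF x] ipoly_of_nat_p[OF x] ipoly_pcompose[OF x]
      ipoly_power[OF x] ipoly_X[OF x] ipoly_frobenius[OF x] carry_def D[OF x]
    using x by simp
  finally show ?thesis .
qed

end

section \<open>The difference operator of an automorphism\<close>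

definition (in ring) delta :: "('a \<Rightarrow> 'a) \<Rightarrow> 'a \<Rightarrow> 'a" where
  "delta \<tau> x = \<tau> x \<ominus> x"

context char_p_field begin

text \<open>
  The binomial coefficient \<open>x choose k\<close>.  It has its meaning for \<open>k < p\<close> only, where \<open>k!\<close> is
  invertible.
\<close>

primrec binom_elem :: "'a \<Rightarrow> nat \<Rightarrow> 'a" where
  "binom_elem x 0 = \<one>"
| "binom_elem x (Suc k) = binom_elem x k \<otimes> (x \<ominus> emb (int k)) \<otimes> inv (emb (int (Suc k)))"

lemma emb_unit: "0 < k \<Longrightarrow> k < p \<Longrightarrow> emb (int k) \<in> Units R"
  unfolding field_Units using emb_eq_0_iff[of "int k"] by (auto dest: dvd_imp_le)

lemma emb_subfield:
  assumes "subfield S R" shows "emb n \<in> S"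
proof -
  note S = subringE[OF subfieldE(1)[OF assms]]
  have nat: "emb (int k) \<in> S" for k
    by (induction k) (use S in \<open>auto simp: emb_add\<close>)
  show ?thesis
    by (cases n rule: int_cases2) (use S nat in \<open>auto simp: emb_minus\<close>)
qed

lemma binom_elem_subfield:
  assumes S: "subfield S R" and x: "x \<in> S" and "k < p"
  shows "binom_elem x k \<in> S"
  using \<open>k < p\<close>
proof (induction k)
  case 0
  then show ?case using subringE(3)[OF subfieldE(1)[OF S]] by simp
next
  case (Suc k)
  note SR = subringE[OF subfieldE(1)[OF S]]
  have "emb (int (Suc k)) \<in> S - {\<zero>}"
    using emb_subfield[OF S] emb_unit[of "Suc k"] Suc.prems by (auto simp: field_Units)
  then have "inv (emb (int (Suc k))) \<in> S" using subfield_m_inv(1)[OF S] by blast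
  moreover have "x \<ominus> emb (int k) \<in> S"
    unfolding a_minus_def using SR(5,7) x emb_subfield[OF S] by blast
  ultimately show ?case using Suc SR(6) by (auto simp del: of_nat_Suc)
qed

lemmas binom_elem_closed = binom_elem_subfield[OF carrier_is_subfield]

lemma binom_elem_Suc_mult:
  assumes x: "x \<in> carrier R" and k: "Suc k < p"
  shows "binom_elem x (Suc k) \<otimes> emb (int (Suc k)) = binom_elem x k \<otimes> (x \<ominus> emb (int k))"
  using x k binom_elem_closed[OF x, of k] emb_unit[of "Suc k"] by (simp add: m_assoc del: of_nat_Suc)

lemma ipoly_subfield:
  assumes F: "subfield F R" and x: "x \<in> F"
  shows "ipoly f x \<in> F"
proof -
  note FR = subringE[OF subfieldE(1)[OF F]]
  have xR: "x \<in> carrier R" using x FR(1) by blast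
  show ?thesis
    by (induction f) (use FR x emb_subfield[OF F] in \<open>auto simp: ipoly_simps[OF xR]\<close>)
qed

context
  fixes F h assumes F: "subfield F R" and h: "h \<in> ring_hom (R\<lparr>carrier := F\<rparr>) R"
begin

lemma subfield_hom_simps:
  shows "\<lbrakk>a \<in> F; b \<in> F\<rbrakk> \<Longrightarrow> h (a \<oplus> b) = h a \<oplus> h b"
    and "\<lbrakk>a \<in> F; b \<in> F\<rbrakk> \<Longrightarrow> h (a \<otimes> b) = h a \<otimes> h b"
    and "a \<in> F \<Longrightarrow> h a \<in> carrier R" and "h \<one> = \<one>" and "h \<zero> = \<zero>"
  using ring_hom_add[OF h] ring_hom_mult[OF h] ring_hom_closed[OF h] ring_hom_one[OF h]
    ring_hom_zero[OF h subring_is_ring[OF subfieldE(1)[OF F]] ring_axioms] by simp_all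

lemma subfield_hom_minus:
  assumes a: "a \<in> F"
  shows "h (\<ominus> a) = \<ominus> h a"
proof -
  have "\<ominus> a \<in> F" "a \<in> carrier R"
    using a subringE(1,5)[OF subfieldE(1)[OF F]] by auto
  then have "h (\<ominus> a) \<oplus> h a = \<zero>"
    using a by (simp add: subfield_hom_simps(1)[symmetric] l_neg subfield_hom_simps(5))
  then show ?thesis using a \<open>\<ominus> a \<in> F\<close> by (simp add: minus_equality subfield_hom_simps(3))
qed

lemma subfield_hom_emb: "h (emb n) = emb n"
proof -
  note eF = emb_subfield[OF F]
  have one: "\<one> \<in> F" using subringE(3)[OF subfieldE(1)[OF F]] .
  have nat: "h (emb (int k)) = emb (int k)" for k
    by (induction k) (use eF one in \<open>simp_all add: emb_add subfield_hom_simps\<close>)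
  show ?thesis
    by (cases n rule: int_cases2) (simp_all add: nat emb_minus subfield_hom_minus eF)
qed

lemma subfield_hom_ipoly:
  assumes x: "x \<in> F"
  shows "h (ipoly f x) = ipoly f (h x)"
proof -
  note FR = subringE[OF subfieldE(1)[OF F]]
  have xR: "x \<in> carrier R" "h x \<in> carrier R" using x FR(1) subfield_hom_simps(3) by auto
  have fF: "x \<otimes> ipoly f x \<in> F" "ipoly f x \<in> F" for f
    using ipoly_subfield[OF F x] x FR(6) by auto
  show ?thesis
    by (induction f)
      (use xR x fF emb_subfield[OF F] in \<open>simp_all add: ipoly_simps subfield_hom_simps subfield_hom_emb\<close>)
qed

end

context
  fixes \<tau> assumes \<tau>: "\<tau> \<in> ring_hom R R"
begin

interpretation S: ring_hom_cring R R \<tau>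
  using \<tau> by (simp add: ring_hom_cring_def ring_hom_cring_axioms_def is_cring)

lemma hom_emb: "\<tau> (emb n) = emb n"
  using subfield_hom_emb[OF carrier_is_subfield, of \<tau>] \<tau> by simp

lemma hom_minus: "\<lbrakk>x \<in> carrier R; y \<in> carrier R\<rbrakk> \<Longrightarrow> \<tau> (x \<ominus> y) = \<tau> x \<ominus> \<tau> y"
  by (simp add: a_minus_def)

lemma endo_hom: "additive_endo \<tau>"
  by (auto simp: additive_endo_def hom_emb)

lemma hom_ipoly: "x \<in> carrier R \<Longrightarrow> \<tau> (ipoly f x) = ipoly f (\<tau> x)"
  using subfield_hom_ipoly[OF carrier_is_subfield, of \<tau>] \<tau> by simp

lemma hom_carry: "x \<in> carrier R \<Longrightarrow> \<tau> (carry x) = carry (\<tau> x)"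
  by (simp add: carry_def hom_ipoly)

lemma hom_D1_value: "x \<in> carrier R \<Longrightarrow> \<tau> (D1_value x) = D1_value (\<tau> x)"
  by (simp add: D1_value_def eval_int_poly_eq_ipoly hom_ipoly)

lemma delta_closed: "x \<in> carrier R \<Longrightarrow> delta \<tau> x \<in> carrier R"
  by (simp add: delta_def)

lemma delta_iter_closed: "x \<in> carrier R \<Longrightarrow> (delta \<tau> ^^ k) x \<in> carrier R"
  by (induction k) (simp_all add: delta_closed)

lemma delta_eq_endo_eval: "x \<in> carrier R \<Longrightarrow> delta \<tau> x = endo_eval \<tau> [:- 1, 1:] x"
  by (simp add: delta_def endo_eval_pCons[OF endo_hom] endo_eval_0[OF endo_hom] emb_minus a_minus_def l_minus a_comm)

lemma hom_iter_closed: "x \<in> carrier R \<Longrightarrow> (\<tau> ^^ k) x \<in> carrier R"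
  by (induction k) simp_all

text \<open>
  The congruence \<open>(X - 1) ^ p = X ^ p - 1\<close> modulo the odd prime \<open>p\<close>, evaluated at the operator \<open>\<tau>\<close>.
\<close>

lemma delta_iter_p:
  assumes x: "x \<in> carrier R"
  shows "(delta \<tau> ^^ p) x = (\<tau> ^^ p) x \<ominus> x"
proof -
  note E = endo_hom
  have it: "(delta \<tau> ^^ k) x = endo_eval \<tau> ([:- 1, 1:] ^ k) x" for k
  proof (induction k)
    case 0
    show ?case using endo_eval_power[OF E x, of _ 0] by simp
  next
    case (Suc k)
    then show ?case
      using x by (simp add: endo_eval_mult[OF E] endo_eval_closed[OF E] delta_eq_endo_eval del: mult_pCons_left)
  qed
  have X: "endo_eval \<tau> [:0, 1:] y = \<tau> y" if "y \<in> carrier R" for y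
    using that by (simp add: endo_eval_pCons[OF E] endo_eval_0[OF E])
  have itX: "endo_eval \<tau> ([:0, 1:] ^ k) x = (\<tau> ^^ k) x" for k
  proof (induction k)
    case 0
    show ?case using endo_eval_power[OF E x, of _ 0] by simp
  next
    case (Suc k)
    then show ?case
      using x by (simp add: endo_eval_mult[OF E] endo_eval_closed[OF E] X hom_iter_closed del: mult_pCons_left)
  qed
  have m1: "([:-1:] :: int poly) ^ p = [:-1:]"
    using odd_p by (simp add: poly_const_pow)
  have "[:- 1, 1:] ^ p = ([:0, 1:] + [:-1:] :: int poly) ^ p" by simp
  also have "\<dots> = [:0, 1:] ^ p + [:-1:] + of_nat p * mid_binomial p [:0, 1:] [:-1:]"
    unfolding power_add_prime[OF prime_p] m1 ..
  finally have "(delta \<tau> ^^ p) x =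
      endo_eval \<tau> ([:0, 1:] ^ p + [:-1:] + of_nat p * mid_binomial p [:0, 1:] [:-1:]) x"
    by (simp only: it)
  also have "\<dots> = (\<tau> ^^ p) x \<oplus> endo_eval \<tau> [:-1:] x \<oplus> \<zero>"
    by (simp only: endo_eval_add[OF E x] endo_eval_of_nat_p[OF E x] itX)
  also have "\<dots> = (\<tau> ^^ p) x \<ominus> x"
    using x itX[of p] endo_eval_closed[OF E x, of "[:0, 1:] ^ p"]
    by (simp add: endo_eval_pCons[OF E] endo_eval_0[OF E] emb_minus l_minus a_minus_def S.hom_zero)
  finally show ?thesis .
qed

lemma delta_diff:
  "\<lbrakk>x \<in> carrier R; y \<in> carrier R\<rbrakk> \<Longrightarrow> delta \<tau> (x \<ominus> y) = delta \<tau> x \<ominus> delta \<tau> y"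
  using S.hom_closed unfolding delta_def a_minus_def
  by (simp add: minus_add a_ac)

lemma delta_iter_diff:
  "\<lbrakk>x \<in> carrier R; y \<in> carrier R\<rbrakk> \<Longrightarrow> (delta \<tau> ^^ k) (x \<ominus> y) = (delta \<tau> ^^ k) x \<ominus> (delta \<tau> ^^ k) y"
  by (induction k) (simp_all add: delta_diff delta_iter_closed)

lemma delta_fixed_mult:
  "\<lbrakk>c \<in> carrier R; \<tau> c = c; x \<in> carrier R\<rbrakk> \<Longrightarrow> delta \<tau> (c \<otimes> x) = c \<otimes> delta \<tau> x"
  by (simp add: delta_def a_minus_def r_distr r_minus)

lemma delta_iter_fixed_mult:
  "\<lbrakk>c \<in> carrier R; \<tau> c = c; x \<in> carrier R\<rbrakk> \<Longrightarrow> (delta \<tau> ^^ k) (c \<otimes> x) = c \<otimes> (delta \<tau> ^^ k) x"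
  by (induction k) (simp_all add: delta_fixed_mult delta_iter_closed)

lemma delta_zero_iff: "x \<in> carrier R \<Longrightarrow> delta \<tau> x = \<zero> \<longleftrightarrow> \<tau> x = x"
  by (simp add: delta_def r_right_minus_eq)

lemma delta_iter_zero: "(delta \<tau> ^^ k) \<zero> = \<zero>"
  by (induction k) (simp_all add: delta_zero_iff)

lemma delta_iter_subfield:
  assumes S: "subfield S R" and st: "\<And>s. s \<in> S \<Longrightarrow> \<tau> s \<in> S" and y: "y \<in> S"
  shows "(delta \<tau> ^^ k) y \<in> S"
proof (induction k)
  case (Suc k)
  then show ?case
    using subringE(5,7)[OF subfieldE(1)[OF S]] st by (simp add: delta_def a_minus_def)
qed (simp add: y)

context
  fixes \<xi> assumes \<xi>: "\<xi> \<in> carrier R" and shift: "\<tau> \<xi> = \<xi> \<oplus> \<one>"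
begin

lemma delta_ipoly: "delta \<tau> (ipoly f \<xi>) = ipoly (diff_poly f) \<xi>"
proof -
  have "ipoly [:1, 1:] \<xi> = \<xi> \<oplus> \<one>" using \<xi> by (simp add: ipoly_simps a_comm)
  then show ?thesis
    using \<xi> by (simp add: delta_def diff_poly_def ipoly_diff ipoly_pcompose hom_ipoly shift)
qed

text \<open>
  The carry polynomial is monic of degree \<open>p - 1\<close>, so its \<open>(p - 1)\<close>-st difference is \<open>(p - 1)!\<close>,
  and Wilson's theorem applies.
\<close>

lemma delta_iter_carry: "(delta \<tau> ^^ (p - 1)) (carry \<xi>) = \<ominus> \<one>"
proof -
  have "(delta \<tau> ^^ k) (ipoly f \<xi>) = ipoly ((diff_poly ^^ k) f) \<xi>" for k f
    by (induction k) (simp_all add: delta_ipoly)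
  then have "(delta \<tau> ^^ (p - 1)) (carry \<xi>) = ipoly [:fact (p - 1):] \<xi>"
    unfolding carry_def diff_poly_carry[OF prime_p, symmetric] .
  also have "\<dots> = emb (fact (p - 1))" using \<xi> by (simp add: ipoly_simps)
  also have "\<dots> = emb (- 1)"
    by (rule emb_cong) (use wilson_theorem[OF prime_p] in simp)
  finally show ?thesis by (simp add: emb_minus)
qed

text \<open>
  Pascal's rule.
\<close>

lemma binom_elem_shift: "Suc k < p \<Longrightarrow> \<tau> (binom_elem \<xi> (Suc k)) = binom_elem \<xi> (Suc k) \<oplus> binom_elem \<xi> k"
proof (induction k)
  case 0
  then show ?case using \<xi> shift by (simp add: a_minus_def)
next
  case (Suc k)
  define b c e1 i where "b = binom_elem \<xi> (Suc k)" and "c = binom_elem \<xi> k" and "e1 = emb (int k)"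
    and "i = inv (emb (int (Suc (Suc k))))"
  have u: "emb (int (Suc (Suc k))) \<in> Units R" using emb_unit Suc.prems by blast
  have cl: "b \<in> carrier R" "c \<in> carrier R" "e1 \<in> carrier R" "i \<in> carrier R"
    using binom_elem_closed[OF \<xi>] Suc.prems u by (auto simp: b_def c_def e1_def i_def simp del: binom_elem.simps)
  have "emb (int (Suc n)) = emb (int n) \<oplus> \<one>" for n
    by (simp add: emb_add a_comm)
  then have e: "emb (int (Suc k)) = e1 \<oplus> \<one>" "emb (int (Suc (Suc k))) = e1 \<oplus> \<one> \<oplus> \<one>"
    by (simp_all only: e1_def)
  have i1: "(e1 \<oplus> \<one> \<oplus> \<one>) \<otimes> i = \<one>" using u unfolding i_def e(2) by simp
  have IH: "\<tau> b = b \<oplus> c" using Suc by (simp add: b_def c_def del: binom_elem.simps)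
  have bc: "b \<otimes> (e1 \<oplus> \<one>) = c \<otimes> (\<xi> \<ominus> e1)"
    using binom_elem_Suc_mult[OF \<xi>, of k] Suc.prems unfolding b_def c_def e1_def e(1)[unfolded e1_def]
    by (simp del: binom_elem.simps)
  have \<tau>e: "\<tau> e1 = e1" by (simp add: e1_def hom_emb)
  have \<tau>i: "\<tau> i = i"
  proof -
    have "(e1 \<oplus> \<one> \<oplus> \<one>) \<otimes> \<tau> i = \<tau> ((e1 \<oplus> \<one> \<oplus> \<one>) \<otimes> i)"
      using cl by (simp add: \<tau>e)
    then have "(e1 \<oplus> \<one> \<oplus> \<one>) \<otimes> \<tau> i = (e1 \<oplus> \<one> \<oplus> \<one>) \<otimes> i" by (simp add: i1)
    then show ?thesis using u cl unfolding e(2) by simp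
  qed
  have B: "binom_elem \<xi> (Suc (Suc k)) = b \<otimes> (\<xi> \<ominus> (e1 \<oplus> \<one>)) \<otimes> i"
    unfolding binom_elem.simps(2)[of _ "Suc k"] b_def[symmetric] e(1) i_def by (simp del: binom_elem.simps)
  have "\<tau> (binom_elem \<xi> (Suc (Suc k))) = (b \<oplus> c) \<otimes> (\<xi> \<oplus> \<one> \<ominus> (e1 \<oplus> \<one>)) \<otimes> i"
    unfolding B using cl \<xi> by (simp add: hom_minus IH \<tau>e \<tau>i shift)
  also have "\<dots> = (b \<otimes> (\<xi> \<ominus> e1) \<oplus> c \<otimes> (\<xi> \<ominus> e1)) \<otimes> i"
  proof -
    have "(b \<oplus> c) \<otimes> (\<xi> \<oplus> \<one> \<ominus> (e1 \<oplus> \<one>)) = b \<otimes> (\<xi> \<ominus> e1) \<oplus> c \<otimes> (\<xi> \<ominus> e1)"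
      using cl \<xi> by algebra
    then show ?thesis by simp
  qed
  also have "\<dots> = (b \<otimes> (\<xi> \<ominus> e1) \<oplus> b \<otimes> (e1 \<oplus> \<one>)) \<otimes> i" by (simp add: bc)
  also have "\<dots> = (b \<otimes> (\<xi> \<ominus> (e1 \<oplus> \<one>)) \<oplus> b \<otimes> (e1 \<oplus> \<one> \<oplus> \<one>)) \<otimes> i"
  proof -
    have "b \<otimes> (\<xi> \<ominus> e1) \<oplus> b \<otimes> (e1 \<oplus> \<one>) = b \<otimes> (\<xi> \<ominus> (e1 \<oplus> \<one>)) \<oplus> b \<otimes> (e1 \<oplus> \<one> \<oplus> \<one>)"
      using cl \<xi> by algebra
    then show ?thesis by simp
  qed
  also have "\<dots> = binom_elem \<xi> (Suc (Suc k)) \<oplus> b \<otimes> ((e1 \<oplus> \<one> \<oplus> \<one>) \<otimes> i)"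
    unfolding B using cl \<xi> by (simp add: l_distr m_assoc)
  finally show ?case using cl by (simp add: i1 b_def del: binom_elem.simps)
qed

lemma delta_binom_elem:
  assumes "Suc k < p"
  shows "delta \<tau> (binom_elem \<xi> (Suc k)) = binom_elem \<xi> k"
proof -
  have cl: "binom_elem \<xi> k \<in> carrier R" "binom_elem \<xi> (Suc k) \<in> carrier R"
    using binom_elem_closed[OF \<xi>] assms by (simp_all del: binom_elem.simps)
  show ?thesis unfolding delta_def binom_elem_shift[OF assms] using cl by algebra
qed

lemma delta_iter_binom_elem: "k < p \<Longrightarrow> (delta \<tau> ^^ k) (binom_elem \<xi> k) = \<one>"
proof (induction k)
  case (Suc k)
  then show ?case by (simp add: funpow_swap1 delta_binom_elem del: funpow.simps binom_elem.simps)
    (simp add: funpow_swap1 delta_binom_elem del: binom_elem.simps)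
qed simp

text \<open>
  The difference of order \<open>k\<close> of \<open>c (\<xi> choose k)\<close> is \<open>c\<close> for every fixed \<open>c\<close>, so subtracting the
  multiple with \<open>c\<close> the difference of order \<open>k\<close> of \<open>y\<close> makes that difference vanish.  Repeating the
  step expands \<open>y\<close> in the elements \<open>\<xi> choose i\<close> with fixed coefficients.
\<close>

lemma descent_step:
  assumes y: "y \<in> carrier R" and k: "k < p" and z: "(delta \<tau> ^^ Suc k) y = \<zero>"
  defines "c \<equiv> (delta \<tau> ^^ k) y"
  shows "\<tau> c = c" and "(delta \<tau> ^^ k) (y \<ominus> c \<otimes> binom_elem \<xi> k) = \<zero>"
proof -
  have c: "c \<in> carrier R" using y by (simp add: c_def delta_iter_closed)
  show cfix: "\<tau> c = c" using z c by (simp add: c_def[symmetric] delta_zero_iff)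
  have b: "binom_elem \<xi> k \<in> carrier R" using k \<xi> by (simp add: binom_elem_closed)
  show "(delta \<tau> ^^ k) (y \<ominus> c \<otimes> binom_elem \<xi> k) = \<zero>"
    using c b y k by (simp add: delta_iter_diff delta_iter_fixed_mult cfix delta_iter_binom_elem
        c_def[symmetric] r_right_minus_eq)
qed

text \<open>
  The summand \<open>c (\<xi> choose k)\<close> split off from \<open>y\<close> is the difference of \<open>c (\<xi> choose k + 1)\<close>, which
  exists because \<open>k + 1 < p\<close>.  In characteristic \<open>p\<close> the trace \<open>1 + \<tau> + \<dots> + \<tau> ^ (p - 1)\<close> is
  \<open>(\<tau> - 1) ^ (p - 1)\<close>, so \<open>k = p - 1\<close> is the additive form of Hilbert's Theorem 90.
\<close>

lemma additive_hilbert_90: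
  assumes S: "subfield S R" "\<xi> \<in> S" "\<And>s. s \<in> S \<Longrightarrow> \<tau> s \<in> S"
    and y: "y \<in> S" and "k < p" and "(delta \<tau> ^^ k) y = \<zero>"
  shows "\<exists>d\<in>S. delta \<tau> d = y"
  using y \<open>k < p\<close> \<open>(delta \<tau> ^^ k) y = \<zero>\<close>
proof (induction k arbitrary: y)
  case 0
  then show ?case
    using subringE(2)[OF subfieldE(1)[OF S(1)]] by (intro bexI[of _ "\<zero>"]) (simp_all add: delta_zero_iff)
next
  case (Suc k)
  note SR = subringE[OF subfieldE(1)[OF S(1)]]
  define c where "c = (delta \<tau> ^^ k) y"
  have yR: "y \<in> carrier R" using Suc.prems SR(1) by blast
  have c: "c \<in> S" unfolding c_def using delta_iter_subfield[OF S(1,3)] Suc.prems by blast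
  have b: "binom_elem \<xi> k \<in> S" "binom_elem \<xi> (Suc k) \<in> S"
    using binom_elem_subfield[OF S(1,2)] Suc.prems by (simp_all del: binom_elem.simps)
  note st = descent_step[OF yR _ Suc.prems(3), folded c_def]
  have "y \<ominus> c \<otimes> binom_elem \<xi> k \<in> S" using SR(5-7) c b Suc.prems by (simp add: a_minus_def)
  then obtain d where d: "d \<in> S" "delta \<tau> d = y \<ominus> c \<otimes> binom_elem \<xi> k"
    using Suc.IH st(2) Suc.prems(2) by auto
  let ?e = "c \<otimes> binom_elem \<xi> (Suc k)"
  have cl: "c \<in> carrier R" "d \<in> carrier R" "binom_elem \<xi> k \<in> carrier R" "binom_elem \<xi> (Suc k) \<in> carrier R"
    using c d b SR(1) by blast+
  have "delta \<tau> (d \<ominus> \<ominus> ?e) = delta \<tau> d \<ominus> \<ominus> (c \<otimes> binom_elem \<xi> k)"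
  proof -
    have "delta \<tau> (\<ominus> ?e) = \<ominus> (c \<otimes> binom_elem \<xi> k)"
      using delta_fixed_mult[of "\<ominus> c" "binom_elem \<xi> (Suc k)"] cl st(1) Suc.prems(2)
      by (simp add: l_minus delta_binom_elem del: binom_elem.simps)
    then show ?thesis using cl by (simp add: delta_diff del: binom_elem.simps)
  qed
  also have "\<dots> = y"
    unfolding d(2) using cl yR by algebra
  finally have "delta \<tau> (d \<ominus> \<ominus> ?e) = y" .
  moreover have "d \<ominus> \<ominus> ?e \<in> S" using SR(5-7) c b d by (simp add: a_minus_def del: binom_elem.simps)
  ultimately show ?case by blast
qed

text \<open>
  By the descent, \<open>y\<close> is a combination of the elements \<open>\<xi> choose i\<close> with \<open>i < k\<close> whose coefficients
  are fixed by \<open>\<tau>\<close>.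
\<close>

lemma generated_over_fixed:
  assumes T: "subfield T R" "\<xi> \<in> T" "\<And>x. \<lbrakk>x \<in> carrier R; \<tau> x = x\<rbrakk> \<Longrightarrow> x \<in> T"
    and y: "y \<in> carrier R" and "k \<le> p" and "(delta \<tau> ^^ k) y = \<zero>"
  shows "y \<in> T"
  using y \<open>k \<le> p\<close> \<open>(delta \<tau> ^^ k) y = \<zero>\<close>
proof (induction k arbitrary: y)
  case 0
  then show ?case using subringE(2)[OF subfieldE(1)[OF T(1)]] by simp
next
  case (Suc k)
  note TR = subringE[OF subfieldE(1)[OF T(1)]]
  define c where "c = (delta \<tau> ^^ k) y"
  note st = descent_step[OF Suc.prems(1) _ Suc.prems(3), folded c_def]
  have k: "k < p" using Suc.prems by simp
  have cl: "c \<in> carrier R" "binom_elem \<xi> k \<in> carrier R"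
    using Suc.prems by (simp_all add: c_def delta_iter_closed binom_elem_closed \<xi>)
  have cb: "c \<otimes> binom_elem \<xi> k \<in> T"
    using TR(6) T(3) cl st(1)[OF k] binom_elem_subfield[OF T(1,2) k] by simp
  have "y \<ominus> c \<otimes> binom_elem \<xi> k \<in> T"
    by (rule Suc.IH) (use Suc.prems cl st(2)[OF k] in auto)
  then have "(y \<ominus> c \<otimes> binom_elem \<xi> k) \<oplus> c \<otimes> binom_elem \<xi> k \<in> T" using TR(7) cb by blast
  moreover have "(y \<ominus> c \<otimes> binom_elem \<xi> k) \<oplus> c \<otimes> binom_elem \<xi> k = y"
    using cl Suc.prems(1) by algebra
  ultimately show ?case by simp
qed

end

text \<open>
  Since \<open>(\<tau> - 1) ^ p = \<tau> ^ p - 1 = 0\<close> but \<open>\<tau> \<noteq> 1\<close>, there is a \<open>z\<close> whose difference \<open>w\<close> is nonzero and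
  fixed; then \<open>z / w\<close> is the required element.
\<close>

lemma artin_schreier_generator:
  assumes per: "\<And>x. x \<in> carrier R \<Longrightarrow> (\<tau> ^^ p) x = x" and nt: "\<exists>x\<in>carrier R. \<tau> x \<noteq> x"
  shows "\<exists>x\<in>carrier R. \<tau> x = x \<oplus> \<one>"
proof -
  obtain y where y: "y \<in> carrier R" "\<tau> y \<noteq> y" using nt by blast
  define k where "k = (LEAST k. (delta \<tau> ^^ k) y = \<zero>)"
  have ex: "(delta \<tau> ^^ p) y = \<zero>" using y per by (simp add: delta_iter_p)
  have k0: "(delta \<tau> ^^ k) y = \<zero>" unfolding k_def by (rule LeastI[of _ p]) (rule ex)
  have less: "(delta \<tau> ^^ j) y \<noteq> \<zero>" if "j < k" for j
    using not_less_Least[of j "\<lambda>k. (delta \<tau> ^^ k) y = \<zero>"] that by (simp add: k_def)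
  have "k \<noteq> 0" using y k0 by (intro notI) simp
  moreover have "k \<noteq> 1" using y k0 by (intro notI) (simp add: delta_zero_iff)
  ultimately obtain j where j: "k = Suc (Suc j)" by (metis One_nat_def not0_implies_Suc)
  (* k = j + 2 is the order of nilpotency of tau - 1 at y, so w below is the last nonzero difference *)
  define z where "z = (delta \<tau> ^^ j) y"
  define w where "w = delta \<tau> z"
  have z: "z \<in> carrier R" using y by (simp add: z_def delta_iter_closed)
  have w: "w \<in> carrier R" using z by (simp add: w_def delta_closed)
  have w0: "w \<noteq> \<zero>" using less[of "Suc j"] j by (simp add: w_def z_def)
  have \<tau>w: "\<tau> w = w" using k0 w by (simp add: j w_def z_def delta_zero_iff)
  have u: "w \<in> Units R" using w w0 by (simp add: field_Units)
  have iw: "inv w \<in> carrier R" "w \<otimes> inv w = \<one>" using u by simp_all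
  have \<tau>iw: "\<tau> (inv w) = inv w"
  proof -
    have "w \<otimes> \<tau> (inv w) = \<tau> (w \<otimes> inv w)" by (simp only: S.hom_mult[OF w iw(1)] \<tau>w)
    then have "w \<otimes> \<tau> (inv w) = w \<otimes> inv w" using iw by simp
    moreover have "w \<otimes> \<tau> (inv w) = w \<otimes> inv w \<longleftrightarrow> \<tau> (inv w) = inv w"
      using iw by (intro Units_l_cancel[OF u]) simp_all
    ultimately show ?thesis by blast
  qed
  have "delta \<tau> (inv w \<otimes> z) = \<one>"
    unfolding delta_fixed_mult[OF iw(1) \<tau>iw z] w_def[symmetric] using u by simp
  moreover have "\<tau> (inv w \<otimes> z) = (inv w \<otimes> z) \<oplus> delta \<tau> (inv w \<otimes> z)"
  proof -
    have cl: "inv w \<otimes> z \<in> carrier R" "\<tau> (inv w \<otimes> z) \<in> carrier R" using iw z by simp_all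
    show ?thesis unfolding delta_def using cl by algebra
  qed
  ultimately show ?thesis using iw z by (intro bexI[of _ "inv w \<otimes> z"]) simp_all
qed

end

end

section \<open>Simple Artin--Schreier extensions\<close>

text \<open>
  Leading zeros are allowed in the list of coefficients, so the bound applies to a difference of two
  polynomials without normalizing it.
\<close>

lemma (in field) zero_poly_if_many_roots:
  assumes l: "set l \<subseteq> carrier R" and S: "S \<subseteq> carrier R" "finite S" "length l \<le> card S"
    and root: "\<And>s. s \<in> S \<Longrightarrow> eval l s = \<zero>"
  shows "set l \<subseteq> {\<zero>}"
proof (cases "normalize l = []")
  case True
  have "normalize q = [] \<Longrightarrow> set q \<subseteq> {\<zero>}" for q :: "'a list"
    by (induction q) (auto split: if_splits)
  then show ?thesis using True by blast
next
  case False
  define q where "q = normalize l"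
  have q: "q \<in> carrier (poly_ring R)"
    unfolding q_def using normalize_gives_polynomial[OF l] univ_poly_carrier by blast
  have "s \<in># roots q" if "s \<in> S" for s
  proof -
    have "is_root q s"
      using that S(1) root[OF that] False l by (auto simp: is_root_def q_def eval_normalize)
    then show ?thesis using roots_mem_iff_is_root[OF q] by blast
  qed
  then have "S \<subseteq> set_mset (roots q)" by blast
  then have "card S \<le> card (set_mset (roots q))" by (simp add: card_mono)
  also have "\<dots> \<le> size (roots q)"
  proof -
    have "card (set_mset M) \<le> size M" for M :: "'a multiset"
      by (induction M) (auto simp: card_insert_if le_SucI)
    then show ?thesis .
  qed
  also have "\<dots> \<le> Polynomials.degree q" by (rule size_roots_le_degree[OF q])
  finally have "card S \<le> length q - 1" .
  moreover have "length q > 0" using False by (simp add: q_def)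
  moreover have "length q \<le> length l" unfolding q_def by (rule normalize_length_le)
  ultimately show ?thesis using S(3) by linarith
qed

lemma ring_hom_factor:
  assumes "ring A" "ring R" "e \<in> ring_hom A R" "f \<in> ring_hom A R"
    and ker: "\<And>a. \<lbrakk>a \<in> carrier A; e a = \<zero>\<^bsub>R\<^esub>\<rbrakk> \<Longrightarrow> f a = \<zero>\<^bsub>R\<^esub>"
  obtains g where "g \<in> ring_hom (R\<lparr>carrier := e ` carrier A\<rparr>) R"
    and "\<And>a. a \<in> carrier A \<Longrightarrow> g (e a) = f a"
proof -
  interpret A: ring A by fact
  interpret R: ring R by fact
  interpret e: ring_hom_ring A R e using assms by (intro ring_hom_ringI2)
  interpret f: ring_hom_ring A R f using assms by (intro ring_hom_ringI2)
  define g where "g z = f (SOME a. a \<in> carrier A \<and> e a = z)" for z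
  have g: "g (e a) = f a" if a: "a \<in> carrier A" for a
  proof -
    define b where "b = (SOME b. b \<in> carrier A \<and> e b = e a)"
    have b: "b \<in> carrier A" "e b = e a"
      using someI[of "\<lambda>b. b \<in> carrier A \<and> e b = e a" a] a by (auto simp: b_def)
    have "e (a \<ominus>\<^bsub>A\<^esub> b) = \<zero>\<^bsub>R\<^esub>" using a b by (simp add: a_minus_def R.r_neg)
    then have "f (a \<ominus>\<^bsub>A\<^esub> b) = \<zero>\<^bsub>R\<^esub>" using a b by (intro ker) auto
    then have "f a \<ominus>\<^bsub>R\<^esub> f b = \<zero>\<^bsub>R\<^esub>" using a b by (simp add: a_minus_def)
    then show ?thesis using a b by (simp add: g_def b_def[symmetric])
  qed
  have "g \<in> ring_hom (R\<lparr>carrier := e ` carrier A\<rparr>) R"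
  proof (rule ring_hom_memI)
    have "g (e \<one>\<^bsub>A\<^esub>) = f \<one>\<^bsub>A\<^esub>" by (rule g) simp
    then show "g \<one>\<^bsub>R\<lparr>carrier := e ` carrier A\<rparr>\<^esub> = \<one>\<^bsub>R\<^esub>" by simp
  next
    fix x assume "x \<in> carrier (R\<lparr>carrier := e ` carrier A\<rparr>)"
    then obtain a where a: "a \<in> carrier A" "x = e a" by auto
    then show "g x \<in> carrier R" by (simp add: g)
    fix y assume "y \<in> carrier (R\<lparr>carrier := e ` carrier A\<rparr>)"
    then obtain b where b: "b \<in> carrier A" "y = e b" by auto
    show "g (x \<otimes>\<^bsub>R\<lparr>carrier := e ` carrier A\<rparr>\<^esub> y) = g x \<otimes>\<^bsub>R\<^esub> g y"
      using g[of "a \<otimes>\<^bsub>A\<^esub> b"] a b by (simp add: g)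
    show "g (x \<oplus>\<^bsub>R\<lparr>carrier := e ` carrier A\<rparr>\<^esub> y) = g x \<oplus>\<^bsub>R\<^esub> g y"
      using g[of "a \<oplus>\<^bsub>A\<^esub> b"] a b by (simp add: g)
  qed
  then show thesis using g by (rule that)
qed

text \<open>
  Mapping the coefficients along \<open>h\<close> may create leading zeros when \<open>h\<close> is not injective; this is
  harmless, since only values are compared.
\<close>

lemma (in cring) eval_map_is_hom:
  assumes F: "subring F R" and h: "h \<in> ring_hom (R\<lparr>carrier := F\<rparr>) R" and y: "y \<in> carrier R"
  shows "(\<lambda>q. eval (map h q) y) \<in> ring_hom (F[X]) R"
proof -
  note FR = subringE[OF F]
  have hc: "a \<in> F \<Longrightarrow> h a \<in> carrier R" for a using ring_hom_closed[OF h] by simp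
  have ha: "\<lbrakk>a \<in> F; b \<in> F\<rbrakk> \<Longrightarrow> h (a \<oplus> b) = h a \<oplus> h b" for a b using ring_hom_add[OF h] by simp
  have hm: "\<lbrakk>a \<in> F; b \<in> F\<rbrakk> \<Longrightarrow> h (a \<otimes> b) = h a \<otimes> h b" for a b using ring_hom_mult[OF h] by simp
  have h1: "h \<one> = \<one>" using ring_hom_one[OF h] by simp
  have h0: "h \<zero> = \<zero>" using ring_hom_zero[OF h subring_is_ring[OF F] ring_axioms] by simp
  have set: "set (map h q) \<subseteq> carrier R" if "set q \<subseteq> F" for q using that hc by auto
  have ec: "eval (map h q) y \<in> carrier R" if "set q \<subseteq> F" for q
    by (rule eval_in_carrier[OF set[OF that] y])
  have norm: "eval (map h (normalize q)) y = eval (map h q) y" if "set q \<subseteq> F" for q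
    using that
  proof (induction q)
    case (Cons a q)
    then have q: "set q \<subseteq> F" by simp
    show ?case
    proof (cases "a = \<zero>")
      case True
      then show ?thesis using Cons.IH[OF q] ec[OF q] y by (simp add: h0)
    qed simp
  qed simp
  have rep: "eval (map h (replicate n \<zero> @ q)) y = eval (map h q) y" if "set q \<subseteq> F" for n q
    using eval_replicate[OF set[OF that] y] by (simp add: h0)
  have add2: "eval (map h (map2 (\<oplus>) q r)) y = eval (map h q) y \<oplus> eval (map h r) y"
    if "length q = length r" "set q \<subseteq> F" "set r \<subseteq> F" for q r
    using that
  proof (induction q r rule: list_induct2)
    case (Cons a q b r)
    have "eval (map h q) y \<in> carrier R" "eval (map h r) y \<in> carrier R" using Cons.prems ec by auto
    then show ?case using Cons y hc ha by (simp add: l_distr a_ac)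
  qed simp
  have sub2: "set (map2 (\<oplus>) q r) \<subseteq> F" if "set q \<subseteq> F" "set r \<subseteq> F" for q r
  proof
    fix c assume "c \<in> set (map2 (\<oplus>) q r)"
    then obtain a b where "(a, b) \<in> set (zip q r)" "c = a \<oplus> b" by auto
    then show "c \<in> F" using that FR(7) set_zip_leftD set_zip_rightD by (metis subsetD)
  qed
  have subr: "set (replicate n \<zero> @ q) \<subseteq> F" if "set q \<subseteq> F" for n q
    using that FR(2) by auto
  have add: "eval (map h (poly_add q r)) y = eval (map h q) y \<oplus> eval (map h r) y"
    if q: "set q \<subseteq> F" and r: "set r \<subseteq> F" for q r
  proof (cases "length r \<le> length q")
    case True
    have "eval (map h (poly_add q r)) y = eval (map h (map2 (\<oplus>) q (replicate (length q - length r) \<zero> @ r))) y"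
      using True norm[OF sub2[OF q subr[OF r]]] by simp
    also have "\<dots> = eval (map h q) y \<oplus> eval (map h (replicate (length q - length r) \<zero> @ r)) y"
      by (rule add2[OF _ q subr[OF r]]) (use True in simp)
    finally show ?thesis by (simp only: rep[OF r])
  next
    case False
    have "eval (map h (poly_add q r)) y = eval (map h (map2 (\<oplus>) r (replicate (length r - length q) \<zero> @ q))) y"
      using False norm[OF sub2[OF r subr[OF q]]] by simp
    also have "\<dots> = eval (map h r) y \<oplus> eval (map h (replicate (length r - length q) \<zero> @ q)) y"
      by (rule add2[OF _ r subr[OF q]]) (use False in simp)
    finally show ?thesis by (simp only: rep[OF q] a_comm[OF ec[OF r] ec[OF q]])
  qed
  have smult: "eval (map h (map ((\<otimes>) a) q)) y = h a \<otimes> eval (map h q) y" if a: "a \<in> F" and "set q \<subseteq> F" for a q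
    using that(2)
  proof (induction q)
    case (Cons b q)
    have "eval (map h q) y \<in> carrier R" using Cons.prems ec by auto
    then show ?case using Cons y a hc by (simp add: hm r_distr m_assoc)
  qed (use hc[OF a] in simp)
  have mult: "eval (map h (poly_mult q r)) y = eval (map h q) y \<otimes> eval (map h r) y"
    if "set q \<subseteq> F" and r: "set r \<subseteq> F" for q r
    using that(1)
  proof (induction q)
    case Nil
    then show ?case using ec[OF r] by simp
  next
    case (Cons a q)
    let ?s = "map ((\<otimes>) a) r @ replicate (length q) \<zero>"
    have a: "a \<in> F" and q: "set q \<subseteq> F" using Cons.prems by auto
    have s: "set (map ((\<otimes>) a) r) \<subseteq> F" using r a FR(6) by auto
    have z: "set (replicate n \<zero>) \<subseteq> F" for n using FR(2) by auto
    have pm: "set (poly_mult q r) \<subseteq> F"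
      using polynomial_incl[OF poly_mult_is_polynomial[OF F q r]] .
    have ez: "eval (replicate n \<zero>) y = \<zero>" for n
      using eval_replicate[of "[]" y n] y by simp
    have "eval (map h ?s) y = eval (map h (map ((\<otimes>) a) r)) y \<otimes> y [^] length q \<oplus> \<zero>"
      using eval_append[OF set[OF s] set[OF z] y, of "length q"] by (simp add: h0 ez)
    also have "\<dots> = h a \<otimes> y [^] length q \<otimes> eval (map h r) y"
      using hc[OF a] y ec[OF r] by (simp add: smult[OF a r] m_ac del: map_map)
    finally have s': "eval (map h ?s) y = h a \<otimes> y [^] length q \<otimes> eval (map h r) y" .
    have "eval (map h (poly_mult (a # q) r)) y = eval (map h ?s) y \<oplus> eval (map h (poly_mult q r)) y"
      using add[of ?s "poly_mult q r"] s z pm by (simp del: poly_add.simps map_append map_map)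
    also have "\<dots> = (h a \<otimes> y [^] length q \<oplus> eval (map h q) y) \<otimes> eval (map h r) y"
      unfolding s' Cons.IH[OF q] using hc[OF a] y ec[OF q] ec[OF r] by (simp add: l_distr)
    finally show ?case by simp
  qed
  have inF: "set q \<subseteq> F" if "q \<in> carrier (F[X])" for q
    using that polynomial_incl unfolding univ_poly_carrier[symmetric] by blast
  show ?thesis
  proof (rule ring_hom_memI)
    show "eval (map h \<one>\<^bsub>F[X]\<^esub>) y = \<one>" using y by (simp add: univ_poly_one h1)
  qed (auto simp: univ_poly_add univ_poly_mult add mult inF ec simp del: poly_add.simps poly_mult.simps)
qed

context char_p_field begin

text \<open>
  The coefficients of \<open>X ^ p - X - b\<close>, leading coefficient first.
\<close>

definition as_poly :: "'a \<Rightarrow> 'a list" where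
  "as_poly b = \<one> # replicate (p - 2) \<zero> @ [\<ominus> \<one>, \<ominus> b]"

lemma length_as_poly: "length (as_poly b) = Suc p"
  using p_gt_1 by (simp add: as_poly_def)

lemma eval_as_poly:
  assumes "b \<in> carrier R" "x \<in> carrier R"
  shows "eval (as_poly b) x = x [^] p \<ominus> x \<ominus> b"
proof -
  have "Suc (Suc (p - 2)) = p" using p_gt_1 by simp
  then show ?thesis
    unfolding as_poly_def using assms eval_replicate[of "[\<ominus> \<one>, \<ominus> b]" x "p - 2"]
    by (simp add: a_minus_def l_minus a_assoc)
qed

lemma as_poly_carrier:
  assumes "subfield F R" "b \<in> F"
  shows "as_poly b \<in> carrier (F[X])"
  unfolding univ_poly_carrier[symmetric] polynomial_def as_poly_def
  using subringE[OF subfieldE(1)[OF assms(1)]] assms(2) by auto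

lemma emb_inj: "inj_on (\<lambda>i. emb (int i)) {..<p}"
proof (rule linorder_inj_onI)
  fix i j assume ij: "i < j" "i \<in> {..<p}" "j \<in> {..<p}"
  show "emb (int i) \<noteq> emb (int j)"
  proof
    assume "emb (int i) = emb (int j)"
    then have "emb (int j - int i) = \<zero>"
      unfolding diff_conv_add_uminus emb_add emb_minus by (simp add: r_neg)
    then have "int p dvd int j - int i" by (simp add: emb_eq_0_iff)
    then have "int p \<le> int j - int i" using ij by (intro zdvd_imp_le) auto
    then show False using ij by auto
  qed
qed auto

text \<open>
  The \<open>p\<close> elements of the prime field are roots of \<open>X ^ p - X\<close>, and there is no room for another one.
\<close>

lemma frobenius_fixed:
  assumes t: "t \<in> carrier R" "t [^] p = t"
  shows "\<exists>i<p. t = emb (int i)"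
proof (rule ccontr)
  assume no: "\<not> ?thesis"
  let ?S = "insert t ((\<lambda>i. emb (int i)) ` {..<p})"
  have "card ?S = Suc p" using no emb_inj by (subst card_insert_disjoint) (auto simp: card_image)
  have "set (as_poly \<zero>) \<subseteq> {\<zero>}"
  proof (rule zero_poly_if_many_roots)
    show "length (as_poly \<zero>) \<le> card ?S" by (simp only: length_as_poly \<open>card ?S = Suc p\<close>)
    show "set (as_poly \<zero>) \<subseteq> carrier R" by (auto simp: as_poly_def)
    fix s assume "s \<in> ?S"
    then have "s \<in> carrier R" "s [^] p = s" using t by (auto simp: emb_frobenius)
    then show "eval (as_poly \<zero>) s = \<zero>" by (simp add: eval_as_poly a_minus_def r_neg)
  qed (use t in auto)
  then show False by (simp add: as_poly_def)
qed

lemma artin_schreier_extension: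
  assumes F: "subfield F R" and x: "x \<in> carrier R" and b: "x [^] p \<ominus> x \<in> F"
  shows "subfield (simple_extension F x) R"
    and "Polynomials.degree (Irr F x) \<le> p"
    and "dimension (Polynomials.degree (Irr F x)) F (simple_extension F x)"
proof -
  have bR: "x [^] p \<ominus> x \<in> carrier R" using x by simp
  have root: "eval (as_poly (x [^] p \<ominus> x)) x = \<zero>"
    using x bR by (simp add: eval_as_poly a_minus_def r_neg)
  have ne: "as_poly (x [^] p \<ominus> x) \<noteq> []" by (simp add: as_poly_def)
  note pc = as_poly_carrier[OF F b]
  have alg: "(algebraic over F) x" by (rule algebraicI[OF pc ne root])
  show "subfield (simple_extension F x) R" using simple_extension_is_subfield[OF F x] alg by blast
  show "dimension (Polynomials.degree (Irr F x)) F (simple_extension F x)"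
    by (rule dimension_simple_extension[OF F x alg])
  have "Polynomials.degree (Irr F x) \<le> Polynomials.degree (as_poly (x [^] p \<ominus> x))"
    by (rule pdivides_imp_degree_le[OF subfieldE(1)[OF F] IrrE(1)[OF F x alg] pc ne
          Irr_minimal[OF F x alg pc root]])
  then show "Polynomials.degree (Irr F x) \<le> p" by (simp add: length_as_poly)
qed

lemma as_poly_reduce:
  assumes F: "subfield F R" and x: "x \<in> carrier R" and b: "b \<in> F" and f: "f \<in> carrier (F[X])"
  obtains q r where "q \<in> carrier (F[X])" "r \<in> carrier (F[X])" "length r \<le> p"
    "f = as_poly b \<otimes>\<^bsub>F[X]\<^esub> q \<oplus>\<^bsub>F[X]\<^esub> r"
proof -
  have ne: "as_poly b \<noteq> \<zero>\<^bsub>F[X]\<^esub>" by (simp add: univ_poly_zero as_poly_def)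
  obtain q r where "q \<in> carrier (F[X])" "r \<in> carrier (F[X])"
    "f = as_poly b \<otimes>\<^bsub>F[X]\<^esub> q \<oplus>\<^bsub>F[X]\<^esub> r" "r = \<zero>\<^bsub>F[X]\<^esub> \<or> Polynomials.degree r < Polynomials.degree (as_poly b)"
    using subfield_long_division_theorem_shell[OF F f as_poly_carrier[OF F b] ne] by blast
  moreover from this(4) have "length r \<le> p" by (auto simp: univ_poly_zero length_as_poly)
  ultimately show thesis using that by blast
qed

text \<open>
  If \<open>f(x) = 0\<close>, the remainder of \<open>f\<close> modulo \<open>X ^ p - X - b\<close> has degree less than the degree \<open>p\<close> of \<open>x\<close> and
  vanishes at \<open>x\<close>, hence is zero.  So \<open>f\<close> is a multiple of \<open>X ^ p - X - b\<close>, and mapping its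
  coefficients along \<open>h\<close> gives a polynomial that vanishes at \<open>y\<close>.  The assignment
  \<open>f(x) \<mapsto> (h f)(y)\<close> is therefore well defined.
\<close>

lemma extend_hom:
  assumes F: "subfield F R" and x: "x \<in> carrier R" and b: "x [^] p \<ominus> x \<in> F"
    and deg: "Polynomials.degree (Irr F x) = p"
    and h: "h \<in> ring_hom (R\<lparr>carrier := F\<rparr>) R"
    and y: "y \<in> carrier R" "y [^] p \<ominus> y = h (x [^] p \<ominus> x)"
  obtains g where "g \<in> ring_hom (R\<lparr>carrier := simple_extension F x\<rparr>) R"
    and "\<And>a. a \<in> F \<Longrightarrow> g a = h a" and "g x = y"
proof -
  define \<beta> where "\<beta> = x [^] p \<ominus> x"
  note FR = subringE[OF subfieldE(1)[OF F]]
  have bF: "\<beta> \<in> F" using b by (simp add: \<beta>_def)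
  let ?e = "\<lambda>q. eval q x" and ?f = "\<lambda>q. eval (map h q) y"
  have alg: "(algebraic over F) x"
    using simple_extension_is_subfield[OF F x] artin_schreier_extension(1)[OF F x b] by blast
  have e: "?e \<in> ring_hom (F[X]) R" by (rule eval_is_hom[OF subfieldE(1)[OF F] x])
  have f: "?f \<in> ring_hom (F[X]) R" by (rule eval_map_is_hom[OF subfieldE(1)[OF F] h y(1)])
  note hc = subfield_hom_simps(3)[OF F h] and h1 = subfield_hom_simps(4)[OF F h]
    and h0 = subfield_hom_simps(5)[OF F h] and hneg = subfield_hom_minus[OF F h]
  have root: "?e (as_poly \<beta>) = \<zero>"
    using x by (simp add: \<beta>_def eval_as_poly a_minus_def r_neg)
  have "map h (as_poly \<beta>) = as_poly (h \<beta>)"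
    using FR(3) bF by (simp add: as_poly_def h1 h0 hneg map_replicate)
  then have rootf: "?f (as_poly \<beta>) = \<zero>"
    using y hc[OF bF] unfolding \<beta>_def[symmetric] by (simp add: eval_as_poly a_minus_def r_neg)
  have ker: "?f q = \<zero>" if q: "q \<in> carrier (F[X])" and q0: "?e q = \<zero>" for q
  proof -
    obtain s r where s: "s \<in> carrier (F[X])" and r: "r \<in> carrier (F[X])" "length r \<le> p"
      and eq: "q = as_poly \<beta> \<otimes>\<^bsub>F[X]\<^esub> s \<oplus>\<^bsub>F[X]\<^esub> r"
      by (rule as_poly_reduce[OF F x bF q])
    note pc = as_poly_carrier[OF F bF]
    have UP: "ring (F[X])" by (rule univ_poly_is_ring[OF subfieldE(1)[OF F]])
    have m: "as_poly \<beta> \<otimes>\<^bsub>F[X]\<^esub> s \<in> carrier (F[X])"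
      using pc s by (rule ring.ring_simprules(5)[OF UP])
    have e1: "k q = k (as_poly \<beta>) \<otimes> k s \<oplus> k r" if "k \<in> ring_hom (F[X]) R" for k
      unfolding eq ring_hom_add[OF that m r(1)] ring_hom_mult[OF that pc s] ..
    have kc: "k s \<in> carrier R" "k r \<in> carrier R" if "k \<in> ring_hom (F[X]) R" for k
      using ring_hom_closed[OF that] s r(1) by auto
    have "?e r = \<zero>" using e1[OF e] kc[OF e] root q0 by simp
    have "r = []"
    proof (rule ccontr)
      assume ne: "r \<noteq> []"
      have "Polynomials.degree (Irr F x) \<le> Polynomials.degree r"
        by (rule pdivides_imp_degree_le[OF subfieldE(1)[OF F] IrrE(1)[OF F x alg] r(1) ne
              Irr_minimal[OF F x alg r(1) \<open>?e r = \<zero>\<close>]])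
      moreover have "length r > 0" using ne by simp
      ultimately show False using deg r(2) by linarith
    qed
    then show "?f q = \<zero>" using e1[OF f] kc[OF f] rootf by simp
  qed
  obtain g where g: "g \<in> ring_hom (R\<lparr>carrier := ?e ` carrier (F[X])\<rparr>) R"
    "\<And>q. q \<in> carrier (F[X]) \<Longrightarrow> g (?e q) = ?f q"
    by (rule ring_hom_factor[OF univ_poly_is_ring[OF subfieldE(1)[OF F]] ring_axioms e f ker]) blast+
  show thesis
  proof (rule that)
    show "g \<in> ring_hom (R\<lparr>carrier := simple_extension F x\<rparr>) R"
      using g(1) by (simp add: simple_extension_as_eval_img[OF FR(1) x])
    show "g a = h a" if a: "a \<in> F" for a
    proof (cases "a = \<zero>")
      case True
      then show ?thesis using g(2)[of "[]"] by (auto simp: h0)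
    next
      case False
      then have "[a] \<in> carrier (F[X])"
        unfolding univ_poly_carrier[symmetric] polynomial_def using a by simp
      from g(2)[OF this] show ?thesis using a FR(1) hc x y by (simp add: subset_iff)
    qed
    have "[\<one>, \<zero>] \<in> carrier (F[X])"
      unfolding univ_poly_carrier[symmetric] polynomial_def using FR(2,3) by simp
    from g(2)[OF this] show "g x = y" using x y by (simp add: h1 h0)
  qed
qed

lemma hom_eval_fixed:
  assumes \<tau>: "\<tau> \<in> ring_hom R R" and l: "set l \<subseteq> carrier R" "\<And>a. a \<in> set l \<Longrightarrow> \<tau> a = a"
    and x: "x \<in> carrier R"
  shows "\<tau> (eval l x) = eval l (\<tau> x)"
proof -
  interpret h: ring_hom_ring R R \<tau> using \<tau> by (intro ring_hom_ringI2) unfold_locales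
  have "map \<tau> l = l" using l(2) by (rule map_idI)
  then show ?thesis using h.eval_hom'[OF x l(1)] by simp
qed

text \<open>
  Write \<open>z = r(x)\<close> with \<open>r\<close> of degree less than \<open>p\<close> over \<open>F\<close>.  Applying \<open>\<tau>\<close> repeatedly gives
  \<open>r(x + j) = z\<close> for all \<open>j\<close>, so \<open>r - z\<close> has \<open>p\<close> roots and is zero: \<open>z\<close> is the constant coefficient
  of \<open>r\<close>.
\<close>

lemma fixed_in_simple_extension:
  assumes \<tau>: "\<tau> \<in> ring_hom R R" and F: "subfield F R" and fix_F: "\<And>a. a \<in> F \<Longrightarrow> \<tau> a = a"
    and x: "x \<in> carrier R" and b: "x [^] p \<ominus> x \<in> F" and shift: "\<tau> x = x \<oplus> \<one>"
    and z: "z \<in> simple_extension F x" and fix_z: "\<tau> z = z"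
  shows "z \<in> F"
proof -
  interpret h: ring_hom_ring R R \<tau> using \<tau> by (intro ring_hom_ringI2) unfold_locales
  define \<beta> where "\<beta> = x [^] p \<ominus> x"
  note FR = subringE[OF subfieldE(1)[OF F]]
  have bF: "\<beta> \<in> F" using b by (simp add: \<beta>_def)
  have e: "(\<lambda>q. eval q x) \<in> ring_hom (F[X]) R" by (rule eval_is_hom[OF subfieldE(1)[OF F] x])
  obtain q where q: "q \<in> carrier (F[X])" "z = eval q x"
    using z by (auto simp: simple_extension_as_eval_img[OF FR(1) x])
  obtain s r where s: "s \<in> carrier (F[X])" and r: "r \<in> carrier (F[X])" "length r \<le> p"
    and eq: "q = as_poly \<beta> \<otimes>\<^bsub>F[X]\<^esub> s \<oplus>\<^bsub>F[X]\<^esub> r"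
    by (rule as_poly_reduce[OF F x bF q(1)])
  note pc = as_poly_carrier[OF F bF]
  have UP: "ring (F[X])" by (rule univ_poly_is_ring[OF subfieldE(1)[OF F]])
  have m: "as_poly \<beta> \<otimes>\<^bsub>F[X]\<^esub> s \<in> carrier (F[X])"
    using pc s by (rule ring.ring_simprules(5)[OF UP])
  have root: "eval (as_poly \<beta>) x = \<zero>"
    using x by (simp add: \<beta>_def eval_as_poly a_minus_def r_neg)
  have zr: "z = eval r x"
    using ring_hom_closed[OF e s] ring_hom_closed[OF e r(1)]
    unfolding q(2) eq ring_hom_add[OF e m r(1)] ring_hom_mult[OF e pc s] by (simp add: root)
  have rF: "set r \<subseteq> F" using r(1) polynomial_incl unfolding univ_poly_carrier[symmetric] by blast
  then have rR: "set r \<subseteq> carrier R" using FR(1) by blast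
  have iter: "eval r (x \<oplus> emb (int j)) = z" for j
  proof (induction j)
    case (Suc j)
    have "x \<oplus> emb (int (Suc j)) = \<tau> (x \<oplus> emb (int j))"
      using x by (simp add: shift emb_add hom_emb[OF \<tau>] a_ac)
    then have "eval r (x \<oplus> emb (int (Suc j))) = \<tau> (eval r (x \<oplus> emb (int j)))"
      using hom_eval_fixed[OF \<tau> rR] rF fix_F x by (metis a_closed emb_closed subsetD)
    then show ?case using Suc fix_z by simp
  qed (use x zr in simp)
  show ?thesis
  proof (cases r rule: rev_cases)
    case Nil
    then show ?thesis using zr FR(2) by simp
  next
    case (snoc r' c)
    have zR: "z \<in> carrier R" using zr eval_in_carrier[OF rR x] by simp
    have c: "c \<in> F" "c \<in> carrier R" and r': "set r' \<subseteq> carrier R" using snoc rF rR by auto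
    let ?S = "(\<lambda>j. x \<oplus> emb (int j)) ` {..<p}"
    have "inj_on (\<lambda>j. x \<oplus> emb (int j)) {..<p}"
      using emb_inj x by (auto simp: inj_on_def)
    then have "card ?S = p" by (simp add: card_image)
    (* this list represents r - z, because the last entry is the constant coefficient *)
    have "set (r' @ [c \<ominus> z]) \<subseteq> {\<zero>}"
    proof (rule zero_poly_if_many_roots)
      show "length (r' @ [c \<ominus> z]) \<le> card ?S" using r(2) snoc \<open>card ?S = p\<close> by simp
      fix t assume "t \<in> ?S"
      then obtain j where t: "t = x \<oplus> emb (int j)" by auto
      have tR: "t \<in> carrier R" using x t by simp
      have ev: "eval r' t \<in> carrier R" by (rule eval_in_carrier[OF r' tR])
      have "eval r' t \<otimes> t \<oplus> c = z"
        using iter[of j] eval_append_aux[OF r' c(2) tR] by (simp add: snoc t)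
      then have "eval r' t \<otimes> t \<oplus> c \<ominus> z = \<zero>" using zR by (simp add: a_minus_def r_neg)
      then show "eval (r' @ [c \<ominus> z]) t = \<zero>"
        using eval_append_aux[OF r' _ tR, of "c \<ominus> z"] c zR ev tR by (simp add: a_minus_def a_assoc)
    qed (use r' c zR x in auto)
    then have "c \<ominus> z = \<zero>" by simp
    then show ?thesis using c zR by simp
  qed
qed

end

section \<open>Homomorphisms from presented groups and normal forms in \<open>G\<close>\<close>

context group begin

definition word_val :: "('g \<Rightarrow> 'a) \<Rightarrow> 'g word \<Rightarrow> 'a" where
  "word_val s w = foldr (\<lambda>(g, b) x. (if b then s g else inv (s g)) \<otimes> x) w \<one>"

context
  fixes s :: "'g \<Rightarrow> 'a" assumes s: "\<And>g. s g \<in> carrier G"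
begin

lemma word_val_closed: "word_val s w \<in> carrier G"
  unfolding word_val_def by (induction w) (auto simp: s)

lemma word_val_append: "word_val s (u @ v) = word_val s u \<otimes> word_val s v"
proof (induction u)
  case Nil
  have "word_val s [] = \<one>" by (simp add: word_val_def)
  then show ?case using word_val_closed[of v] by simp
next
  case (Cons l u)
  have c: "word_val s (l # w) = (if snd l then s (fst l) else inv (s (fst l))) \<otimes> word_val s w" for w
    by (simp add: word_val_def case_prod_beta)
  show ?case using Cons by (simp add: c m_assoc word_val_closed s)
qed

lemma word_val_Nil: "word_val s [] = \<one>"
  by (simp add: word_val_def)

lemma word_val_letter: "word_val s [(g, True)] = s g"
  by (simp add: word_val_def s)

lemma word_val_replicate: "word_val s (replicate n (g, True)) = s g [^] n"
proof (induction n)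
  case (Suc n)
  have "replicate (Suc n) (g, True) = replicate n (g, True) @ [(g, True)]"
    by (simp add: replicate_append_same)
  then show ?case using Suc by (simp add: word_val_append word_val_letter del: replicate_Suc)
qed (simp add: word_val_Nil)

lemma word_val_cong:
  assumes R: "\<And>u v. (u, v) \<in> R \<Longrightarrow> word_val s u = word_val s v"
  shows "word_cong R u v \<Longrightarrow> word_val s u = word_val s v"
proof (induction rule: word_cong.induct)
  case (cancel g b)
  then show ?case by (cases b) (simp_all add: word_val_def s)
qed (simp_all add: R word_val_append)

text \<open>
  Von Dyck's theorem.
\<close>

lemma presented_group_hom:
  assumes R: "\<And>u v. (u, v) \<in> R \<Longrightarrow> word_val s u = word_val s v"
  obtains f where "f \<in> hom (presented_group R) G"
    and "\<And>u. f (word_class R u) = word_val s u"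
proof -
  define f where "f A = word_val s (SOME u. word_class R u = A)" for A
  have f: "f (word_class R u) = word_val s u" for u
  proof -
    have "word_class R (SOME v. word_class R v = word_class R u) = word_class R u"
      by (rule someI[of _ u]) simp
    then have "word_cong R (SOME v. word_class R v = word_class R u) u"
      by (rule word_class_eq_iff[THEN iffD1])
    then show ?thesis unfolding f_def using word_val_cong[of R, OF R] by blast
  qed
  have "f \<in> hom (presented_group R) G"
  proof (rule homI)
    fix x assume "x \<in> carrier (presented_group R)"
    then obtain u where x: "x = word_class R u" by (auto simp: presented_group_def)
    show "f x \<in> carrier G" by (simp add: x f word_val_closed)
    fix y assume "y \<in> carrier (presented_group R)"
    then obtain v where y: "y = word_class R v" by (auto simp: presented_group_def)
    show "f (x \<otimes>\<^bsub>presented_group R\<^esub> y) = f x \<otimes> f y"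
      by (simp add: x y f mult_word_class word_val_append)
  qed
  then show thesis using f by (rule that)
qed

end

lemma commute_pow:
  assumes "x \<in> carrier G" "y \<in> carrier G" "x \<otimes> y = y \<otimes> x"
  shows "x [^] (n::nat) \<otimes> y = y \<otimes> x [^] n"
  by (induction n) (use assms in \<open>simp_all add: m_assoc, metis m_assoc nat_pow_closed\<close>)

lemma commute_inv:
  assumes x: "x \<in> carrier G" and y: "y \<in> carrier G" and c: "x \<otimes> y = y \<otimes> x"
  shows "x \<otimes> inv y = inv y \<otimes> x"
proof -
  have "x \<otimes> inv y = inv y \<otimes> (y \<otimes> x) \<otimes> inv y" using x y by (simp add: m_assoc[symmetric])
  also have "\<dots> = inv y \<otimes> x" unfolding c[symmetric] using x y by (simp add: m_assoc)
  finally show ?thesis .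
qed

end

text \<open>
  Three elements of a group that satisfy the defining relations of \<open>G\<close>; the relations that make the third
  generator central are only required for the other two generators.
\<close>

locale G_relations = group G for G (structure) +
  fixes p a0 a1 :: nat and s1 s2 s3 :: 'a
  assumes s_closed [simp]: "s1 \<in> carrier G" "s2 \<in> carrier G" "s3 \<in> carrier G"
    and p_pos: "p > 0"
    and rel1: "s1 [^] p = s3 [^] a1" and rel2: "s2 [^] p = \<one>" and rel3: "s3 [^] p = \<one>"
    and rel21: "s2 \<otimes> s1 = s1 \<otimes> s2 \<otimes> s3 [^] a0"
    and central1: "s3 \<otimes> s1 = s1 \<otimes> s3" and central2: "s3 \<otimes> s2 = s2 \<otimes> s3"
begin

text \<open>
  The normal form \<open>s\<^sub>1\<^sup>i s\<^sub>2\<^sup>j s\<^sub>3\<^sup>k\<close>; exponents are not reduced modulo \<open>p\<close>, so a given element has many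
  normal forms.
\<close>

definition nf :: "nat \<Rightarrow> nat \<Rightarrow> nat \<Rightarrow> 'a" where
  "nf i j k = s1 [^] i \<otimes> s2 [^] j \<otimes> s3 [^] k"

lemma nf_mult3: "nf i j k \<otimes> s3 = nf i j (Suc k)"
  by (simp add: nf_def m_assoc)

lemma nf_mult2: "nf i j k \<otimes> s2 = nf i (Suc j) k"
  using commute_pow[of s3 s2 k] central2 by (simp add: nf_def m_assoc)

lemma s2_pow_s1: "s2 [^] j \<otimes> s1 = s1 \<otimes> s2 [^] j \<otimes> s3 [^] (a0 * j)"
proof (induction j)
  case (Suc j)
  have c2: "s3 [^] n \<otimes> s2 = s2 \<otimes> s3 [^] n" for n :: nat
    by (rule commute_pow) (simp_all add: central2)
  have "s2 [^] Suc j \<otimes> s1 = (s2 [^] j \<otimes> s1) \<otimes> s2 \<otimes> s3 [^] a0"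
    using rel21 by (simp add: m_assoc)
  also have "\<dots> = s1 \<otimes> s2 [^] j \<otimes> (s3 [^] (a0 * j) \<otimes> s2) \<otimes> s3 [^] a0"
    by (simp add: Suc m_assoc)
  also have "\<dots> = s1 \<otimes> s2 [^] Suc j \<otimes> (s3 [^] (a0 * j) \<otimes> s3 [^] a0)"
    unfolding c2 by (simp add: m_assoc)
  also have "s3 [^] (a0 * j) \<otimes> s3 [^] a0 = s3 [^] (a0 * Suc j)"
    by (simp add: nat_pow_mult add.commute)
  finally show ?case .
qed simp

lemma nf_mult1: "nf i j k \<otimes> s1 = nf (Suc i) j (a0 * j + k)"
proof -
  have "nf i j k \<otimes> s1 = s1 [^] i \<otimes> (s2 [^] j \<otimes> s1) \<otimes> s3 [^] k"
    using commute_pow[of s3 s1 k] central1 by (simp add: nf_def m_assoc)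
  also have "\<dots> = nf (Suc i) j (a0 * j + k)"
    unfolding s2_pow_s1 by (simp add: nf_def m_assoc nat_pow_mult)
  finally show ?thesis .
qed

lemma nf_closed [simp]: "nf i j k \<in> carrier G"
  by (simp add: nf_def)

abbreviation NF :: "'a set" where "NF \<equiv> {nf i j k | i j k. True}"

lemma NF_mult:
  assumes "x \<in> NF" "s \<in> {s1, s2, s3}"
  shows "x \<otimes> s \<in> NF"
  using assms nf_mult1 nf_mult2 nf_mult3 by auto metis+

text \<open>
  The generators have finite order, so their inverses are powers with nonnegative exponent.
\<close>

lemma NF_mult_inv:
  assumes x: "x \<in> NF" and s: "s \<in> {s1, s2, s3}"
  shows "x \<otimes> inv s \<in> NF"
proof -
  have "s1 [^] (p * p) = s3 [^] (a1 * p)"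
    using rel1 by (simp add: nat_pow_pow[symmetric])
  also have "\<dots> = (s3 [^] p) [^] a1" by (simp add: nat_pow_pow mult.commute)
  finally have "s1 [^] (p * p) = \<one>" by (simp add: rel3)
  moreover have "s2 [^] (p * p) = \<one>" "s3 [^] (p * p) = \<one>"
    by (simp_all add: nat_pow_pow[symmetric] rel2 rel3)
  ultimately have "s [^] (p * p) = \<one>" using s by auto
  moreover obtain n where n: "p * p = Suc n" using p_pos by (metis mult_pos_pos gr0_conv_Suc)
  ultimately have "s [^] n \<otimes> s = \<one>" by simp
  then have "inv s = s [^] n" using s by (intro inv_equality) auto
  moreover have "x \<otimes> s [^] m \<in> NF" for m :: nat
  proof (induction m)
    case 0
    have "x \<otimes> s [^] (0::nat) = x" using x by auto
    then show ?case using x by (simp only:)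
  next
    case (Suc m)
    have "x \<in> carrier G" using x by auto
    then have "x \<otimes> s [^] Suc m = (x \<otimes> s [^] m) \<otimes> s" using s by (auto simp: m_assoc)
    then show ?case using NF_mult[OF Suc s] by simp
  qed
  ultimately show ?thesis by simp
qed

end

lemma G_group_relations:
  assumes "p > 0"
  shows "G_relations (G_group p a0 a1) p a0 a1 (G_gen p a0 a1 S1) (G_gen p a0 a1 S2) (G_gen p a0 a1 S3)"
proof -
  let ?R = "G_rels p a0 a1" and ?G = "G_group p a0 a1"
  interpret group ?G unfolding G_group_def by (rule group_presented_group)
  note G = G_group_def[symmetric, of p a0 a1]
  have one: "\<one>\<^bsub>?G\<^esub> = word_class ?R []" by (simp add: G_group_def presented_group_def)
  have car: "word_class ?R u \<in> carrier ?G" for u by (simp add: G_group_def presented_group_def)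
  have mult: "word_class ?R u \<otimes>\<^bsub>?G\<^esub> word_class ?R v = word_class ?R (u @ v)" for u v
    unfolding G_group_def by (rule mult_word_class)
  have pow: "G_gen p a0 a1 g [^]\<^bsub>?G\<^esub> n = word_class ?R (replicate n (g, True))" for g and n :: nat
    by (induction n) (simp_all add: one mult G_gen_def replicate_append_same)
  have rel: "word_class ?R u = word_class ?R v" if "(u, v) \<in> ?R" for u v
    using that by (simp add: word_class_eq_iff word_cong.rel)
  show ?thesis
  proof
    show "G_gen p a0 a1 S1 \<in> carrier ?G" "G_gen p a0 a1 S2 \<in> carrier ?G" "G_gen p a0 a1 S3 \<in> carrier ?G"
      by (simp_all add: G_gen_def car)
    show "p > 0" by fact
    show "G_gen p a0 a1 S1 [^]\<^bsub>?G\<^esub> p = G_gen p a0 a1 S3 [^]\<^bsub>?G\<^esub> a1"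
      unfolding pow by (rule rel) (simp add: G_rels_def Let_def)
    show "G_gen p a0 a1 S2 [^]\<^bsub>?G\<^esub> p = \<one>\<^bsub>?G\<^esub>" "G_gen p a0 a1 S3 [^]\<^bsub>?G\<^esub> p = \<one>\<^bsub>?G\<^esub>"
      unfolding pow one by (rule rel, simp add: G_rels_def Let_def)+
    show "G_gen p a0 a1 S2 \<otimes>\<^bsub>?G\<^esub> G_gen p a0 a1 S1 =
        G_gen p a0 a1 S1 \<otimes>\<^bsub>?G\<^esub> G_gen p a0 a1 S2 \<otimes>\<^bsub>?G\<^esub> G_gen p a0 a1 S3 [^]\<^bsub>?G\<^esub> a0"
      unfolding pow unfolding G_gen_def mult by (rule rel) (simp add: G_rels_def Let_def)
    show "G_gen p a0 a1 S3 \<otimes>\<^bsub>?G\<^esub> G_gen p a0 a1 S1 = G_gen p a0 a1 S1 \<otimes>\<^bsub>?G\<^esub> G_gen p a0 a1 S3"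
      "G_gen p a0 a1 S3 \<otimes>\<^bsub>?G\<^esub> G_gen p a0 a1 S2 = G_gen p a0 a1 S2 \<otimes>\<^bsub>?G\<^esub> G_gen p a0 a1 S3"
      unfolding G_gen_def mult by (rule rel, simp add: G_rels_def Let_def)+
  qed
qed

lemma G_group_normal_form:
  assumes "p > 0" and x: "x \<in> carrier (G_group p a0 a1)"
  obtains i j k where "x = G_relations.nf (G_group p a0 a1)
      (G_gen p a0 a1 S1) (G_gen p a0 a1 S2) (G_gen p a0 a1 S3) i j k"
proof -
  let ?R = "G_rels p a0 a1" and ?G = "G_group p a0 a1"
  interpret G_relations ?G p a0 a1 "G_gen p a0 a1 S1" "G_gen p a0 a1 S2" "G_gen p a0 a1 S3"
    by (rule G_group_relations[OF assms(1)])
  have one: "\<one>\<^bsub>?G\<^esub> = word_class ?R []" by (simp add: G_group_def presented_group_def)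
  have car: "word_class ?R u \<in> carrier ?G" for u by (simp add: G_group_def presented_group_def)
  have mult: "word_class ?R (u @ v) = word_class ?R u \<otimes>\<^bsub>?G\<^esub> word_class ?R v" for u v
    unfolding G_group_def by (rule mult_word_class[symmetric])
  obtain w where w: "x = word_class ?R w" using x by (auto simp: G_group_def presented_group_def)
  have "word_class ?R w \<in> NF"
  proof (induction w rule: rev_induct)
    case Nil
    have "word_class ?R [] = nf 0 0 0" by (simp add: nf_def one[symmetric])
    then show ?case by blast
  next
    case (snoc l w)
    obtain g b where l: "l = (g, b)" by fastforce
    have g: "G_gen p a0 a1 g \<in> {G_gen p a0 a1 S1, G_gen p a0 a1 S2, G_gen p a0 a1 S3}"
      by (cases g) auto
    have gc: "G_gen p a0 a1 g \<in> carrier ?G" by (simp add: G_gen_def car)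
    show ?case
    proof (cases b)
      case True
      then show ?thesis using NF_mult[OF snoc g] by (simp only: mult l G_gen_def)
    next
      case False
      have "word_class ?R [(g, False)] \<otimes>\<^bsub>?G\<^esub> G_gen p a0 a1 g = \<one>\<^bsub>?G\<^esub>"
        using word_cong.cancel[of ?R g False]
        by (simp add: G_gen_def mult[symmetric] one word_class_eq_iff)
      then have "word_class ?R [(g, False)] = inv\<^bsub>?G\<^esub> G_gen p a0 a1 g"
        using gc car by (intro inv_equality[symmetric])
      then show ?thesis using NF_mult_inv[OF snoc g] False by (simp only: mult l)
    qed
  qed
  then show thesis using that w by blast
qed

context G_relations begin

text \<open>
  The normal form bounds the size of \<open>G\<close> from above, and the independence of the \<open>s\<^sub>i\<close> bounds it from
  below, so the homomorphism from \<open>G\<close> given by the relations is bijective.  That \<open>G\<close> itself does not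
  collapse is a consequence, and no model of \<open>G\<close> has to be constructed.
\<close>

lemma iso_G_group:
  assumes gen: "\<And>x. x \<in> carrier G \<Longrightarrow> x \<in> NF"
    and indep: "\<And>i j k. nf i j k = \<one> \<Longrightarrow> p dvd i \<and> p dvd j"
    and ord3: "\<And>k::nat. s3 [^] k = \<one> \<Longrightarrow> p dvd k"
  shows "G \<cong> G_group p a0 a1"
proof -
  let ?R = "G_rels p a0 a1" and ?G = "G_group p a0 a1"
  let ?g = "G_gen p a0 a1"
  interpret P: G_relations ?G p a0 a1 "?g S1" "?g S2" "?g S3"
    by (rule G_group_relations[OF p_pos])
  define s where "s g = (case g of S1 \<Rightarrow> s1 | S2 \<Rightarrow> s2 | S3 \<Rightarrow> s3)" for g
  have s: "s g \<in> carrier G" for g by (cases g) (simp_all add: s_def)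
  have sS: "s S1 = s1" "s S2 = s2" "s S3 = s3" by (simp_all add: s_def)
  have L: "word_val s [(S1, True)] = s1" "word_val s [(S2, True)] = s2" "word_val s [(S3, True)] = s3"
    by (simp_all add: word_val_letter[of s, OF s] sS)
  have central: "s3 \<otimes> word_val s w = word_val s w \<otimes> s3" for w
  proof (induction w)
    case Nil
    then show ?case by (simp add: word_val_Nil[of s, OF s])
  next
    case (Cons l w)
    obtain g b where l: "l = (g, b)" by fastforce
    define t where "t = word_val s [l]"
    have sg: "s3 \<otimes> s g = s g \<otimes> s3" by (cases g) (simp_all add: s_def central1 central2)
    have t: "t \<in> carrier G" by (simp add: t_def word_val_closed s)
    have st: "s3 \<otimes> t = t \<otimes> s3"
    proof (cases b)
      case True
      then show ?thesis using sg by (simp add: t_def l word_val_letter s)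
    next
      case False
      then have "t = inv (s g)" by (simp add: t_def l word_val_def s)
      then show ?thesis using commute_inv[OF _ s sg] by simp
    qed
    have v: "word_val s w \<in> carrier G" by (simp add: word_val_closed s)
    have lw: "word_val s (l # w) = t \<otimes> word_val s w"
      using word_val_append[of s "[l]" w, OF s] by (simp add: t_def)
    have "s3 \<otimes> word_val s (l # w) = t \<otimes> (s3 \<otimes> word_val s w)"
      unfolding lw using t v st by (simp add: m_assoc[symmetric])
    also have "\<dots> = word_val s (l # w) \<otimes> s3"
      unfolding Cons lw using t v by (simp add: m_assoc)
    finally show ?case .
  qed
  have rels: "word_val s u = word_val s v" if uv: "(u, v) \<in> ?R" for u v
  proof -
    consider "u = replicate p (S1, True)" "v = replicate a1 (S3, True)"
      | "u = replicate p (S2, True)" "v = []" | "u = replicate p (S3, True)" "v = []"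
      | "u = [(S2, True)] @ [(S1, True)]" "v = [(S1, True)] @ [(S2, True)] @ replicate a0 (S3, True)"
      | w where "u = [(S3, True)] @ w" "v = w @ [(S3, True)]"
      using uv unfolding G_rels_def Let_def by auto
    then show ?thesis
    proof cases
      case 1
      then show ?thesis by (simp only: word_val_replicate[of s, OF s] sS rel1)
    next
      case 2
      then show ?thesis by (simp only: word_val_replicate[of s, OF s] sS rel2 word_val_Nil[of s, OF s])
    next
      case 3
      then show ?thesis by (simp only: word_val_replicate[of s, OF s] sS rel3 word_val_Nil[of s, OF s])
    next
      case 4
      then show ?thesis
        unfolding 4 word_val_append[of s, OF s] word_val_replicate[of s, OF s] L sS
        by (simp add: rel21 m_assoc)
    next
      case 5
      then show ?thesis
        unfolding 5 word_val_append[of s, OF s] L by (simp add: central)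
    qed
  qed
  obtain f where f: "f \<in> hom ?G G" "\<And>u. f (word_class ?R u) = word_val s u"
    unfolding G_group_def using presented_group_hom[of s, OF s rels] by blast
  interpret f: group_hom ?G G f
    using f(1) by (simp add: group_hom_def group_hom_axioms_def P.is_group is_group)
  have fg: "f (?g S1) = s1" "f (?g S2) = s2" "f (?g S3) = s3"
    by (simp_all add: G_gen_def f(2) L)
  have fnf: "f (P.nf i j k) = nf i j k" for i j k
    unfolding P.nf_def nf_def by (simp add: f.hom_nat_pow fg)
  have "f \<in> iso ?G G"
  proof (rule isoI[OF f(1)], unfold bij_betw_def, intro conjI)
    show "f ` carrier ?G = carrier G"
    proof
      show "carrier G \<subseteq> f ` carrier ?G"
      proof
        fix x assume "x \<in> carrier G"
        then obtain i j k where "x = nf i j k" using gen by blast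
        then have "x = f (P.nf i j k)" by (simp add: fnf)
        then show "x \<in> f ` carrier ?G" by (rule image_eqI) simp
      qed
    qed auto
    show "inj_on f (carrier ?G)"
    unfolding f.inj_on_one_iff
    proof (intro allI impI)
      fix x assume "x \<in> carrier ?G" "f x = \<one>"
      then have x: "x \<in> carrier ?G" "f x = \<one>" by simp_all
      then obtain i j k where xn: "x = P.nf i j k" using G_group_normal_form[OF p_pos] by blast
      then have "p dvd i" "p dvd j" using indep x(2) by (auto simp: fnf)
      then obtain i' j' where ij: "i = p * i'" "j = p * j'" by (elim dvdE)
      have "?g S1 [^]\<^bsub>?G\<^esub> i = ?g S3 [^]\<^bsub>?G\<^esub> (a1 * i')"
        by (simp add: ij P.nat_pow_pow[symmetric] P.rel1)
      moreover have "?g S2 [^]\<^bsub>?G\<^esub> j = \<one>\<^bsub>?G\<^esub>"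
        by (simp add: ij P.nat_pow_pow[symmetric] P.rel2)
      ultimately have x3: "x = ?g S3 [^]\<^bsub>?G\<^esub> (a1 * i' + k)"
        by (simp add: xn P.nf_def P.nat_pow_mult)
      then have "s3 [^] (a1 * i' + k) = \<one>" using x(2) by (simp add: f.hom_nat_pow fg)
      then obtain m where "a1 * i' + k = p * m" using ord3 by (meson dvdE)
      then show "x = \<one>\<^bsub>?G\<^esub>" unfolding x3 by (simp add: P.nat_pow_pow[symmetric] P.rel3)
    qed
  qed
  then show ?thesis using P.iso_sym[of G] by (auto simp: is_iso_def)
qed

end

section \<open>The group of automorphisms over a subfield\<close>

context ring begin

lemma Gal_memI:
  assumes "f \<in> ring_hom R R" "f \<in> extensional (carrier R)" "bij_betw f (carrier R) (carrier R)"
    "\<And>k. k \<in> K \<Longrightarrow> f k = k"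
  shows "f \<in> carrier (Gal R K)"
  using assms by (simp add: Gal_def Bij_def)

lemma Gal_memD:
  assumes "f \<in> carrier (Gal R K)"
  shows "f \<in> ring_hom R R" "f \<in> Bij (carrier R)" "\<And>k. k \<in> K \<Longrightarrow> f k = k"
    "\<And>x. x \<in> carrier R \<Longrightarrow> f x \<in> carrier R"
  using assms ring_hom_closed[of f R R] by (auto simp: Gal_def)

lemma Gal_mult_apply:
  assumes "f \<in> carrier (Gal R K)" "g \<in> carrier (Gal R K)" "x \<in> carrier R"
  shows "(f \<otimes>\<^bsub>Gal R K\<^esub> g) x = f (g x)"
  using Gal_memD[OF assms(1)] Gal_memD[OF assms(2)] assms(3)
  by (simp add: Gal_def BijGroup_def compose_eq)

lemma Gal_one: "\<one>\<^bsub>Gal R K\<^esub> = (\<lambda>x\<in>carrier R. x)"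
  by (simp add: Gal_def BijGroup_def)

lemma group_Gal:
  assumes K: "K \<subseteq> carrier R"
  shows "group (Gal R K)"
proof -
  let ?B = "BijGroup (carrier R)"
  interpret B: group ?B by (rule group_BijGroup)
  have "subgroup (carrier (Gal R K)) ?B"
  proof (rule B.subgroupI)
    show "carrier (Gal R K) \<subseteq> carrier ?B" by (auto simp: Gal_def BijGroup_def)
    have "(\<lambda>x\<in>carrier R. x) \<in> carrier (Gal R K)"
      using K by (intro Gal_memI) (auto intro!: ring_hom_memI simp: bij_betw_def inj_on_def)
    then show "carrier (Gal R K) \<noteq> {}" by blast
  next
    fix f assume f: "f \<in> carrier (Gal R K)"
    note fD = Gal_memD[OF f]
    define h where "h = (\<lambda>x\<in>carrier R. inv_into (carrier R) f x)"
    have bij: "h \<in> Bij (carrier R)" unfolding h_def by (rule restrict_inv_into_Bij[OF fD(2)])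
    have inj: "inj_on f (carrier R)" using fD(2) by (simp add: Bij_def bij_betw_def)
    have hk: "h (f x) = x" if "x \<in> carrier R" for x
      using that fD(4) inj by (simp add: h_def)
    have surj: "\<exists>x\<in>carrier R. y = f x" if "y \<in> carrier R" for y
      using that fD(2) by (auto simp: Bij_def bij_betw_def)
    have "h \<in> carrier (Gal R K)"
    proof (rule Gal_memI)
      show "h \<in> ring_hom R R"
      proof (rule ring_hom_memI)
        show "h \<one> = \<one>" using hk[OF one_closed] ring_hom_one[OF fD(1)] by simp
        fix x assume "x \<in> carrier R"
        then obtain u where u: "u \<in> carrier R" "x = f u" using surj by blast
        then show "h x \<in> carrier R" by (simp add: hk)
        fix y assume "y \<in> carrier R"
        then obtain v where v: "v \<in> carrier R" "y = f v" using surj by blast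
        have "h (x \<otimes> y) = u \<otimes> v"
          unfolding u(2) v(2) ring_hom_mult[OF fD(1) u(1) v(1), symmetric] using u v by (simp add: hk)
        then show "h (x \<otimes> y) = h x \<otimes> h y" using u v by (simp add: hk)
        have "h (x \<oplus> y) = u \<oplus> v"
          unfolding u(2) v(2) ring_hom_add[OF fD(1) u(1) v(1), symmetric] using u v by (simp add: hk)
        then show "h (x \<oplus> y) = h x \<oplus> h y" using u v by (simp add: hk)
      qed
      show "h \<in> extensional (carrier R)" by (simp add: h_def)
      show "bij_betw h (carrier R) (carrier R)" using bij by (simp add: Bij_def)
      show "h k = k" if "k \<in> K" for k
        using hk[of k] fD(3)[OF that] K that by auto
    qed
    then show "inv\<^bsub>?B\<^esub> f \<in> carrier (Gal R K)" using inv_BijGroup[OF fD(2)] by (simp add: h_def)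
  next
    fix f g assume f: "f \<in> carrier (Gal R K)" and g: "g \<in> carrier (Gal R K)"
    note fD = Gal_memD[OF f] and gD = Gal_memD[OF g]
    have ap: "(f \<otimes>\<^bsub>?B\<^esub> g) x = f (g x)" if "x \<in> carrier R" for x
      using Gal_mult_apply[OF f g that] by (simp add: Gal_def)
    have B: "f \<otimes>\<^bsub>?B\<^esub> g \<in> Bij (carrier R)"
      using fD(2) gD(2) by (simp add: BijGroup_def compose_Bij)
    show "f \<otimes>\<^bsub>?B\<^esub> g \<in> carrier (Gal R K)"
    proof (rule Gal_memI)
      show "f \<otimes>\<^bsub>?B\<^esub> g \<in> ring_hom R R"
        using fD(1) gD(1)
        by (intro ring_hom_memI)
          (auto simp: ap fD(4) gD(4) ring_hom_mult ring_hom_add ring_hom_one)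
      show "f \<otimes>\<^bsub>?B\<^esub> g \<in> extensional (carrier R)" "bij_betw (f \<otimes>\<^bsub>?B\<^esub> g) (carrier R) (carrier R)"
        using B by (simp_all add: Bij_def)
      show "(f \<otimes>\<^bsub>?B\<^esub> g) k = k" if "k \<in> K" for k
        using that K fD(3) gD(3) ap[of k] by auto
    qed
  qed
  then show ?thesis
    using B.subgroup_imp_group by (simp add: Gal_def)
qed

lemma Gal_eqI:
  assumes "f \<in> carrier (Gal R K)" "g \<in> carrier (Gal R K)"
    and "\<And>x. x \<in> carrier R \<Longrightarrow> f x = g x"
  shows "f = g"
  using Gal_memD(2)[OF assms(1)] Gal_memD(2)[OF assms(2)] assms(3)
  by (intro extensionalityI[of f "carrier R" g]) (auto simp: Bij_def)

lemma Gal_pow_apply: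
  assumes K: "K \<subseteq> carrier R" and f: "f \<in> carrier (Gal R K)" and x: "x \<in> carrier R"
  shows "(f [^]\<^bsub>Gal R K\<^esub> (n::nat)) x = (f ^^ n) x"
  using x
proof (induction n arbitrary: x)
  interpret G: group "Gal R K" by (rule group_Gal[OF K])
  case 0
  then show ?case by (simp add: Gal_one)
next
  interpret G: group "Gal R K" by (rule group_Gal[OF K])
  case (Suc n)
  then show ?case
    using f Gal_memD(4)[OF f] by (simp add: Gal_mult_apply funpow_swap1 del: funpow.simps)
      (simp add: funpow_swap1)
qed

end

section \<open>Subfields cut out by automorphisms\<close>

lemma (in field) equalizer_subfield:
  assumes f: "f \<in> ring_hom R R" and g: "g \<in> ring_hom R R"
  shows "subfield {x \<in> carrier R. f x = g x} R"
proof -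
  interpret f: ring_hom_ring R R f using f by (intro ring_hom_ringI2) unfold_locales
  interpret g: ring_hom_ring R R g using g by (intro ring_hom_ringI2) unfold_locales
  show ?thesis
  proof (rule subfieldI'[OF subringI])
    fix k assume k: "k \<in> {x \<in> carrier R. f x = g x} - {\<zero>}"
    then have u: "k \<in> Units R" by (simp add: field_Units)
    have i: "inv k \<in> carrier R" "k \<otimes> inv k = \<one>" using u by simp_all
    have kR: "k \<in> carrier R" using k by simp
    have "f (inv k) = f (inv k) \<otimes> g (k \<otimes> inv k)" using i by simp
    also have "\<dots> = f (inv k) \<otimes> (f k \<otimes> g (inv k))"
      using g.hom_mult[OF kR i(1)] k by simp
    also have "\<dots> = f (k \<otimes> inv k) \<otimes> g (inv k)"
      using f.hom_mult[OF kR i(1)] kR i(1) by (simp add: m_ac)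
    also have "\<dots> = g (inv k)" unfolding i(2) using i(1) by simp
    finally show "inv k \<in> {x \<in> carrier R. f x = g x}" using i(1) by simp
  qed auto
qed

lemma (in field) fixed_subfield:
  assumes "f \<in> ring_hom R R"
  shows "subfield {x \<in> carrier R. f x = x} R"
proof -
  have "(\<lambda>x. x) \<in> ring_hom R R" by (rule ring_hom_memI) auto
  from equalizer_subfield[OF assms this] show ?thesis .
qed

lemma (in field) subfield_Int:
  assumes "subfield A R" "subfield B R"
  shows "subfield (A \<inter> B) R"
proof (rule subfieldI'[OF subring_inter])
  show "subring A R" "subring B R" using assms by (simp_all add: subfieldE(1))
  show "inv k \<in> A \<inter> B" if "k \<in> A \<inter> B - {\<zero>}" for k
    using subfield_m_inv(1)[OF assms(1)] subfield_m_inv(1)[OF assms(2)] that by blast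
qed

lemma G_relations_hom:
  assumes "G_relations G p a0 a1 s1 s2 s3" and f: "f \<in> hom G H" and H: "group H"
  shows "G_relations H p a0 a1 (f s1) (f s2) (f s3)"
proof -
  interpret G: G_relations G p a0 a1 s1 s2 s3 by fact
  interpret H: group H by fact
  interpret f: group_hom G H f using f by (simp add: group_hom_def group_hom_axioms_def G.is_group H)
  show ?thesis
    by unfold_locales
      (simp_all only: G.s_closed G.p_pos f.hom_nat_pow[symmetric] f.hom_mult[symmetric] f.hom_closed
        G.nat_pow_closed G.m_closed G.rel1 G.rel2 G.rel3 G.rel21 G.central1 G.central2 f.hom_one)
qed

lemma (in ring) fixed_field_generate:
  assumes K: "K \<subseteq> carrier R" and S: "S \<subseteq> carrier (Gal R K)"
  shows "fixed_field R (generate (Gal R K) S) = {x \<in> carrier R. \<forall>s\<in>S. s x = x}"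
proof -
  interpret G: group "Gal R K" by (rule group_Gal[OF K])
  have "g x = x" if g: "g \<in> generate (Gal R K) S" and x: "x \<in> carrier R" "\<forall>s\<in>S. s x = x" for g x
    using g
  proof induction
    case one
    then show ?case using x by (simp add: Gal_one)
  next
    case (incl h)
    then show ?case using x by simp
  next
    case (inv h)
    then have h: "h \<in> carrier (Gal R K)" "h x = x" using S x by auto
    have "(inv\<^bsub>Gal R K\<^esub> h) (h x) = (inv\<^bsub>Gal R K\<^esub> h \<otimes>\<^bsub>Gal R K\<^esub> h) x"
      using h x by (simp only: Gal_mult_apply G.inv_closed)
    then show ?case using h x by (simp add: Gal_one)
  next
    case (eng h1 h2)
    then have "h1 \<in> carrier (Gal R K)" "h2 \<in> carrier (Gal R K)"
      using G.generate_in_carrier[OF S] by auto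
    then show ?case using eng x by (simp add: Gal_mult_apply)
  qed
  then show ?thesis by (auto simp: fixed_field_def intro: generate.incl)
qed

context char_p_field begin

lemma diff_eq_iff:
  assumes "a \<in> carrier R" "b \<in> carrier R" "c \<in> carrier R"
  shows "a \<ominus> b = c \<longleftrightarrow> a = b \<oplus> c"
proof
  assume c: "a \<ominus> b = c"
  have "a = b \<oplus> (a \<ominus> b)" using assms by algebra
  then show "a = b \<oplus> c" unfolding c .
next
  assume a: "a = b \<oplus> c"
  show "a \<ominus> b = c" unfolding a using assms by algebra
qed

lemma orbit:
  assumes "\<tau> \<in> ring_hom R R" "x \<in> carrier R" "\<tau> x = x \<oplus> \<one>"
  shows "(\<tau> ^^ n) x = x \<oplus> emb (int n)"
proof (induction n)
  case (Suc n)
  then show ?case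
    using assms by (simp add: ring_hom_add[OF assms(1)] hom_emb[OF assms(1)] emb_add a_ac)
qed (use assms in simp)

lemma orbit_fixed: "\<tau> x = x \<Longrightarrow> (\<tau> ^^ n) x = x"
  by (induction n) simp_all

text \<open>
  The right-hand side of the equation for the third generator, as a function of the first one.
\<close>

definition third_rhs :: "nat \<Rightarrow> nat \<Rightarrow> 'a \<Rightarrow> 'a \<Rightarrow> 'a \<Rightarrow> 'a" where
  "third_rhs a0 a1 \<beta>2 \<beta>3 x = emb (int a0) \<otimes> (\<beta>2 \<otimes> x) \<oplus> emb (int a1) \<otimes> D1_value x \<oplus> \<beta>3"

text \<open>
  The element by which the first automorphism moves the third generator.
\<close>

definition cocycle :: "nat \<Rightarrow> nat \<Rightarrow> 'a \<Rightarrow> 'a \<Rightarrow> 'a" where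
  "cocycle a0 a1 x1 x2 = emb (int a0) \<otimes> x2 \<ominus> emb (int a1) \<otimes> carry x1"

lemma cocycle_closed: "\<lbrakk>x1 \<in> carrier R; x2 \<in> carrier R\<rbrakk> \<Longrightarrow> cocycle a0 a1 x1 x2 \<in> carrier R"
  by (simp add: cocycle_def)

lemma third_rhs_closed:
  "\<lbrakk>x \<in> carrier R; \<beta>2 \<in> carrier R; \<beta>3 \<in> carrier R\<rbrakk> \<Longrightarrow> third_rhs a0 a1 \<beta>2 \<beta>3 x \<in> carrier R"
  by (simp add: third_rhs_def)

text \<open>
  This is why the equation for the third generator has the given form: under \<open>x\<^sub>1 \<mapsto> x\<^sub>1 + 1\<close> its
  right-hand side changes by \<open>\<wp>\<close> of the cocycle, which is what an automorphism that adds the cocycle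
  to \<open>x\<^sub>3\<close> requires.
\<close>

lemma third_rhs_shift:
  assumes x: "x1 \<in> carrier R" "x2 \<in> carrier R" and b2: "x2 [^] p \<ominus> x2 = \<beta>2" and b3: "\<beta>3 \<in> carrier R"
  shows "third_rhs a0 a1 \<beta>2 \<beta>3 (x1 \<oplus> \<one>) =
    third_rhs a0 a1 \<beta>2 \<beta>3 x1 \<oplus> (cocycle a0 a1 x1 x2 [^] p \<ominus> cocycle a0 a1 x1 x2)"
proof -
  define A0 A1 c cp w y where "A0 = emb (int a0)" and "A1 = emb (int a1)" and "c = carry x1"
    and "cp = carry x1 [^] p" and "w = D1_value x1" and "y = x2 [^] p"
  have cl: "A0 \<in> carrier R" "A1 \<in> carrier R" "c \<in> carrier R" "cp \<in> carrier R" "w \<in> carrier R" "y \<in> carrier R"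
    using x by (simp_all add: A0_def A1_def c_def cp_def w_def y_def)
  have u: "cocycle a0 a1 x1 x2 [^] p = A0 \<otimes> y \<ominus> A1 \<otimes> cp"
    using x by (simp add: cocycle_def frobenius_diff nat_pow_distrib emb_frobenius A0_def A1_def y_def cp_def)
  have W: "D1_value (x1 \<oplus> \<one>) = w \<oplus> c \<ominus> cp" using x by (simp add: D1_value_shift w_def c_def cp_def)
  show ?thesis
    unfolding u unfolding third_rhs_def cocycle_def b2[symmetric] W A0_def[symmetric] A1_def[symmetric]
      c_def[symmetric] w_def[symmetric] y_def[symmetric]
    using cl x b3 by algebra
qed

text \<open>
  The left-hand side is the trace of the cocycle, that is, the amount by which the \<open>p\<close>-th power of the
  first automorphism moves \<open>x\<^sub>3\<close>.  The value \<open>a\<^sub>1\<close> is also the amount by which the power of the third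
  automorphism with exponent \<open>a\<^sub>1\<close> moves it, as the first relation of \<open>G\<close> demands.
\<close>

lemma delta_iter_cocycle:
  assumes \<tau>: "\<tau> \<in> ring_hom R R" and x: "x1 \<in> carrier R" "x2 \<in> carrier R"
    and "\<tau> x1 = x1 \<oplus> \<one>" "\<tau> x2 = x2"
  shows "(delta \<tau> ^^ (p - 1)) (cocycle a0 a1 x1 x2) = emb (int a1)"
proof -
  obtain m where m: "p - 1 = Suc m" using p_gt_1 by (metis not0_implies_Suc zero_less_diff neq0_conv)
  have "delta \<tau> x2 = \<zero>" using assms by (simp add: delta_zero_iff)
  then have d2: "(delta \<tau> ^^ (p - 1)) x2 = \<zero>"
    unfolding m by (simp add: funpow_Suc_right delta_iter_zero[OF \<tau>] del: funpow.simps)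
  have "(delta \<tau> ^^ (p - 1)) (cocycle a0 a1 x1 x2)
      = (delta \<tau> ^^ (p - 1)) (emb (int a0) \<otimes> x2) \<ominus> (delta \<tau> ^^ (p - 1)) (emb (int a1) \<otimes> carry x1)"
    unfolding cocycle_def using x by (intro delta_iter_diff[OF \<tau>]) simp_all
  also have "\<dots> = emb (int a0) \<otimes> \<zero> \<ominus> emb (int a1) \<otimes> (\<ominus> \<one>)"
    using x by (simp only: delta_iter_fixed_mult[OF \<tau> emb_closed hom_emb[OF \<tau>]] carry_closed
        d2 delta_iter_carry[OF \<tau> x(1) assms(4)])
  also have "\<dots> = emb (int a1)"
    by (simp add: r_minus a_minus_def)
  finally show ?thesis .
qed

section \<open>Correcting the third generator\<close>

text \<open>
  Start with any \<open>y\<close> that \<open>s3\<close> moves by 1.  Its differences under \<open>s2\<close> and \<open>s1\<close> are fixed by the central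
  \<open>s3\<close>.  Two applications of the additive Hilbert 90, the first for \<open>s2\<close> and the second for \<open>s1\<close> on the
  elements fixed by both \<open>s2\<close> and \<open>s3\<close>, change \<open>y\<close> so that \<open>s2\<close> fixes it and \<open>s1\<close> moves it by the
  cocycle.  The conditions of Hilbert 90 come from the relations of \<open>G\<close>: those for the \<open>p\<close>-th powers of \<open>s2\<close>
  and \<open>s1\<close> make the traces vanish, and the commutation relation shows that the difference between the
  cocycle and the actual move under \<open>s1\<close> is fixed by \<open>s2\<close>.
\<close>

lemma corrected_generator:
  assumes K: "K \<subseteq> carrier R"
    and rel: "G_relations (Gal R K) p a0 a1 s1 s2 s3"
    and nt: "\<exists>x\<in>carrier R. s3 x \<noteq> x"
    and fixK: "\<And>x. \<lbrakk>x \<in> carrier R; s1 x = x; s2 x = x; s3 x = x\<rbrakk> \<Longrightarrow> x \<in> K"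
    and x: "x1 \<in> carrier R" "x2 \<in> carrier R"
    and s1x: "s1 x1 = x1 \<oplus> \<one>" "s1 x2 = x2" and s2x: "s2 x1 = x1" "s2 x2 = x2 \<oplus> \<one>"
    and s3x: "s3 x1 = x1" "s3 x2 = x2"
    and b2: "x2 [^] p \<ominus> x2 = \<beta>2" "\<beta>2 \<in> K"
  obtains x3 \<beta>3 where "x3 \<in> carrier R" "s3 x3 = x3 \<oplus> \<one>" "\<beta>3 \<in> K"
    "x3 [^] p \<ominus> x3 = third_rhs a0 a1 \<beta>2 \<beta>3 x1"
proof -
  interpret G: G_relations "Gal R K" p a0 a1 s1 s2 s3 by fact
  note D1 = Gal_memD[OF G.s_closed(1)] and D2 = Gal_memD[OF G.s_closed(2)] and D3 = Gal_memD[OF G.s_closed(3)]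
  note h1 = D1(1) and h2 = D2(1) and h3 = D3(1)
  interpret s1: ring_hom_cring R R s1 using h1 by (simp add: ring_hom_cring_def ring_hom_cring_axioms_def is_cring)
  interpret s2: ring_hom_cring R R s2 using h2 by (simp add: ring_hom_cring_def ring_hom_cring_axioms_def is_cring)
  interpret s3: ring_hom_cring R R s3 using h3 by (simp add: ring_hom_cring_def ring_hom_cring_axioms_def is_cring)
  note pa = Gal_pow_apply[OF K]
  have r1: "(s1 ^^ p) z = (s3 ^^ a1) z" if "z \<in> carrier R" for z
    using fun_cong[OF G.rel1, of z] that by (simp add: pa)
  have r2: "(s2 ^^ p) z = z" if "z \<in> carrier R" for z
    using fun_cong[OF G.rel2, of z] that by (simp add: pa Gal_one)
  have r3: "(s3 ^^ p) z = z" if "z \<in> carrier R" for z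
    using fun_cong[OF G.rel3, of z] that by (simp add: pa Gal_one)
  have r21: "s2 (s1 z) = s1 (s2 ((s3 ^^ a0) z))" if "z \<in> carrier R" for z
    using fun_cong[OF G.rel21, of z] that by (simp add: Gal_mult_apply pa hom_iter_closed[OF h3])
  have c1: "s3 (s1 z) = s1 (s3 z)" if "z \<in> carrier R" for z
    using fun_cong[OF G.central1, of z] that by (simp add: Gal_mult_apply)
  have c2: "s3 (s2 z) = s2 (s3 z)" if "z \<in> carrier R" for z
    using fun_cong[OF G.central2, of z] that by (simp add: Gal_mult_apply)
  have e1: "emb 1 = \<one>" by simp
  have pow_pred: "(delta \<tau> ^^ (p - 1)) (delta \<tau> z) = (\<tau> ^^ p) z \<ominus> z"
    if "\<tau> \<in> ring_hom R R" "z \<in> carrier R" for \<tau> z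
  proof -
    have "Suc (p - 1) = p" using p_gt_1 by simp
    then have "(delta \<tau> ^^ (p - 1)) (delta \<tau> z) = (delta \<tau> ^^ p) z"
      by (metis funpow_swap1 funpow_simps_right(2) comp_apply)
    then show ?thesis using that by (simp add: delta_iter_p)
  qed
  let ?F3 = "{z \<in> carrier R. s3 z = z}" and ?F2 = "{z \<in> carrier R. s2 z = z}"
  note F3 = fixed_subfield[OF h3] and F2 = fixed_subfield[OF h2]
  define u0 where "u0 = cocycle a0 a1 x1 x2"
  have u0R: "u0 \<in> carrier R" using x by (simp add: u0_def cocycle_closed)
  have s3u0: "s3 u0 = u0" using x s3x
    by (simp add: u0_def cocycle_def hom_minus[OF h3] hom_emb[OF h3] hom_carry[OF h3])
  have s2u0: "s2 u0 = u0 \<oplus> emb (int a0)"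
  proof -
    have "s2 u0 = emb (int a0) \<otimes> (x2 \<oplus> \<one>) \<ominus> emb (int a1) \<otimes> carry x1"
      using x s2x by (simp add: u0_def cocycle_def hom_minus[OF h2] hom_emb[OF h2] hom_carry[OF h2])
    also have "\<dots> = u0 \<oplus> emb (int a0)"
      using x emb_closed carry_closed[OF x(1)] unfolding u0_def cocycle_def
      by (simp add: r_distr a_minus_def a_ac)
    finally show ?thesis .
  qed
  obtain y where y: "y \<in> carrier R" "s3 y = y \<oplus> \<one>"
    using artin_schreier_generator[OF h3 r3 nt] by blast
  (* the relation s2 ^ p = 1 says that v has trace zero for s2 *)
  define v where "v = delta s2 y"
  have vR: "v \<in> carrier R" using y by (simp add: v_def delta_closed[OF h2])
  have "s3 v = v"
  proof -
    have "s3 v = s2 y \<oplus> \<one> \<ominus> (y \<oplus> \<one>)"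
      using y by (simp add: v_def delta_def hom_minus[OF h3] c2)
    also have "\<dots> = v" unfolding v_def delta_def using y(1) D2(4)[OF y(1)] by algebra
    finally show ?thesis .
  qed
  then have v: "v \<in> ?F3" using vR by simp
  have "(delta s2 ^^ (p - 1)) v = \<zero>"
    unfolding v_def pow_pred[OF h2 y(1)] r2[OF y(1)] using y by (simp add: a_minus_def r_neg)
  then obtain d2 where d2: "d2 \<in> ?F3" "delta s2 d2 = v"
    using additive_hilbert_90[OF h2 x(2) s2x(2) F3 _ _ v, of "p - 1"] x s3x c2 p_gt_1 by auto
  define y' where "y' = y \<ominus> d2"
  have y'R: "y' \<in> carrier R" using y d2 by (simp add: y'_def)
  have s3y': "s3 y' = y' \<oplus> \<one>"
    using y d2 by (simp add: y'_def hom_minus[OF h3] a_minus_def a_ac)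
  have "delta s2 y' = \<zero>"
    using y d2 vR delta_diff[OF h2, of y d2] unfolding y'_def v_def[symmetric] by (simp add: a_minus_def r_neg)
  then have s2y': "s2 y' = y'" using y'R by (simp add: delta_zero_iff[OF h2])
  (* w is the deviation from the cocycle; it has trace zero for s1 and is fixed by s2 and s3 *)
  define w where "w = delta s1 y' \<ominus> u0"
  have wR: "w \<in> carrier R" using y'R u0R by (simp add: w_def delta_closed[OF h1])
  have s3w: "s3 w = w"
  proof -
    have "s3 w = s1 y' \<oplus> \<one> \<ominus> (y' \<oplus> \<one>) \<ominus> u0"
      using y'R u0R D1(4)[OF y'R]
      by (simp add: w_def delta_def hom_minus[OF h3] c1 s3y' s3u0)
    also have "\<dots> = w" unfolding w_def delta_def using y'R u0R D1(4)[OF y'R] by algebra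
    finally show ?thesis .
  qed
  have s3it: "(s3 ^^ n) y' = y' \<oplus> emb (int n)" for n
    by (rule orbit[OF h3 y'R s3y'])
  have s2w: "s2 w = w"
  proof -
    have "s2 (s1 y') = s1 y' \<oplus> emb (int a0)"
      using y'R by (simp add: r21 s3it s2y' hom_emb[OF h1] hom_emb[OF h2])
    then have "s2 w = s1 y' \<oplus> emb (int a0) \<ominus> y' \<ominus> (u0 \<oplus> emb (int a0))"
      using y'R u0R D1(4)[OF y'R] by (simp add: w_def delta_def hom_minus[OF h2] s2y' s2u0)
    also have "\<dots> = w"
      unfolding w_def delta_def using y'R u0R D1(4)[OF y'R] emb_closed[of "int a0"] by algebra
    finally show ?thesis .
  qed
  have w: "w \<in> ?F2 \<inter> ?F3" using wR s2w s3w by simp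
  have "(delta s1 ^^ (p - 1)) w = \<zero>"
  proof -
    have "(delta s1 ^^ (p - 1)) w = (s1 ^^ p) y' \<ominus> y' \<ominus> emb (int a1)"
      unfolding w_def delta_iter_diff[OF h1 delta_closed[OF h1 y'R] u0R] pow_pred[OF h1 y'R]
      unfolding u0_def delta_iter_cocycle[OF h1 x s1x] ..
    also have "\<dots> = y' \<oplus> emb (int a1) \<ominus> y' \<ominus> emb (int a1)"
      using y'R by (simp add: r1 s3it)
    also have "\<dots> = \<zero>" using y'R emb_closed[of "int a1"] by algebra
    finally show ?thesis .
  qed
  moreover have "s1 z \<in> ?F2 \<inter> ?F3" if "z \<in> ?F2 \<inter> ?F3" for z
    using that by (simp add: c1 r21 orbit_fixed)
  ultimately obtain d1 where d1: "d1 \<in> ?F2 \<inter> ?F3" "delta s1 d1 = w"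
    using additive_hilbert_90[OF h1 x(1) s1x(1) subfield_Int[OF F2 F3] _ _ w, of "p - 1"]
      x s2x s3x p_gt_1 by auto
  define x3 where "x3 = y' \<ominus> d1"
  have x3R: "x3 \<in> carrier R" using y'R d1 by (simp add: x3_def)
  have s3x3: "s3 x3 = x3 \<oplus> \<one>"
    using y'R d1 by (simp add: x3_def hom_minus[OF h3] s3y' a_minus_def a_ac)
  have s2x3: "s2 x3 = x3" using y'R d1 by (simp add: x3_def hom_minus[OF h2] s2y')
  have "delta s1 x3 = u0"
  proof -
    have cl: "delta s1 y' \<in> carrier R" using y'R by (simp add: delta_closed[OF h1])
    have "delta s1 x3 = delta s1 y' \<ominus> (delta s1 y' \<ominus> u0)"
      using y'R d1 by (simp add: x3_def delta_diff[OF h1] w_def)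
    also have "\<dots> = u0" using cl u0R by algebra
    finally show ?thesis .
  qed
  then have s1x3: "s1 x3 = x3 \<oplus> u0"
    using x3R u0R D1(4)[OF x3R] unfolding delta_def by (simp add: diff_eq_iff)
  have \<beta>2R: "\<beta>2 \<in> carrier R" using b2 K by blast
  define r where "r = third_rhs a0 a1 \<beta>2 \<zero> x1"
  have rR: "r \<in> carrier R" using x \<beta>2R by (simp add: r_def third_rhs_closed)
  have hr: "\<tau> r = third_rhs a0 a1 \<beta>2 \<zero> (\<tau> x1)" if "\<tau> \<in> ring_hom R R" "\<tau> \<beta>2 = \<beta>2" for \<tau>
  proof -
    interpret t: ring_hom_cring R R \<tau> using that by (simp add: ring_hom_cring_def ring_hom_cring_axioms_def is_cring)
    show ?thesis using x \<beta>2R that(2) by (simp add: r_def third_rhs_def hom_emb[OF that(1)] hom_D1_value[OF that(1)])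
  qed
  define \<beta>3 where "\<beta>3 = x3 [^] p \<ominus> x3 \<ominus> r"
  have b3R: "\<beta>3 \<in> carrier R" using x3R rR by (simp add: \<beta>3_def)
  have h\<beta>3: "\<tau> \<beta>3 = \<tau> x3 [^] p \<ominus> \<tau> x3 \<ominus> \<tau> r" if "\<tau> \<in> ring_hom R R" for \<tau>
  proof -
    interpret t: ring_hom_cring R R \<tau> using that by (simp add: ring_hom_cring_def ring_hom_cring_axioms_def is_cring)
    show ?thesis using x3R rR by (simp add: \<beta>3_def hom_minus[OF that])
  qed
  have "s1 \<beta>3 = \<beta>3"
  proof -
    have R': "s1 r = r \<oplus> (u0 [^] p \<ominus> u0)"
      using hr[OF h1 D1(3)[OF b2(2)]] third_rhs_shift[OF x b2(1) zero_closed] s1x by (simp add: r_def u0_def)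
    have "s1 \<beta>3 = x3 [^] p \<oplus> u0 [^] p \<ominus> (x3 \<oplus> u0) \<ominus> (r \<oplus> (u0 [^] p \<ominus> u0))"
      using x3R u0R by (simp add: h\<beta>3[OF h1] s1x3 frobenius_add R')
    also have "\<dots> = x3 [^] p \<ominus> x3 \<ominus> r"
    proof -
      have cl: "x3 [^] p \<in> carrier R" "u0 [^] p \<in> carrier R" using x3R u0R by simp_all
      show ?thesis using cl x3R u0R rR by algebra
    qed
    finally show ?thesis by (simp add: \<beta>3_def)
  qed
  moreover have "s2 \<beta>3 = \<beta>3"
    using hr[OF h2 D2(3)[OF b2(2)]] by (simp add: h\<beta>3[OF h2] s2x3 s2x r_def[symmetric] \<beta>3_def[symmetric])
  moreover have "s3 \<beta>3 = \<beta>3"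
  proof -
    have "s3 \<beta>3 = x3 [^] p \<oplus> \<one> \<ominus> (x3 \<oplus> \<one>) \<ominus> r"
      using hr[OF h3 D3(3)[OF b2(2)]] x3R by (simp add: h\<beta>3[OF h3] s3x3 s3x r_def[symmetric] frobenius_add)
    also have "\<dots> = x3 [^] p \<ominus> x3 \<ominus> r"
    proof -
      have cl: "x3 [^] p \<in> carrier R" using x3R by simp
      show ?thesis using cl x3R rR by algebra
    qed
    finally show ?thesis by (simp add: \<beta>3_def)
  qed
  ultimately have "\<beta>3 \<in> K" using fixK b3R by blast
  moreover have "x3 [^] p \<ominus> x3 = third_rhs a0 a1 \<beta>2 \<beta>3 x1"
  proof -
    have cl: "x3 [^] p \<in> carrier R" using x3R by simp
    have "third_rhs a0 a1 \<beta>2 \<beta>3 x1 = r \<oplus> \<beta>3"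
      using x \<beta>2R b3R by (simp add: r_def third_rhs_def)
    also have "\<dots> = x3 [^] p \<ominus> x3" unfolding \<beta>3_def using cl x3R rR by algebra
    finally show ?thesis ..
  qed
  ultimately show thesis using that x3R s3x3 by blast
qed

end

section \<open>Towers of three Artin--Schreier extensions\<close>

lemma cube_factors:
  fixes a b c p :: nat
  assumes "a \<le> p" "b \<le> p" "c \<le> p" "p > 0" "a * b * c = p ^ 3"
  shows "a = p \<and> b = p \<and> c = p"
proof -
  have p3: "p ^ 3 = p * p * p" by (simp add: power3_eq_cube)
  have ab: "a * b \<le> p * p" using assms by (intro mult_le_mono)
  have "c = p"
  proof (rule ccontr)
    assume "c \<noteq> p"
    then have "c < p" using assms by simp
    have "a * b * c \<le> p * p * c" using ab by simp
    also have "\<dots> < p * p * p" using \<open>c < p\<close> assms by simp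
    finally show False using assms p3 by simp
  qed
  then have ab': "a * b = p * p" using assms p3 by simp
  have "a = p"
  proof (rule ccontr)
    assume "a \<noteq> p"
    then have "a < p" using assms by simp
    have "a * b \<le> a * p" using assms by simp
    also have "\<dots> < p * p" using \<open>a < p\<close> assms by simp
    finally show False using ab' by simp
  qed
  then show ?thesis using ab' \<open>c = p\<close> assms by simp
qed

context char_p_field begin

text \<open>
  This is what makes \<open>\<sigma>\<^sub>3\<close> nontrivial: otherwise \<open>x\<^sub>1\<close> and \<open>x\<^sub>2\<close> would generate the whole extension.
\<close>

lemma two_step_dimension:
  assumes K: "subfield K R" and x: "x1 \<in> carrier R" "x2 \<in> carrier R"
    and b: "x1 [^] p \<ominus> x1 \<in> K" "x2 [^] p \<ominus> x2 \<in> K"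
    and gen: "carrier R = generate_field R (K \<union> {x1, x2})"
  shows "\<not> dimension (p ^ 3) K (carrier R)"
proof
  assume dim: "dimension (p ^ 3) K (carrier R)"
  let ?F1 = "simple_extension K x1" and ?F2 = "simple_extension (simple_extension K x1) x2"
  note KR = subfieldE(3)[OF K]
  note A = artin_schreier_extension[OF K x(1) b(1)]
  have inc1: "K \<subseteq> ?F1" by (rule simple_extension_incl[OF KR x(1)])
  have b2: "x2 [^] p \<ominus> x2 \<in> ?F1" using b(2) inc1 by blast
  note B = artin_schreier_extension[OF A(1) x(2) b2]
  have inc2: "?F1 \<subseteq> ?F2" by (rule simple_extension_incl[OF subfieldE(3)[OF A(1)] x(2)])
  have "x1 \<in> ?F1" "x2 \<in> ?F2"
    using simple_extension_mem[OF subfieldE(1)[OF K] x(1)]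
      simple_extension_mem[OF subfieldE(1)[OF A(1)] x(2)] by auto
  then have "K \<union> {x1, x2} \<subseteq> ?F2" using inc1 inc2 by blast
  then have "carrier R \<subseteq> ?F2"
    unfolding gen using KR x by (intro generate_field_min_subfield1[OF _ B(1)]) auto
  then have F2: "?F2 = carrier R" using subfieldE(3)[OF B(1)] by blast
  have "dimension (Polynomials.degree (Irr K x1) * Polynomials.degree (Irr ?F1 x2)) K ?F2"
    by (rule telescopic_base[OF K A(1) A(3) B(3)])
  then have "Polynomials.degree (Irr K x1) * Polynomials.degree (Irr ?F1 x2) = p ^ 3"
    unfolding F2 by (rule dimension_is_inj[OF K _ dim])
  moreover have "Polynomials.degree (Irr K x1) * Polynomials.degree (Irr ?F1 x2) \<le> p * p"
    by (rule mult_le_mono[OF A(2) B(2)])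
  moreover have "p * p < p ^ 3" using p_gt_1 by (simp add: power3_eq_cube)
  ultimately show False by simp
qed

end

locale as_tower = char_p_field +
  fixes K :: "'a set" and a0 a1 :: nat and x1 x2 x3 \<beta>1 \<beta>2 \<beta>3 :: 'a
  assumes K: "subfield K R"
    and x_closed [simp]: "x1 \<in> carrier R" "x2 \<in> carrier R" "x3 \<in> carrier R"
    and \<beta>: "\<beta>1 \<in> K" "\<beta>2 \<in> K" "\<beta>3 \<in> K"
    and eq1: "x1 [^] p \<ominus> x1 = \<beta>1" and eq2: "x2 [^] p \<ominus> x2 = \<beta>2"
    and eq3: "x3 [^] p \<ominus> x3 = third_rhs a0 a1 \<beta>2 \<beta>3 x1"
    and gen: "carrier R = generate_field R (K \<union> {x1, x2, x3})"
    and dim: "dimension (p ^ 3) K (carrier R)"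
begin

definition "F1 = simple_extension K x1"
definition "F2 = simple_extension F1 x2"

lemma KR: "K \<subseteq> carrier R"
  by (rule subfieldE(3)[OF K])

lemma \<beta>R [simp]: "\<beta>1 \<in> carrier R" "\<beta>2 \<in> carrier R" "\<beta>3 \<in> carrier R"
  using \<beta> KR by auto

lemma b1K: "x1 [^] p \<ominus> x1 \<in> K"
  by (simp add: eq1 \<beta>)

lemma F1: "subfield F1 R" "K \<subseteq> F1" "x1 \<in> F1"
  unfolding F1_def using artin_schreier_extension(1)[OF K _ b1K]
    simple_extension_incl[OF KR] simple_extension_mem[OF subfieldE(1)[OF K]] by simp_all

lemma b2F: "x2 [^] p \<ominus> x2 \<in> F1"
  using \<beta> F1(2) by (auto simp: eq2)

lemma F2: "subfield F2 R" "F1 \<subseteq> F2" "x2 \<in> F2"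
  unfolding F2_def using artin_schreier_extension(1)[OF F1(1) _ b2F]
    simple_extension_incl[OF subfieldE(3)[OF F1(1)]] simple_extension_mem[OF subfieldE(1)[OF F1(1)]]
  by simp_all

lemma in_F2: "K \<subseteq> F2" "x1 \<in> F2"
  using F1 F2 by auto

lemma D1_value_F2: "D1_value x1 \<in> F2"
  by (simp add: D1_value_def eval_int_poly_eq_ipoly ipoly_subfield[OF F2(1) in_F2(2)])

lemma b3F: "x3 [^] p \<ominus> x3 \<in> F2"
  unfolding eq3 third_rhs_def
  by (intro subringE(6,7)[OF subfieldE(1)[OF F2(1)]])
    (use emb_subfield[OF F2(1)] D1_value_F2 in_F2 \<beta> in auto)

lemma cocycle_F2: "cocycle a0 a1 x1 x2 \<in> F2"
  unfolding cocycle_def carry_def a_minus_def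
  using subringE(5-7)[OF subfieldE(1)[OF F2(1)]] emb_subfield[OF F2(1)]
    ipoly_subfield[OF F2(1) in_F2(2)] F2(3) by auto

lemma top: "simple_extension F2 x3 = carrier R"
proof
  let ?F3 = "simple_extension F2 x3"
  note A = artin_schreier_extension(1)[OF F2(1) x_closed(3) b3F]
  show "?F3 \<subseteq> carrier R" by (rule subfieldE(3)[OF A])
  have "F2 \<subseteq> ?F3" "x3 \<in> ?F3"
    using simple_extension_incl[OF subfieldE(3)[OF F2(1)]] simple_extension_mem[OF subfieldE(1)[OF F2(1)]]
    by simp_all
  then have "K \<union> {x1, x2, x3} \<subseteq> ?F3" using in_F2 F2(3) by blast
  then show "carrier R \<subseteq> ?F3"
    using KR by (subst gen) (intro generate_field_min_subfield1[OF _ A], auto)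
qed

text \<open>
  The three degrees are at most \<open>p\<close> and their product is \<open>p ^ 3\<close>.
\<close>

lemma degrees:
  "Polynomials.degree (Irr K x1) = p" "Polynomials.degree (Irr F1 x2) = p"
  "Polynomials.degree (Irr F2 x3) = p"
proof -
  note A = artin_schreier_extension[OF K x_closed(1) b1K, folded F1_def]
  note B = artin_schreier_extension[OF F1(1) x_closed(2) b2F, folded F2_def]
  note C = artin_schreier_extension[OF F2(1) x_closed(3) b3F, unfolded top]
  have "dimension (Polynomials.degree (Irr K x1) * Polynomials.degree (Irr F1 x2) *
      Polynomials.degree (Irr F2 x3)) K (carrier R)"
    by (rule telescopic_base[OF K F2(1) telescopic_base[OF K F1(1) A(3) B(3)] C(3)])
  then have "Polynomials.degree (Irr K x1) * Polynomials.degree (Irr F1 x2) *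
      Polynomials.degree (Irr F2 x3) = p ^ 3"
    by (rule dimension_is_inj[OF K _ dim])
  then show "Polynomials.degree (Irr K x1) = p" "Polynomials.degree (Irr F1 x2) = p"
    "Polynomials.degree (Irr F2 x3) = p"
    using cube_factors[OF A(2) B(2) C(2)] p_gt_1 by auto
qed

lemma hom_eqI:
  assumes f: "f \<in> ring_hom R R" and g: "g \<in> ring_hom R R"
    and "\<And>k. k \<in> K \<Longrightarrow> f k = g k" "f x1 = g x1" "f x2 = g x2" "f x3 = g x3"
    and x: "x \<in> carrier R"
  shows "f x = g x"
proof -
  have "carrier R \<subseteq> {x \<in> carrier R. f x = g x}"
    by (subst gen, rule generate_field_min_subfield1[OF _ equalizer_subfield[OF f g]])
      (use assms KR in auto)
  then show ?thesis using x by blast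
qed

text \<open>
  Extend the identity of the ground field through the three steps of the tower.
\<close>

lemma exists_hom:
  assumes y: "y1 \<in> carrier R" "y2 \<in> carrier R" "y3 \<in> carrier R"
    and e1: "y1 [^] p \<ominus> y1 = \<beta>1" and e2: "y2 [^] p \<ominus> y2 = \<beta>2"
    and e3: "y3 [^] p \<ominus> y3 = third_rhs a0 a1 \<beta>2 \<beta>3 y1"
  obtains g where "g \<in> ring_hom R R" "\<And>k. k \<in> K \<Longrightarrow> g k = k"
    "g x1 = y1" "g x2 = y2" "g x3 = y3"
proof -
  have "(\<lambda>x. x) \<in> ring_hom (R\<lparr>carrier := K\<rparr>) R"
    using KR by (intro ring_hom_memI) auto
  then obtain g1 where g1: "g1 \<in> ring_hom (R\<lparr>carrier := F1\<rparr>) R" "\<And>k. k \<in> K \<Longrightarrow> g1 k = k" "g1 x1 = y1"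
    using extend_hom[OF K x_closed(1) b1K degrees(1) _ y(1), of "\<lambda>x. x"] e1 eq1
    unfolding F1_def by auto
  have "y2 [^] p \<ominus> y2 = g1 (x2 [^] p \<ominus> x2)" using \<beta> by (simp add: e2 eq2 g1(2))
  then obtain g2 where g2: "g2 \<in> ring_hom (R\<lparr>carrier := F2\<rparr>) R" "\<And>k. k \<in> F1 \<Longrightarrow> g2 k = g1 k" "g2 x2 = y2"
    using extend_hom[OF F1(1) x_closed(2) b2F degrees(2) g1(1) y(2)] unfolding F2_def by auto
  have g2K: "g2 k = k" if "k \<in> K" for k using that g1(2) g2(2) F1(2) by auto
  have g2x1: "g2 x1 = y1" using g1(3) g2(2) F1(3) by auto
  note ha = subfield_hom_simps(1)[OF F2(1) g2(1)] and hm = subfield_hom_simps(2)[OF F2(1) g2(1)]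
  have "g2 (third_rhs a0 a1 \<beta>2 \<beta>3 x1) = third_rhs a0 a1 \<beta>2 \<beta>3 y1"
  proof -
    note FR = subringE(6,7)[OF subfieldE(1)[OF F2(1)]] and eF = emb_subfield[OF F2(1)]
    have bF: "\<beta>2 \<in> F2" "\<beta>3 \<in> F2" using \<beta> in_F2 by auto
    have w: "g2 (D1_value x1) = D1_value y1"
      using y by (simp add: D1_value_def eval_int_poly_eq_ipoly subfield_hom_ipoly[OF F2(1) g2(1) in_F2(2)] g2x1)
    show ?thesis
      unfolding third_rhs_def
      using FR eF bF D1_value_F2 in_F2 \<beta>
      by (simp add: ha hm w g2K g2x1 subfield_hom_emb[OF F2(1) g2(1)])
  qed
  then have "y3 [^] p \<ominus> y3 = g2 (x3 [^] p \<ominus> x3)" by (simp add: e3 eq3)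
  then obtain g where g: "g \<in> ring_hom R R" "\<And>k. k \<in> F2 \<Longrightarrow> g k = g2 k" "g x3 = y3"
    using extend_hom[OF F2(1) x_closed(3) b3F degrees(3) g2(1) y(3)] unfolding top by auto
  show thesis
  proof (rule that[OF g(1)])
    show "g k = k" if "k \<in> K" for k using that g(2) g2K in_F2 by auto
  qed (use g g2x1 g2(3) in_F2 F2(3) in auto)
qed

text \<open>
  The homomorphism that moves the generators as prescribed is onto: its image contains \<open>x\<^sub>1\<close> and \<open>x\<^sub>2\<close>,
  which are moved by integers, hence all of \<open>F2\<close>, in particular \<open>w\<close>, and therefore also \<open>x\<^sub>3\<close>.
\<close>

lemma exists_automorphism:
  assumes w: "w \<in> F2"
    and e3: "(x3 \<oplus> w) [^] p \<ominus> (x3 \<oplus> w) = third_rhs a0 a1 \<beta>2 \<beta>3 (x1 \<oplus> emb i)"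
  obtains s where "s \<in> carrier (Gal R K)"
    "s x1 = x1 \<oplus> emb i" "s x2 = x2 \<oplus> emb j" "s x3 = x3 \<oplus> w"
proof -
  have wR: "w \<in> carrier R" using w subfieldE(3)[OF F2(1)] by blast
  have sh: "(x \<oplus> emb n) [^] p \<ominus> (x \<oplus> emb n) = x [^] p \<ominus> x" if x: "x \<in> carrier R" for x n
  proof -
    have "(x \<oplus> emb n) [^] p = x [^] p \<oplus> emb n" using x by (simp add: frobenius_add emb_frobenius)
    moreover have "x [^] p \<in> carrier R" "emb n \<in> carrier R" using x by simp_all
    ultimately show ?thesis using x by (simp only:) algebra
  qed
  obtain g where g: "g \<in> ring_hom R R" "\<And>k. k \<in> K \<Longrightarrow> g k = k"
    "g x1 = x1 \<oplus> emb i" "g x2 = x2 \<oplus> emb j" "g x3 = x3 \<oplus> w"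
    by (rule exists_hom[of "x1 \<oplus> emb i" "x2 \<oplus> emb j" "x3 \<oplus> w"])
      (use sh wR e3 in \<open>auto simp: eq1 eq2\<close>)
  interpret g: ring_hom_ring R R g using g(1) by (intro ring_hom_ringI2) unfold_locales
  have I: "inj_on g (carrier R)" "subfield (g ` carrier R) R"
    using g.img_is_subfield[OF carrier_is_subfield one_not_zero] by auto
  let ?I = "g ` carrier R"
  note IR = subringE[OF subfieldE(1)[OF I(2)]]
  have KI: "K \<subseteq> ?I"
  proof
    fix k assume "k \<in> K"
    then show "k \<in> ?I" using g(2)[of k] KR by (intro image_eqI[of _ g k]) auto
  qed
  have sub: "x \<in> ?I" if "x \<in> carrier R" "c \<in> ?I" "g x = x \<oplus> c" for x c
  proof -
    have "g x \<in> ?I" using that by blast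
    then have "g x \<oplus> \<ominus> c \<in> ?I" using IR(5,7) that by blast
    moreover have "c \<in> carrier R" using that IR(1) by blast
    then have "(x \<oplus> c) \<oplus> \<ominus> c = x" using that(1) by algebra
    ultimately show ?thesis by (simp add: that(3))
  qed
  have I12: "x1 \<in> ?I" "x2 \<in> ?I" using sub[OF _ _ g(3)] sub[OF _ _ g(4)] emb_subfield[OF I(2)] by auto
  have "F1 \<subseteq> ?I" unfolding F1_def
    by (rule simple_extension_subring_incl[OF subfieldE(1)[OF I(2)] KI I12(1)])
  then have "F2 \<subseteq> ?I" unfolding F2_def
    by (rule simple_extension_subring_incl[OF subfieldE(1)[OF I(2)] _ I12(2)])
  then have "x3 \<in> ?I" using sub[OF _ _ g(5)] w by auto
  then have "K \<union> {x1, x2, x3} \<subseteq> ?I" using KI I12 by blast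
  then have "carrier R \<subseteq> ?I"
    using KR by (subst gen) (intro generate_field_min_subfield1[OF _ I(2)], auto)
  then have bij: "bij_betw g (carrier R) (carrier R)" using I(1) IR(1) by (auto simp: bij_betw_def)
  let ?s = "restrict g (carrier R)"
  have "?s \<in> carrier (Gal R K)"
  proof (rule Gal_memI)
    show "?s \<in> ring_hom R R" by (rule ring_hom_memI) auto
    show "bij_betw ?s (carrier R) (carrier R)" using bij by (simp cong: bij_betw_cong)
    show "?s k = k" if "k \<in> K" for k using that g(2) KR by auto
  qed simp
  then show thesis using that g by simp
qed

lemma Gal_third_rhs:
  assumes s: "s \<in> carrier (Gal R K)"
  shows "s (third_rhs a0 a1 \<beta>2 \<beta>3 x1) = third_rhs a0 a1 \<beta>2 \<beta>3 (s x1)"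
proof -
  note sD = Gal_memD[OF s]
  interpret s: ring_hom_ring R R s using sD(1) by (intro ring_hom_ringI2) unfold_locales
  show ?thesis using sD(3) \<beta> by (simp add: third_rhs_def hom_emb[OF sD(1)] hom_D1_value[OF sD(1)])
qed

text \<open>
  The element \<open>s x - x\<close> is a fixed point of the Frobenius map, hence an integer.
\<close>

lemma Gal_shift:
  assumes s: "s \<in> carrier (Gal R K)" and x: "x \<in> carrier R" and "s (x [^] p \<ominus> x) = x [^] p \<ominus> x"
  obtains i where "s x = x \<oplus> emb (int i)"
proof -
  note sD = Gal_memD[OF s]
  interpret s: ring_hom_ring R R s using sD(1) by (intro ring_hom_ringI2) unfold_locales
  have sx: "s x \<in> carrier R" using x by simp
  have e: "s x [^] p \<ominus> s x = x [^] p \<ominus> x"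
    using assms(3) x by (simp add: hom_minus[OF sD(1)] s.hom_nat_pow)
  have cl: "s x [^] p \<in> carrier R" "x [^] p \<in> carrier R" using x sx by simp_all
  have "(s x \<ominus> x) [^] p = s x [^] p \<ominus> x [^] p" using x sx by (simp add: frobenius_diff)
  also have "\<dots> = (s x [^] p \<ominus> s x) \<oplus> s x \<ominus> x [^] p" using cl sx by algebra
  also have "\<dots> = (x [^] p \<ominus> x) \<oplus> s x \<ominus> x [^] p" unfolding e ..
  also have "\<dots> = s x \<ominus> x" using cl x sx by algebra
  finally obtain i where "s x \<ominus> x = emb (int i)" using frobenius_fixed[of "s x \<ominus> x"] x sx by auto
  then show thesis using that x sx by (simp add: diff_eq_iff)
qed

lemma Gal_fixes:
  assumes s: "s \<in> carrier (Gal R K)" and s1: "s x1 = x1"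
  shows "a \<in> F1 \<Longrightarrow> s a = a" and "\<lbrakk>s x2 = x2; a \<in> F2\<rbrakk> \<Longrightarrow> s a = a"
proof -
  let ?E = "{x \<in> carrier R. s x = x}"
  note sD = Gal_memD[OF s]
  have E: "subring ?E R" by (rule subfieldE(1)[OF fixed_subfield[OF sD(1)]])
  have KE: "K \<subseteq> ?E" using sD(3) KR by auto
  have F1E: "F1 \<subseteq> ?E"
    unfolding F1_def by (rule simple_extension_subring_incl[OF E KE]) (simp add: s1)
  then show "s a = a" if "a \<in> F1" using that by blast
  have "F2 \<subseteq> ?E" if "s x2 = x2"
    unfolding F2_def by (rule simple_extension_subring_incl[OF E F1E]) (simp add: that)
  then show "s a = a" if "s x2 = x2" "a \<in> F2" using that by blast
qed

text \<open>
  Three automorphisms \<open>s1\<close>, \<open>s2\<close>, \<open>s3\<close> are prescribed on the generators.  Fixed elements descend through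
  the tower one step at a time, using \<open>s3\<close>, \<open>s2\<close>, \<open>s1\<close> in this order.  The relations of \<open>G\<close> and the
  independence of the three automorphisms are read off from the action on the generators.  Every
  automorphism moves \<open>x\<^sub>1\<close> and \<open>x\<^sub>2\<close> by integers; dividing by suitable powers of \<open>s1\<close> and \<open>s2\<close>
  leaves one that fixes both, and this is a power of \<open>s3\<close>.
\<close>

lemma tower_is_galois:
  "fixed_field R (carrier (Gal R K)) = K" "Gal R K \<cong> G_group p a0 a1"
proof -
  define u0 where "u0 = cocycle a0 a1 x1 x2"
  have u0F: "u0 \<in> F2" by (simp add: u0_def cocycle_F2)
  have u0R: "u0 \<in> carrier R" by (simp add: u0_def cocycle_closed)
  interpret Gal: group "Gal R K" by (rule group_Gal[OF KR])
  have one_pow: "\<one> [^] p = \<one>" by simp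
  have x3p: "x3 [^] p \<in> carrier R" by simp
  obtain s1 where s1: "s1 \<in> carrier (Gal R K)" "s1 x1 = x1 \<oplus> \<one>" "s1 x2 = x2" "s1 x3 = x3 \<oplus> u0"
  proof -
    have "u0 [^] p \<in> carrier R" using u0R by simp
    then have "(x3 \<oplus> u0) [^] p \<ominus> (x3 \<oplus> u0) = (x3 [^] p \<ominus> x3) \<oplus> (u0 [^] p \<ominus> u0)"
      unfolding frobenius_add[OF x_closed(3) u0R] using u0R x3p x_closed(3) by algebra
    also have "\<dots> = third_rhs a0 a1 \<beta>2 \<beta>3 (x1 \<oplus> emb 1)"
      by (simp add: eq3 u0_def third_rhs_shift[OF _ _ eq2])
    finally have e: "(x3 \<oplus> u0) [^] p \<ominus> (x3 \<oplus> u0) = third_rhs a0 a1 \<beta>2 \<beta>3 (x1 \<oplus> emb 1)" .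
    obtain s where "s \<in> carrier (Gal R K)" "s x1 = x1 \<oplus> emb 1" "s x2 = x2 \<oplus> emb 0" "s x3 = x3 \<oplus> u0"
      by (rule exists_automorphism[OF u0F e])
    then show thesis by (intro that[of s]) simp_all
  qed
  obtain s2 where s2: "s2 \<in> carrier (Gal R K)" "s2 x1 = x1" "s2 x2 = x2 \<oplus> \<one>" "s2 x3 = x3"
  proof -
    have e: "(x3 \<oplus> \<zero>) [^] p \<ominus> (x3 \<oplus> \<zero>) = third_rhs a0 a1 \<beta>2 \<beta>3 (x1 \<oplus> emb 0)" by (simp add: eq3)
    obtain s where "s \<in> carrier (Gal R K)" "s x1 = x1 \<oplus> emb 0" "s x2 = x2 \<oplus> emb 1" "s x3 = x3 \<oplus> \<zero>"
      by (rule exists_automorphism[OF subringE(2)[OF subfieldE(1)[OF F2(1)]] e])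
    then show thesis by (intro that[of s]) simp_all
  qed
  obtain s3 where s3: "s3 \<in> carrier (Gal R K)" "s3 x1 = x1" "s3 x2 = x2" "s3 x3 = x3 \<oplus> \<one>"
  proof -
    have "(x3 \<oplus> \<one>) [^] p \<ominus> (x3 \<oplus> \<one>) = x3 [^] p \<ominus> x3"
      unfolding frobenius_add[OF x_closed(3) one_closed] one_pow using x3p x_closed(3) by algebra
    also have "\<dots> = third_rhs a0 a1 \<beta>2 \<beta>3 (x1 \<oplus> emb 0)" by (simp add: eq3)
    finally have e: "(x3 \<oplus> \<one>) [^] p \<ominus> (x3 \<oplus> \<one>) = third_rhs a0 a1 \<beta>2 \<beta>3 (x1 \<oplus> emb 0)" .
    obtain s where "s \<in> carrier (Gal R K)" "s x1 = x1 \<oplus> emb 0" "s x2 = x2 \<oplus> emb 0" "s x3 = x3 \<oplus> \<one>"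
      by (rule exists_automorphism[OF subringE(3)[OF subfieldE(1)[OF F2(1)]] e])
    then show thesis by (intro that[of s]) simp_all
  qed
  note D1 = Gal_memD[OF s1(1)] and D2 = Gal_memD[OF s2(1)] and D3 = Gal_memD[OF s3(1)]
  note h1 = D1(1) and h2 = D2(1) and h3 = D3(1)
  interpret s1: ring_hom_ring R R s1 using h1 by (intro ring_hom_ringI2) unfold_locales
  interpret s2: ring_hom_ring R R s2 using h2 by (intro ring_hom_ringI2) unfold_locales
  interpret s3: ring_hom_ring R R s3 using h3 by (intro ring_hom_ringI2) unfold_locales
  show "fixed_field R (carrier (Gal R K)) = K"
  proof
    show "K \<subseteq> fixed_field R (carrier (Gal R K))"
    proof
      fix k assume k: "k \<in> K"
      then have "\<forall>s\<in>carrier (Gal R K). s k = k" by (blast intro: Gal_memD(3))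
      then show "k \<in> fixed_field R (carrier (Gal R K))" using k KR by (auto simp: fixed_field_def)
    qed
    show "fixed_field R (carrier (Gal R K)) \<subseteq> K"
    proof
      fix z assume "z \<in> fixed_field R (carrier (Gal R K))"
      then have z: "z \<in> carrier R" "s1 z = z" "s2 z = z" "s3 z = z"
        using s1 s2 s3 by (auto simp: fixed_field_def)
      have "z \<in> simple_extension F2 x3" using z by (simp add: top)
      then have "z \<in> F2"
        by (intro fixed_in_simple_extension[OF h3 F2(1) Gal_fixes(2)[OF s3(1-3)] x_closed(3) b3F s3(4) _ z(4)])
      then have "z \<in> simple_extension F1 x2" unfolding F2_def .
      then have "z \<in> F1"
        by (intro fixed_in_simple_extension[OF h2 F1(1) Gal_fixes(1)[OF s2(1,2)] x_closed(2) b2F s2(3) _ z(3)])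
      then have "z \<in> simple_extension K x1" unfolding F1_def .
      then show "z \<in> K"
        by (intro fixed_in_simple_extension[OF h1 K D1(3) x_closed(1) b1K s1(2) _ z(2)])
    qed
  qed
  have eqI: "f = g" if f: "f \<in> carrier (Gal R K)" and g: "g \<in> carrier (Gal R K)"
    and "f x1 = g x1" "f x2 = g x2" "f x3 = g x3" for f g
    by (rule Gal_eqI[OF f g], rule hom_eqI[OF Gal_memD(1)[OF f] Gal_memD(1)[OF g]])
      (use that Gal_memD(3)[OF f] Gal_memD(3)[OF g] in simp_all)
  note pa = Gal_pow_apply[OF KR] and ma = Gal_mult_apply
  have p11: "(s1 ^^ n) x1 = x1 \<oplus> emb (int n)" for n
    by (rule orbit[OF h1 x_closed(1) s1(2)])
  have p22: "(s2 ^^ n) x2 = x2 \<oplus> emb (int n)" for n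
    by (rule orbit[OF h2 x_closed(2) s2(3)])
  have p33: "(s3 ^^ n) x3 = x3 \<oplus> emb (int n)" for n
    by (rule orbit[OF h3 x_closed(3) s3(4)])
  have pf: "(s1 ^^ n) x2 = x2" "(s2 ^^ n) x1 = x1" "(s2 ^^ n) x3 = x3"
    "(s3 ^^ n) x1 = x1" "(s3 ^^ n) x2 = x2" for n
    by (simp_all add: orbit_fixed s1 s2 s3)
  have p13: "(s1 ^^ p) x3 = x3 \<oplus> emb (int a1)"
  proof -
    have d: "delta s1 x3 = u0" unfolding delta_def using u0R by (simp add: s1 diff_eq_iff)
    have "Suc (p - 1) = p" using p_gt_1 by simp
    then have "(delta s1 ^^ p) x3 = (delta s1 ^^ (p - 1)) (delta s1 x3)"
      by (metis funpow_swap1 funpow_simps_right(2) comp_apply)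
    also have "\<dots> = emb (int a1)"
      unfolding d u0_def by (rule delta_iter_cocycle[OF h1]) (simp_all add: s1)
    finally show ?thesis
      unfolding delta_iter_p[OF h1 x_closed(3)] by (simp add: diff_eq_iff hom_iter_closed[OF h1])
  qed
  have s2u0: "s2 u0 = u0 \<oplus> emb (int a0)"
  proof -
    have "s2 u0 = emb (int a0) \<otimes> (x2 \<oplus> \<one>) \<ominus> emb (int a1) \<otimes> carry x1"
      by (simp add: u0_def cocycle_def hom_minus[OF h2] hom_emb[OF h2] hom_carry[OF h2] s2)
    also have "\<dots> = u0 \<oplus> emb (int a0)"
      unfolding u0_def cocycle_def by (simp add: r_distr a_minus_def a_ac)
    finally show ?thesis .
  qed
  have s3u0: "s3 u0 = u0"
    by (simp add: u0_def cocycle_def hom_minus[OF h3] hom_emb[OF h3] hom_carry[OF h3] s3)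
  note sc = s1(1) s2(1) s3(1)
  have one_mem: "(\<lambda>x\<in>carrier R. x) \<in> carrier (Gal R K)"
    using Gal.one_closed by (simp add: Gal_one)
  interpret G: G_relations "Gal R K" p a0 a1 s1 s2 s3
  proof
    show "s1 \<in> carrier (Gal R K)" "s2 \<in> carrier (Gal R K)" "s3 \<in> carrier (Gal R K)" by (fact sc)+
    show "p > 0" using p_gt_1 by simp
    show "s1 [^]\<^bsub>Gal R K\<^esub> p = s3 [^]\<^bsub>Gal R K\<^esub> a1"
      by (rule eqI) (simp_all add: sc pa p11 pf p13 p33)
    show "s2 [^]\<^bsub>Gal R K\<^esub> p = \<one>\<^bsub>Gal R K\<^esub>"
      by (rule eqI) (simp_all add: sc pa p22 pf Gal_one one_mem)
    show "s3 [^]\<^bsub>Gal R K\<^esub> p = \<one>\<^bsub>Gal R K\<^esub>"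
      by (rule eqI) (simp_all add: sc pa p33 pf Gal_one one_mem)
    show "s2 \<otimes>\<^bsub>Gal R K\<^esub> s1 = s1 \<otimes>\<^bsub>Gal R K\<^esub> s2 \<otimes>\<^bsub>Gal R K\<^esub> s3 [^]\<^bsub>Gal R K\<^esub> a0"
      by (rule eqI)
        (simp_all add: sc ma pa pf p33 s1 s2 s2u0 u0R hom_emb[OF h1] hom_emb[OF h2] a_assoc)
    show "s3 \<otimes>\<^bsub>Gal R K\<^esub> s1 = s1 \<otimes>\<^bsub>Gal R K\<^esub> s3"
      by (rule eqI) (simp_all add: sc ma s1 s3 s3u0 u0R a_ac)
    show "s3 \<otimes>\<^bsub>Gal R K\<^esub> s2 = s2 \<otimes>\<^bsub>Gal R K\<^esub> s3"
      by (rule eqI) (simp_all add: sc ma s2 s3)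
  qed
  have nf1: "(G.nf i j k) x1 = x1 \<oplus> emb (int i)" for i j k
    by (simp add: G.nf_def sc ma pa pf p11)
  have nf2: "(G.nf i j k) x2 = x2 \<oplus> emb (int j)" for i j k
    by (simp add: G.nf_def sc ma pa pf p22 hom_iter_closed[OF h1] hom_iter_closed[OF h2])
      (induction i; simp add: s1 hom_emb[OF h1])
  show "Gal R K \<cong> G_group p a0 a1"
  proof (rule G.iso_G_group)
    fix i j k assume one: "G.nf i j k = \<one>\<^bsub>Gal R K\<^esub>"
    have "x1 \<oplus> emb (int i) = x1" "x2 \<oplus> emb (int j) = x2"
      using nf1[of i j k] nf2[of i j k] by (simp_all add: one Gal_one)
    then have "emb (int i) = \<zero>" "emb (int j) = \<zero>" by simp_all
    then show "p dvd i \<and> p dvd j" by (simp add: emb_eq_0_iff)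
  next
    fix k :: nat assume "s3 [^]\<^bsub>Gal R K\<^esub> k = \<one>\<^bsub>Gal R K\<^esub>"
    then have "x3 \<oplus> emb (int k) = x3" using pa[OF sc(3) x_closed(3), of k] by (simp add: p33 Gal_one)
    then have "emb (int k) = \<zero>" by simp
    then show "p dvd k" by (simp add: emb_eq_0_iff)
  next
    fix \<tau> assume \<tau>: "\<tau> \<in> carrier (Gal R K)"
    note TD = Gal_memD[OF \<tau>]
    obtain i where i: "\<tau> x1 = x1 \<oplus> emb (int i)"
      by (rule Gal_shift[OF \<tau> x_closed(1)]) (simp_all add: eq1 TD(3) \<beta>)
    obtain j where j: "\<tau> x2 = x2 \<oplus> emb (int j)"
      by (rule Gal_shift[OF \<tau> x_closed(2)]) (simp_all add: eq2 TD(3) \<beta>)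
    (* dividing tau by rho leaves an automorphism t that fixes x1 and x2 *)
    define \<rho> where "\<rho> = G.nf i j 0"
    have \<rho>: "\<rho> \<in> carrier (Gal R K)" by (simp add: \<rho>_def)
    define t where "t = inv\<^bsub>Gal R K\<^esub> \<rho> \<otimes>\<^bsub>Gal R K\<^esub> \<tau>"
    have t: "t \<in> carrier (Gal R K)" using \<rho> \<tau> by (simp add: t_def)
    have fac: "\<tau> = \<rho> \<otimes>\<^bsub>Gal R K\<^esub> t"
      using \<rho> \<tau> by (simp add: t_def Gal.m_assoc[symmetric])
    have inj: "inj_on \<rho> (carrier R)" using Gal_memD(2)[OF \<rho>] by (simp add: Bij_def bij_betw_def)
    have fixd: "t x = x" if "x \<in> carrier R" "\<tau> x = \<rho> x" for x
    proof -
      have "\<rho> (t x) = \<rho> x" using that fac ma[OF \<rho> t that(1)] by simp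
      then show ?thesis using inj_onD[OF inj] Gal_memD(4)[OF t] that(1) by blast
    qed
    have t1: "t x1 = x1" and t2: "t x2 = x2"
      using fixd i j nf1 nf2 by (simp_all add: \<rho>_def)
    obtain k where k: "t x3 = x3 \<oplus> emb (int k)"
      by (rule Gal_shift[OF t x_closed(3)]) (simp_all add: eq3 Gal_third_rhs[OF t] t1)
    have "t = s3 [^]\<^bsub>Gal R K\<^esub> k"
      by (rule eqI) (simp_all add: t sc pa pf p33 t1 t2 k)
    then have "\<tau> = G.nf i j k" using fac sc by (simp add: \<rho>_def G.nf_def)
    then show "\<tau> \<in> G.NF" by blast
  qed
qed

end

section \<open>Extensions with Galois group \<open>G\<close>\<close>

text \<open>
  The natural numbers that annihilate 1 are the multiples of the additive order of 1, which is 0 when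
  that order is infinite; their greatest common divisor is this order.
\<close>

lemma (in field) char_from_subfield:
  assumes "Factorial_Ring.prime p" and c: "ring_char (R\<lparr>carrier := K\<rparr>) = p"
  shows "add_pow R p \<one> = \<zero>"
proof -
  have pow: "add_pow (R\<lparr>carrier := K\<rparr>) n \<one> = add_pow R n \<one>" for n :: nat
    by (induction n) (simp_all add: add_pow_def)
  define d where "d = group.ord (add_monoid R) \<one>"
  have d: "add_pow R n \<one> = \<zero> \<longleftrightarrow> d dvd n" for n :: nat
    using group.pow_eq_id[OF a_group, of "\<one>" n] by (simp add: d_def add_pow_def)
  have "p = Gcd {n. d dvd n}"
    using c unfolding ring_char_def by (simp add: pow d)
  also have "\<dots> = d"
    by (rule dvd_antisym) (auto intro: Gcd_dvd Gcd_greatest)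
  finally show ?thesis by (simp add: d)
qed

context char_p_field begin

lemma fixed_generates:
  assumes h: "\<tau> \<in> ring_hom R R" and per: "\<And>z. z \<in> carrier R \<Longrightarrow> (\<tau> ^^ p) z = z"
    and x: "x \<in> carrier R" "\<tau> x = x \<oplus> \<one>"
    and T: "subfield T R" "x \<in> T" "\<And>z. \<lbrakk>z \<in> carrier R; \<tau> z = z\<rbrakk> \<Longrightarrow> z \<in> T"
  shows "carrier R = T"
proof
  show "carrier R \<subseteq> T"
  proof
    fix z assume z: "z \<in> carrier R"
    have "(delta \<tau> ^^ p) z = \<zero>" using z by (simp add: delta_iter_p[OF h] per a_minus_def r_neg)
    then show "z \<in> T" using generated_over_fixed[OF h x T z order_refl] by blast
  qed
qed (rule subfieldE(3)[OF T(1)])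

lemma third_rhs_eq:
  assumes "\<beta>2 \<in> carrier R" "x \<in> carrier R"
  shows "add_pow R a0 (\<beta>2 \<otimes> x) \<oplus> add_pow R a1 (eval_int_poly R (D1 p) x) \<oplus> \<beta>3 = third_rhs a0 a1 \<beta>2 \<beta>3 x"
  using assms D1_value_closed[OF assms(2)]
  by (simp add: third_rhs_def add_pow_eq_emb D1_value_def[symmetric])

lemma artin_schreier_witt_generator:
  assumes K: "subfield K R" and dim: "dimension (p ^ 3) K (carrier R)"
    and gal: "galois_extension R K" and iso: "\<phi> \<in> iso (G_group p a0 a1) (Gal R K)"
    and \<sigma>: "\<sigma>1 = \<phi> (G_gen p a0 a1 S1)" "\<sigma>2 = \<phi> (G_gen p a0 a1 S2)" "\<sigma>3 = \<phi> (G_gen p a0 a1 S3)"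
    and K2: "K2 = fixed_field R (generate (Gal R K) {\<sigma>3})"
    and K1: "K1 = fixed_field R (generate (Gal R K) {\<sigma>2, \<sigma>3})"
    and x: "x1 \<in> K1" "x2 \<in> K2" and K2g: "K2 = generate_field R (K \<union> {x1, x2})"
    and sx: "\<sigma>1 x1 \<ominus> x1 = \<one>" "\<sigma>2 x2 \<ominus> x2 = \<one>" "\<sigma>1 x2 \<ominus> x2 = \<zero>"
    and \<beta>: "\<beta>1 \<in> K" "\<beta>2 \<in> K" and w: "wp R p x1 = \<beta>1" "wp R p x2 = \<beta>2"
  shows "\<exists>x3 \<in> carrier R.
              \<sigma>3 x3 \<ominus> x3 = \<one>
              \<and> carrier R = generate_field R (K \<union> {x1, x2, x3})
              \<and> (\<exists>\<beta>3 \<in> K. x3 [^] p \<ominus> x3 =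
                    add_pow R a0 (\<beta>2 \<otimes> x1) \<oplus> add_pow R a1 (eval_int_poly R (D1 p) x1) \<oplus> \<beta>3)"
proof -
  have KR: "K \<subseteq> carrier R" by (rule subfieldE(3)[OF K])
  have p0: "p > 0" using p_gt_1 by simp
  interpret Gal: group "Gal R K" by (rule group_Gal[OF KR])
  interpret P: G_relations "G_group p a0 a1" p a0 a1
    "G_gen p a0 a1 S1" "G_gen p a0 a1 S2" "G_gen p a0 a1 S3"
    by (rule G_group_relations[OF p0])
  have hom: "\<phi> \<in> hom (G_group p a0 a1) (Gal R K)" using iso by (simp add: iso_def)
  interpret \<phi>: group_hom "G_group p a0 a1" "Gal R K" \<phi>
    using hom by (simp add: group_hom_def group_hom_axioms_def P.is_group Gal.is_group)
  have rel: "G_relations (Gal R K) p a0 a1 \<sigma>1 \<sigma>2 \<sigma>3"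
    unfolding \<sigma> by (rule G_relations_hom[OF P.G_relations_axioms hom Gal.is_group])
  interpret G: G_relations "Gal R K" p a0 a1 \<sigma>1 \<sigma>2 \<sigma>3 by (rule rel)
  have K2': "K2 = {z \<in> carrier R. \<sigma>3 z = z}"
    unfolding K2 by (subst fixed_field_generate[OF KR]) auto
  have K1': "K1 = {z \<in> carrier R. \<sigma>2 z = z \<and> \<sigma>3 z = z}"
    unfolding K1 by (subst fixed_field_generate[OF KR]) auto
  have x1: "x1 \<in> carrier R" "\<sigma>2 x1 = x1" "\<sigma>3 x1 = x1" using x(1) K1' by auto
  have x2: "x2 \<in> carrier R" "\<sigma>3 x2 = x2" using x(2) K2' by auto
  note cl = Gal_memD(4)[OF G.s_closed(1)] Gal_memD(4)[OF G.s_closed(2)]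
  have s1: "\<sigma>1 x1 = x1 \<oplus> \<one>" "\<sigma>1 x2 = x2" and s2: "\<sigma>2 x2 = x2 \<oplus> \<one>"
    using sx x1(1) x2(1) cl by (simp_all add: diff_eq_iff)
  have wp: "x1 [^] p \<ominus> x1 = \<beta>1" "x2 [^] p \<ominus> x2 = \<beta>2" using w by (simp_all add: wp_def)
  have nt: "\<exists>z\<in>carrier R. \<sigma>3 z \<noteq> z"
  proof (rule ccontr)
    assume "\<not> ?thesis"
    then have "carrier R = generate_field R (K \<union> {x1, x2})" using K2' K2g by auto
    then show False
      using two_step_dimension[OF K x1(1) x2(1)] wp \<beta> dim by simp
  qed
  have fixK: "z \<in> K" if z: "z \<in> carrier R" "\<sigma>1 z = z" "\<sigma>2 z = z" "\<sigma>3 z = z" for z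
  proof -
    have "s z = z" if s: "s \<in> carrier (Gal R K)" for s
    proof -
      obtain g where g: "g \<in> carrier (G_group p a0 a1)" "s = \<phi> g"
        using s iso by (auto simp: iso_def bij_betw_def)
      obtain i j k where "g = P.nf i j k" using G_group_normal_form[OF p0 g(1)] by blast
      then have "s = G.nf i j k"
        unfolding g(2) P.nf_def G.nf_def by (simp add: \<phi>.hom_nat_pow \<sigma>)
      then show ?thesis
        using z by (simp add: G.nf_def Gal_mult_apply Gal_pow_apply[OF KR] orbit_fixed)
    qed
    then have "z \<in> fixed_field R (carrier (Gal R K))" using z(1) by (simp add: fixed_field_def)
    then show ?thesis using gal by (simp add: galois_extension_def)
  qed
  obtain x3 \<beta>3 where x3: "x3 \<in> carrier R" "\<sigma>3 x3 = x3 \<oplus> \<one>" and \<beta>3: "\<beta>3 \<in> K"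
    and eq: "x3 [^] p \<ominus> x3 = third_rhs a0 a1 \<beta>2 \<beta>3 x1"
    by (rule corrected_generator[OF KR rel nt fixK x1(1) x2(1) s1 x1(2) s2 x1(3) x2(2) wp(2) \<beta>(2)])
  let ?T = "generate_field R (K \<union> {x1, x2, x3})"
  have sub: "K \<union> {x1, x2, x3} \<subseteq> carrier R" using KR x1 x2 x3 by auto
  have "carrier R = ?T"
  proof (rule fixed_generates[OF Gal_memD(1)[OF G.s_closed(3)] _ x3])
    show "(\<sigma>3 ^^ p) z = z" if "z \<in> carrier R" for z
      using fun_cong[OF G.rel3, of z] that by (simp add: Gal_pow_apply[OF KR] Gal_one)
    show "subfield ?T R" by (rule generate_field_is_subfield[OF sub])
    show "x3 \<in> ?T" by (rule generate_field.incl) simp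
    fix z assume "z \<in> carrier R" "\<sigma>3 z = z"
    then have "z \<in> generate_field R (K \<union> {x1, x2})" using K2' K2g by auto
    then show "z \<in> ?T" using mono_generate_field[OF _ sub, of "K \<union> {x1, x2}"] by auto
  qed
  moreover have "\<sigma>3 x3 \<ominus> x3 = \<one>" using x3 by (simp add: diff_eq_iff)
  moreover have "x3 [^] p \<ominus> x3 =
      add_pow R a0 (\<beta>2 \<otimes> x1) \<oplus> add_pow R a1 (eval_int_poly R (D1 p) x1) \<oplus> \<beta>3"
    using eq \<beta> KR x1(1) by (subst third_rhs_eq) auto
  ultimately show ?thesis
    using x3(1) \<beta>3 by blast
qed

end

theorem proposition2p2:
  fixes p a0 a1 :: nat
    and K3 :: "('a, 'b) ring_scheme" (structure)
    and K0 :: "'a set"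
  assumes "Factorial_Ring.prime p" and "odd p"
    and "a0 < p" and "a1 < p"
    and "field K3" and "subfield K0 K3"
    and "ring_char (K3\<lparr>carrier := K0\<rparr>) = p"
    and "ring.dimension K3 (p ^ 3) K0 (carrier K3)"
  shows
    "(\<forall>\<phi> \<sigma>1 \<sigma>2 \<sigma>3 K1 K2 x1 x2 \<beta>1 \<beta>2.
        galois_extension K3 K0
        \<and> \<phi> \<in> iso (G_group p a0 a1) (Gal K3 K0)
        \<and> \<sigma>1 = \<phi> (G_gen p a0 a1 S1)
        \<and> \<sigma>2 = \<phi> (G_gen p a0 a1 S2)
        \<and> \<sigma>3 = \<phi> (G_gen p a0 a1 S3)
        \<and> K2 = fixed_field K3 (generate (Gal K3 K0) {\<sigma>3})
        \<and> K1 = fixed_field K3 (generate (Gal K3 K0) {\<sigma>2, \<sigma>3})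
        \<and> x1 \<in> K1 \<and> x2 \<in> K2
        \<and> K1 = generate_field K3 (K0 \<union> {x1})
        \<and> K2 = generate_field K3 (K0 \<union> {x1, x2})
        \<and> \<sigma>1 x1 \<ominus> x1 = \<one> \<and> \<sigma>2 x2 \<ominus> x2 = \<one> \<and> \<sigma>1 x2 \<ominus> x2 = \<zero>
        \<and> \<beta>1 \<in> K0 \<and> \<beta>2 \<in> K0 \<and> wp K3 p x1 = \<beta>1 \<and> wp K3 p x2 = \<beta>2
        \<longrightarrow> (\<exists>x3 \<in> carrier K3.
              \<sigma>3 x3 \<ominus> x3 = \<one>
              \<and> carrier K3 = generate_field K3 (K0 \<union> {x1, x2, x3})
              \<and> (\<exists>\<beta>3 \<in> K0. x3 [^] p \<ominus> x3 =
                    add_pow K3 a0 (\<beta>2 \<otimes> x1) \<oplus> add_pow K3 a1 (eval_int_poly K3 (D1 p) x1) \<oplus> \<beta>3)))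
     \<and>
     (\<forall>x1 x2 x3 \<beta>1 \<beta>2 \<beta>3.
        algebraic_extension K3 K0
        \<and> x1 \<in> carrier K3 \<and> x2 \<in> carrier K3 \<and> x3 \<in> carrier K3
        \<and> carrier K3 = generate_field K3 (K0 \<union> {x1, x2, x3})
        \<and> \<beta>1 \<in> K0 \<and> \<beta>2 \<in> K0 \<and> \<beta>3 \<in> K0
        \<and> wp K3 p x1 = \<beta>1 \<and> wp K3 p x2 = \<beta>2
        \<and> wp K3 p x3 = add_pow K3 a0 (\<beta>2 \<otimes> x1) \<oplus> add_pow K3 a1 (eval_int_poly K3 (D1 p) x1) \<oplus> \<beta>3
        \<longrightarrow> galois_extension K3 K0 \<and> Gal K3 K0 \<cong> G_group p a0 a1)"
proof -
  interpret field K3 by fact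
  have char: "add_pow K3 p \<one> = \<zero>" by (rule char_from_subfield[OF assms(1,7)])
  interpret char_p_field K3 p by unfold_locales (fact assms(1) assms(2) char)+
  have KR: "K0 \<subseteq> carrier K3" by (rule subfieldE(3)[OF assms(6)])
  show ?thesis
  proof (intro conjI allI impI; (elim conjE)?)
    fix \<phi> \<sigma>1 \<sigma>2 \<sigma>3 K1 K2 x1 x2 \<beta>1 \<beta>2
    assume "galois_extension K3 K0" "\<phi> \<in> iso (G_group p a0 a1) (Gal K3 K0)"
      "\<sigma>1 = \<phi> (G_gen p a0 a1 S1)" "\<sigma>2 = \<phi> (G_gen p a0 a1 S2)" "\<sigma>3 = \<phi> (G_gen p a0 a1 S3)"
      "K2 = fixed_field K3 (generate (Gal K3 K0) {\<sigma>3})"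
      "K1 = fixed_field K3 (generate (Gal K3 K0) {\<sigma>2, \<sigma>3})"
      "x1 \<in> K1" "x2 \<in> K2" "K2 = generate_field K3 (K0 \<union> {x1, x2})"
      "\<sigma>1 x1 \<ominus> x1 = \<one>" "\<sigma>2 x2 \<ominus> x2 = \<one>" "\<sigma>1 x2 \<ominus> x2 = \<zero>"
      "\<beta>1 \<in> K0" "\<beta>2 \<in> K0" "wp K3 p x1 = \<beta>1" "wp K3 p x2 = \<beta>2"
    then show "\<exists>x3 \<in> carrier K3.
              \<sigma>3 x3 \<ominus> x3 = \<one>
              \<and> carrier K3 = generate_field K3 (K0 \<union> {x1, x2, x3})
              \<and> (\<exists>\<beta>3 \<in> K0. x3 [^] p \<ominus> x3 =
                    add_pow K3 a0 (\<beta>2 \<otimes> x1) \<oplus> add_pow K3 a1 (eval_int_poly K3 (D1 p) x1) \<oplus> \<beta>3)"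
      by (rule artin_schreier_witt_generator[OF assms(6,8)])
  next
    fix x1 x2 x3 \<beta>1 \<beta>2 \<beta>3
    assume A: "x1 \<in> carrier K3" "x2 \<in> carrier K3" "x3 \<in> carrier K3"
        "carrier K3 = generate_field K3 (K0 \<union> {x1, x2, x3})"
        "\<beta>1 \<in> K0" "\<beta>2 \<in> K0" "\<beta>3 \<in> K0" "wp K3 p x1 = \<beta>1" "wp K3 p x2 = \<beta>2"
        "wp K3 p x3 = add_pow K3 a0 (\<beta>2 \<otimes> x1) \<oplus> add_pow K3 a1 (eval_int_poly K3 (D1 p) x1) \<oplus> \<beta>3"
    have "\<beta>2 \<in> carrier K3" using A(6) KR by blast
    then have "x3 [^] p \<ominus> x3 = third_rhs a0 a1 \<beta>2 \<beta>3 x1"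
      using A(10) third_rhs_eq[of \<beta>2 x1 a0 a1 \<beta>3] A(1) by (simp add: wp_def)
    then interpret as_tower K3 p K0 a0 a1 x1 x2 x3 \<beta>1 \<beta>2 \<beta>3
      using A(1-7) A(8,9)[unfolded wp_def] assms(6,8)
      by (intro as_tower.intro as_tower_axioms.intro char_p_field_axioms)
    show "Gal K3 K0 \<cong> G_group p a0 a1" by (rule tower_is_galois(2))
    assume "algebraic_extension K3 K0"
    then show "galois_extension K3 K0"
      using tower_is_galois(1) by (simp add: galois_extension_def)
  qed
qed

end
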